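(* Let $(M,d)$ be a complete metric space with base point $0$ and let $\mu,\nu$ be Radon probability measures on $M^{\mathcal{R}}$ with finite first $\bar{d}$-moment. Then $$\inf_{\pi\in\Pi(\mu,\nu)}\int_{M^{\mathcal{R}}\times M^{\mathcal{R}}}\bar{d}\,d\pi=\sup_{f}\int_{M^{\mathcal{R}}}f^{\mathcal{R}}\,d(\mu-\nu),$$ where the supremum runs over all $1$-Lipschitz functions $f:M\to\mathbb{R}$. The infimum is attained, and $\pi\in\Pi(\mu,\nu)$ minimises the left-hand side if and only if it is concentrated on a $\bar{d}$-cyclically monotonic subset of $M^{\mathcal{R}}\times M^{\mathcal{R}}$.
   Context: $(M,d)$ is a complete metric space with base point $0\in M$. $\mathrm{Lip}_0(M)$ is the Banach space of real-valued Lipschitz functions $f$ on $M$ with $f(0)=0$, normed by the optimal Lipschitz constant. $M^{\mathcal{U}}$ is the uniform (Samuel) compactification of $M$: the unique compactification to which every bounded uniformly continuous $f:M\to\mathbb{R}$ extends continuously and in which the closures of $A,B\subset M$ are disjoint iff $d(A,B)>0$. Every Lipschitz $f:M\to\mathbb{R}$ extends uniquely and continuously to $f^{\mathcal{U}}:M^{\mathcal{U}}\to[-\infty,\infty]$. With $\rho(x)=d(x,0)$, let $M^{\mathcal{R}}=\{\xi\in M^{\mathcal{U}}:\rho^{\mathcal{U}}(\xi)<\infty\}$, with the subspace topology $\tau$, and $f^{\mathcal{R}}=f^{\mathcal{U}}|_{M^{\mathcal{R}}}$ (real-valued). For $\xi\in M^{\mathcal{R}}$, $\delta(\xi)\in\mathrm{Lip}_0(M)^*$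 is $\langle f,\delta(\xi)\rangle=f^{\mathcal{R}}(\xi)$, and $\bar{d}(\xi,\eta)=\|\delta(\xi)-\delta(\eta)\|_{\mathrm{Lip}_0(M)^*}$, a metric on $M^{\mathcal{R}}$ extending $d$. Borel and Radon measures on $M^{\mathcal{R}}$ and $M^{\mathcal{R}}\times M^{\mathcal{R}}$ refer to the topology $\tau$ (and its product), not to $\bar{d}$. A Radon measure is a finite, Borel, countably additive measure which is regular and tight. $\mu$ has finite first $\bar{d}$-moment if $\int\bar{d}(\xi,\xi_0)\,d\mu(\xi)<\infty$ for some (hence all) $\xi_0\in M^{\mathcal{R}}$. $\Pi(\mu,\nu)$ is the set of Radon probability measures on $M^{\mathcal{R}}\times M^{\mathcal{R}}$ with first marginal $\mu$ and second marginal $\nu$. A measure is "concentrated on $C$" if $C$ is measurable for it and the complement of $C$ is null. A set $C\subset M^{\mathcal{R}}\times M^{\mathcal{R}}$ is $\bar{d}$-cyclically monotonic if for all $(\xi_1,\eta_1),\dots,(\xi_n,\eta_n)\in C$ and every permutation $\sigma$ of $\{1,\dots,n\}$, $\sum_{k=1}^n\bar{d}(\xi_k,\eta_k)\leq\sum_{k=1}^n\bar{d}(\xi_k,\eta_{\sigma(k)})$. *)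

theory Defs
  imports "HOL-Probability.Probability"
begin

text \<open>
  A compactification of the metric space \<^typ>\<open>'a\<close> is a map \<open>\<iota>\<close> into a Hausdorff space \<^typ>\<open>'u\<close>.
  The case of empty sets is excluded because the library sets \<^const>\<open>setdist\<close> to \<open>0\<close> there,
  whereas the convention \<open>inf {} = \<infinity>\<close> makes the condition hold trivially.
\<close>

definition compactification :: "('a::topological_space \<Rightarrow> 'u::t2_space) \<Rightarrow> bool" where
  "compactification \<iota> \<longleftrightarrow>
     compact (UNIV :: 'u set) \<and> closure (range \<iota>) = UNIV \<and>
     (\<exists>g. homeomorphism UNIV (range \<iota>) \<iota> g)"

definition uniform_compactification :: "('a::metric_space \<Rightarrow> 'u::t2_space) \<Rightarrow> bool" where
  "uniform_compactification \<iota> \<longleftrightarrow>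
     compactification \<iota> \<and>
     (\<forall>f :: 'a \<Rightarrow> real. bounded (range f) \<and> uniformly_continuous_on UNIV f \<longrightarrow>
        (\<exists>g :: 'u \<Rightarrow> real. continuous_on UNIV g \<and> (\<forall>x. g (\<iota> x) = f x))) \<and>
     (\<forall>A B. A \<noteq> {} \<and> B \<noteq> {} \<longrightarrow>
        (closure (\<iota> ` A) \<inter> closure (\<iota> ` B) = {} \<longleftrightarrow> 0 < setdist A B))"

definition extU :: "('a \<Rightarrow> 'u::topological_space) \<Rightarrow> ('a \<Rightarrow> real) \<Rightarrow> 'u \<Rightarrow> ereal" where
  "extU \<iota> f = (THE g. continuous_on UNIV g \<and> (\<forall>x. g (\<iota> x) = ereal (f x)))"

definition MR :: "('a::metric_space \<Rightarrow> 'u::topological_space) \<Rightarrow> 'a \<Rightarrow> 'u set" where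
  "MR \<iota> z = {\<xi>. extU \<iota> (\<lambda>x. dist x z) \<xi> < \<infinity>}"

text \<open>For Lipschitz \<open>f\<close>, the values of \<^const>\<open>extU\<close> on \<^const>\<open>MR\<close> are finite; \<open>extR\<close> is used only there.\<close>

definition extR :: "('a \<Rightarrow> 'u::topological_space) \<Rightarrow> ('a \<Rightarrow> real) \<Rightarrow> 'u \<Rightarrow> real" where
  "extR \<iota> f \<xi> = real_of_ereal (extU \<iota> f \<xi>)"

definition Lip0 :: "'a::metric_space \<Rightarrow> ('a \<Rightarrow> real) set" where
  "Lip0 z = {f. f z = 0 \<and> (\<exists>L. L-lipschitz_on UNIV f)}"

definition lip_norm :: "('a::metric_space \<Rightarrow> real) \<Rightarrow> real" where
  "lip_norm f = Inf {L. L-lipschitz_on UNIV f}"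

definition dual_norm :: "'a::metric_space \<Rightarrow> (('a \<Rightarrow> real) \<Rightarrow> real) \<Rightarrow> real" where
  "dual_norm z \<phi> = (SUP f\<in>{f \<in> Lip0 z. lip_norm f \<le> 1}. \<bar>\<phi> f\<bar>)"

definition delta :: "('a \<Rightarrow> 'u::topological_space) \<Rightarrow> 'u \<Rightarrow> ('a \<Rightarrow> real) \<Rightarrow> real" where
  "delta \<iota> \<xi> = (\<lambda>f. extR \<iota> f \<xi>)"

definition dbar :: "('a::metric_space \<Rightarrow> 'u::topological_space) \<Rightarrow> 'a \<Rightarrow> 'u \<Rightarrow> 'u \<Rightarrow> real" where
  "dbar \<iota> z \<xi> \<eta> = dual_norm z (\<lambda>f. delta \<iota> \<xi> f - delta \<iota> \<eta> f)"

text \<open>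
  The Borel sets of the subspace \<open>X\<close> are the traces on \<open>X\<close> of the Borel sets of the ambient space.
  For products, \<^const>\<open>borel\<close> on the product type is generated by the open sets of the product
  topology; without a countable base this may be larger than the product \<open>\<sigma>\<close>-algebra.
\<close>

definition radon_measure_on :: "'b::topological_space set \<Rightarrow> 'b measure \<Rightarrow> bool" where
  "radon_measure_on X \<mu> \<longleftrightarrow>
     finite_measure \<mu> \<and>
     sets \<mu> = sets (restrict_space borel X) \<and>
     (\<forall>A\<in>sets \<mu>. \<forall>e>0. \<exists>F G. closedin (top_of_set X) F \<and> openin (top_of_set X) G \<and>
        F \<subseteq> A \<and> A \<subseteq> G \<and> measure \<mu> (G - F) < e) \<and>
     (\<forall>e>0. \<exists>K. compact K \<and> K \<subseteq> X \<and> measure \<mu> (X - K) < e)"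

definition finite_first_moment ::
    "('a::metric_space \<Rightarrow> 'u::topological_space) \<Rightarrow> 'a \<Rightarrow> 'u measure \<Rightarrow> bool" where
  "finite_first_moment \<iota> z \<mu> \<longleftrightarrow>
     (\<exists>\<xi>\<^sub>0\<in>MR \<iota> z. (\<integral>\<^sup>+ \<xi>. ennreal (dbar \<iota> z \<xi> \<xi>\<^sub>0) \<partial>\<mu>) < \<infinity>)"

definition couplings ::
    "'b::topological_space set \<Rightarrow> 'b measure \<Rightarrow> 'b measure \<Rightarrow> ('b \<times> 'b) measure set" where
  "couplings X \<mu> \<nu> =
     {\<pi>. radon_measure_on (X \<times> X) \<pi> \<and> prob_space \<pi> \<and>
         distr \<pi> (restrict_space borel X) fst = \<mu> \<and>
         distr \<pi> (restrict_space borel X) snd = \<nu>}"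

definition transport_cost ::
    "('a::metric_space \<Rightarrow> 'u::topological_space) \<Rightarrow> 'a \<Rightarrow> ('u \<times> 'u) measure \<Rightarrow> ennreal" where
  "transport_cost \<iota> z \<pi> = (\<integral>\<^sup>+ p. ennreal (dbar \<iota> z (fst p) (snd p)) \<partial>\<pi>)"

text \<open>Measurability for a measure refers to its completion.\<close>

definition concentrated_on :: "'b measure \<Rightarrow> 'b set \<Rightarrow> bool" where
  "concentrated_on \<pi> C \<longleftrightarrow>
     C \<in> sets (completion \<pi>) \<and> emeasure (completion \<pi>) (space \<pi> - C) = 0"

definition cyclically_monotonic :: "('b \<Rightarrow> 'b \<Rightarrow> real) \<Rightarrow> ('b \<times> 'b) set \<Rightarrow> bool" where
  "cyclically_monotonic c C \<longleftrightarrow>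
     (\<forall>n. \<forall>\<xi> \<eta> :: nat \<Rightarrow> 'b. \<forall>\<sigma>.
        (\<forall>k\<in>{1..n}. (\<xi> k, \<eta> k) \<in> C) \<and> \<sigma> permutes {1..n} \<longrightarrow>
        (\<Sum>k=1..n. c (\<xi> k) (\<eta> k)) \<le> (\<Sum>k=1..n. c (\<xi> k) (\<eta> (\<sigma> k))))"

end

theory Submission
  imports Defs
begin

text \<open>
  The cost \<open>dbar\<close> is the supremum of \<open>f \<xi> - f \<eta>\<close> over the extensions \<open>f\<close> of \<open>1\<close>-Lipschitz functions.
  These extensions form a lattice of continuous functions on the open subset \<open>MR\<close> of a
  compact Hausdorff space. If \<open>\<phi> \<xi> + \<psi> \<eta> \<le> dbar \<xi> \<eta>\<close> with
  \<open>\<phi>\<close>, \<open>\<psi>\<close> continuous, then on a compact set some \<open>f\<close> of the lattice satisfies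
  \<open>\<phi> - e < f < e - \<psi>\<close> as in the Kakutani-Stone theorem; so the dual value bounds \<open>\<integral>\<phi> d\<mu> + \<integral>\<psi> d\<nu>\<close>.
  By Hahn-Banach there is a positive functional on the continuous functions of the square with the
  right marginals that gives every continuous minorant of \<open>dbar\<close> at most the dual value, and its
  Riesz measure is an optimal coupling.

  Along maximising \<open>f\<^sub>n\<close> the gaps \<open>dbar \<xi> \<eta> - (f\<^sub>n \<xi> - f\<^sub>n \<eta>)\<close> tend to \<open>0\<close> almost everywhere for an
  optimal coupling, and the set where they do is cyclically monotonic. Conversely, on a
  cyclically monotonic set \<open>C\<close> the infimum over chains in \<open>C\<close> gives a \<open>dbar\<close>-Lipschitz potential \<open>f\<close>
  with \<open>f \<xi> - f \<eta> = dbar \<xi> \<eta>\<close> on \<open>C\<close>. Since no countable base is available, the chains are taken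
  in compact subsets of \<open>C\<close> supplied by Lusin's theorem, which makes \<open>f\<close> Borel.
\<close>

section \<open>The Hahn-Banach theorem for a convex cone\<close>

text \<open>The cost is only lower semicontinuous for the topology of the compactification, is
  meaningful only on \<open>MR\<close>, and may be unbounded there. Test functions are therefore
  continuous on the whole compact space, and the resulting measure is seen to live on
  \<open>MR\<close> only afterwards, from its marginals. The cost itself is reached through its
  superlevel sets, which are open because \<open>MR\<close> is open.

  The same weakness of the topology shapes the converse. A function that is Lipschitz for
  \<open>dbar\<close> need not be continuous or even Borel, so the potential of a cyclically
  monotonic set cannot be expected among the functions over which the dual supremum runs. Weak
  duality, however, holds for every Borel function that is \<open>1\<close>-Lipschitz for
  \<open>dbar\<close>. The potential is tested against a coupling already known to attain the dual
  value, and this bounds its dual value by the supremum. Existence and duality thus have to precede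
  the characterisation of minimisers.\<close>

definition sublinear :: "('v::real_vector \<Rightarrow> real) \<Rightarrow> bool" where
  "sublinear p \<longleftrightarrow> (\<forall>x y. p (x + y) \<le> p x + p y) \<and> (\<forall>a x. 0 \<le> a \<longrightarrow> p (a *\<^sub>R x) = a * p x)"

text \<open>Homogeneity needs only one inequality: applied to \<open>1/a\<close> it yields the
  reverse one.\<close>

lemma sublinearI:
  assumes add: "\<And>x y. p (x + y) \<le> p x + p y"
    and scale: "\<And>a x. 0 < a \<Longrightarrow> p (a *\<^sub>R x) \<le> a * p x"
    and zero: "p 0 = 0"
  shows "sublinear p"
proof -
  have "p (a *\<^sub>R x) = a * p x" if "0 < a" for a x
  proof (rule antisym)
    have "p ((1/a) *\<^sub>R (a *\<^sub>R x)) \<le> (1/a) * p (a *\<^sub>R x)"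
      using that by (intro scale) auto
    with that show "a * p x \<le> p (a *\<^sub>R x)"
      by (simp add: field_simps)
  qed (use that scale in auto)
  then show ?thesis
    unfolding sublinear_def using add zero by (metis less_eq_real_def mult_zero_left scale_zero_left)
qed

lemma sublinear_zero: "sublinear p \<Longrightarrow> p 0 = 0"
  unfolding sublinear_def by (metis mult_zero_left order_refl scale_zero_left)

lemma sublinear_neg: "sublinear p \<Longrightarrow> - p (- x) \<le> p x"
  using sublinear_zero[of p] unfolding sublinear_def by (metis add.right_inverse add_le_cancel_right
      diff_0 diff_minus_eq_add le_add_iff1 minus_le_iff neg_le_iff_le add.commute add_0 le_diff_eq)

text \<open>The bound \<open>- p (- x)\<close> keeps the pointwise infimum finite. For
  subadditivity, any two members of a chain lie above a common member, whose own subadditivity can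
  be used.\<close>

lemma sublinear_INF_chain:
  assumes C: "C \<noteq> {}" "\<And>q. q \<in> C \<Longrightarrow> sublinear q \<and> q \<le> p"
    and chain: "\<And>q r. q \<in> C \<Longrightarrow> r \<in> C \<Longrightarrow> q \<le> r \<or> r \<le> q"
  shows "sublinear (\<lambda>x. INF q\<in>C. q x)" "\<And>q. q \<in> C \<Longrightarrow> (\<lambda>x. INF q\<in>C. q x) \<le> q"
proof -
  have bdd: "bdd_below ((\<lambda>q. q x) ` C)" for x
  proof (rule bdd_belowI2)
    fix q assume "q \<in> C"
    then have "- q (- x) \<le> q x" "q (-x) \<le> p (-x)"
      using C sublinear_neg by (auto simp: le_fun_def)
    then show "- p (- x) \<le> q x" by linarith
  qed
  show low: "(\<lambda>x. INF q\<in>C. q x) \<le> q" if "q \<in> C" for q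
    unfolding le_fun_def using that bdd by (auto intro!: cINF_lower)
  show "sublinear (\<lambda>x. INF q\<in>C. q x)"
  proof (rule sublinearI)
    fix x y
    have *: "(INF q\<in>C. q (x+y)) \<le> q x + r y" if q: "q \<in> C" and r: "r \<in> C" for q r
    proof -
      obtain s where s: "s \<in> C" "s \<le> q" "s \<le> r" using chain[OF q r] q r by blast
      have "(INF q\<in>C. q (x+y)) \<le> s (x+y)" using s bdd by (auto intro!: cINF_lower)
      also have "\<dots> \<le> s x + s y" using C(2)[OF s(1)] by (auto simp: sublinear_def)
      also have "\<dots> \<le> q x + r y" using s by (auto simp: le_fun_def intro!: add_mono)
      finally show ?thesis .
    qed
    have "(INF q\<in>C. q (x+y)) - (INF q\<in>C. q y) \<le> q x" if q: "q \<in> C" for q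
    proof -
      have "(INF q\<in>C. q (x+y)) - q x \<le> (INF q\<in>C. q y)"
        using C(1) by (rule cINF_greatest) (use *[OF q] in \<open>simp add: diff_le_eq add.commute\<close>)
      then show ?thesis by linarith
    qed
    then have "(INF q\<in>C. q (x+y)) - (INF q\<in>C. q y) \<le> (INF q\<in>C. q x)"
      using C(1) by (intro cINF_greatest)
    then show "(INF q\<in>C. q (x+y)) \<le> (INF q\<in>C. q x) + (INF q\<in>C. q y)" by linarith
  next
    fix a :: real and x assume a: "0 < a"
    have "(INF q\<in>C. q (a *\<^sub>R x)) / a \<le> (INF q\<in>C. q x)"
    proof (rule cINF_greatest[OF C(1)])
      fix q assume "q \<in> C"
      then have "(INF q\<in>C. q (a *\<^sub>R x)) \<le> a * q x"
        using a C(2)[OF \<open>q \<in> C\<close>] bdd by (intro cINF_lower2[where x=q]) (auto simp: sublinear_def)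
      then show "(INF q\<in>C. q (a *\<^sub>R x)) / a \<le> q x"
        using a by (simp add: field_simps)
    qed
    then show "(INF q\<in>C. q (a *\<^sub>R x)) \<le> a * (INF q\<in>C. q x)"
      using a by (simp add: field_simps)
  next
    have "(INF q\<in>C. q 0) = (INF q\<in>C. 0)"
      by (rule INF_cong) (use C(2) sublinear_zero in blast)+
    then show "(INF q\<in>C. q 0) = 0" using C(1) by simp
  qed
qed

lemma minimal_sublinear_exists:
  assumes "sublinear p"
  obtains q where "sublinear q" "q \<le> p" "\<And>r. sublinear r \<Longrightarrow> r \<le> q \<Longrightarrow> r = q"
proof -
  let ?A = "{q. sublinear q \<and> q \<le> p}"
  have "\<exists>m\<in>?A. \<forall>a\<in>?A. a \<le> m \<longrightarrow> a = m"
  \<comment> \<open>Zorn's lemma is applied to the reversed order, so its maximal element is a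
    minimal functional.\<close>
  proof (rule predicate_Zorn[where P="\<lambda>q r. r \<le> q"])
    show "partial_order_on ?A (relation_of (\<lambda>q r. r \<le> q) ?A)"
      by (rule partial_order_on_relation_ofI) auto
    fix C assume C: "C \<in> Chains (relation_of (\<lambda>q r. r \<le> q) ?A)"
    then have sub: "\<And>q. q \<in> C \<Longrightarrow> sublinear q \<and> q \<le> p"
      and ch: "\<And>q r. q \<in> C \<Longrightarrow> r \<in> C \<Longrightarrow> q \<le> r \<or> r \<le> q"
      unfolding Chains_def relation_of_def by auto
    show "\<exists>u\<in>?A. \<forall>a\<in>C. u \<le> a"
    proof (cases "C = {}")
      case True then show ?thesis using assms by auto
    next
      case False
      note * = sublinear_INF_chain[OF False sub ch]
      obtain q where "q \<in> C" using False by auto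
      with *(2)[of q] sub[of q] have "(\<lambda>x. INF q\<in>C. q x) \<le> p" by (meson order_trans)
      with * show ?thesis by blast
    qed
  qed
  then show thesis using that by (metis (no_types, lifting) mem_Collect_eq order_trans)
qed

text \<open>If \<open>q\<close> is minimal, then \<open>q\<close> equals the sublinear functional
  \<open>y \<mapsto> INF t\<ge>0. q (y + t x) - t q x\<close>; at \<open>y = -x\<close>, \<open>t = 1\<close> this gives \<open>q (-x) \<le> - q x\<close>.\<close>

lemma minimal_sublinear_neg:
  assumes q: "sublinear q" and min: "\<And>r. sublinear r \<Longrightarrow> r \<le> q \<Longrightarrow> r = q"
  shows "q (- x) = - q x"
proof (rule antisym)
  define r where "r y = (INF t\<in>{0..}. q (y + t *\<^sub>R x) - t * q x)" for y
  have add: "q (a + b) \<le> q a + q b" for a b using q by (auto simp: sublinear_def)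
  have sc: "0 \<le> t \<Longrightarrow> q (t *\<^sub>R y) = t * q y" for t y using q by (auto simp: sublinear_def)
  have bdd: "bdd_below ((\<lambda>t. q (y + t *\<^sub>R x) - t * q x) ` {0..})" for y
  proof (rule bdd_belowI2)
    fix t :: real assume "t \<in> {0..}"
    then show "- q (-y) \<le> q (y + t *\<^sub>R x) - t * q x"
      using add[of "y + t *\<^sub>R x" "-y"] sc[of t x] by auto
  qed
  have low: "r y \<le> q (y + t *\<^sub>R x) - t * q x" if "0 \<le> t" for y t
    unfolding r_def using that by (intro cINF_lower bdd) auto
  have le: "r \<le> q" using low[of 0] by (auto simp: le_fun_def)
  have "sublinear r"
  proof (rule sublinearI)
    fix y y'
    have *: "r (y + y') \<le> (q (y + t *\<^sub>R x) - t * q x) + (q (y' + s *\<^sub>R x) - s * q x)"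
      if "0 \<le> t" "0 \<le> s" for s t
      using low[of "t+s" "y+y'"] add[of "y + t *\<^sub>R x" "y' + s *\<^sub>R x"] that
      by (simp add: algebra_simps)
    have "r (y + y') - r y' \<le> q (y + t *\<^sub>R x) - t * q x" if t: "0 \<le> t" for t
    proof -
      have "r (y + y') - (q (y + t *\<^sub>R x) - t * q x) \<le> r y'"
        unfolding r_def[of y'] by (rule cINF_greatest) (use *[OF t] in \<open>auto simp: algebra_simps\<close>)
      then show ?thesis by linarith
    qed
    then have "r (y + y') - r y' \<le> r y"
      unfolding r_def[of y] by (intro cINF_greatest) auto
    then show "r (y + y') \<le> r y + r y'" by linarith
  next
    fix a :: real and y assume a: "0 < a"
    have "r (a *\<^sub>R y) / a \<le> r y"
      unfolding r_def[of y]
    proof (rule cINF_greatest)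
      fix t :: real assume "t \<in> {0..}"
      then have "r (a *\<^sub>R y) \<le> q (a *\<^sub>R (y + t *\<^sub>R x)) - (a * t) * q x"
        using low[of "a*t" "a *\<^sub>R y"] a by (auto simp: algebra_simps)
      also have "\<dots> = a * (q (y + t *\<^sub>R x) - t * q x)"
        using a by (simp add: sc algebra_simps del: scaleR_add_right)
      finally show "r (a *\<^sub>R y) / a \<le> q (y + t *\<^sub>R x) - t * q x"
        using a by (simp add: field_simps)
    qed auto
    then show "r (a *\<^sub>R y) \<le> a * r y" using a by (simp add: field_simps)
  next
    show "r 0 = 0" unfolding r_def by (subst INF_cong[where D="\<lambda>_. 0"]) (auto simp: sc)
  qed
  then have "r = q" using min le by blast
  then show "q (-x) \<le> - q x" using low[of 1 "-x"] sublinear_zero[OF q] by simp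
  show "- q x \<le> q (-x)" using sublinear_neg[OF q, of "-x"] by simp
qed

text \<open>\<open>R h s\<close> is read as the demand that the functional be at most
  \<open>s\<close> at \<open>h\<close>. The least demanded bound \<open>p h\<close> is finite, since
  a bound for \<open>- h\<close> combined with \<open>pos\<close> limits it from below, and it is
  sublinear because the demands form a convex cone. A minimal sublinear functional below
  \<open>p\<close> is odd, hence linear.\<close>

theorem linear_below_cone:
  fixes R :: "'v::real_vector \<Rightarrow> real \<Rightarrow> bool"
  assumes add: "\<And>h s h' s'. R h s \<Longrightarrow> R h' s' \<Longrightarrow> R (h + h') (s + s')"
    and scale: "\<And>h s a. 0 < a \<Longrightarrow> R h s \<Longrightarrow> R (a *\<^sub>R h) (a * s)"
    and zero: "R 0 0" and pos: "\<And>s. R 0 s \<Longrightarrow> 0 \<le> s"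
    and total: "\<And>h. \<exists>s. R h s"
  obtains \<Lambda> where "linear \<Lambda>" "\<And>h s. R h s \<Longrightarrow> \<Lambda> h \<le> s"
proof -
  define p where "p h = Inf {s. R h s}" for h
  have bdd: "bdd_below {s. R h s}" for h
  proof -
    obtain s' where s': "R (-h) s'" using total by blast
    have "- s' \<le> s" if "R h s" for s
      using pos[of "s + s'"] add[OF that s'] by simp
    then show ?thesis by (meson bdd_belowI mem_Collect_eq)
  qed
  have ne: "{s. R h s} \<noteq> {}" for h using total by auto
  have low: "p h \<le> s" if "R h s" for h s
    unfolding p_def using that bdd by (intro cInf_lower) auto
  have "sublinear p"
  proof (rule sublinearI)
    fix h h'
    have "p (h + h') - p h' \<le> s" if s: "R h s" for s
    proof -
      have "p (h + h') - s \<le> p h'"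
        unfolding p_def[of h'] using low[OF add[OF s]] by (intro cInf_greatest[OF ne]) (auto simp: algebra_simps)
      then show ?thesis by linarith
    qed
    then have "p (h + h') - p h' \<le> p h" unfolding p_def[of h] by (intro cInf_greatest[OF ne]) auto
    then show "p (h + h') \<le> p h + p h'" by linarith
  next
    fix a :: real and h assume a: "0 < a"
    have "p (a *\<^sub>R h) / a \<le> p h"
      unfolding p_def[of h] using low[OF scale[OF a]] a
      by (intro cInf_greatest[OF ne]) (auto simp: field_simps)
    then show "p (a *\<^sub>R h) \<le> a * p h" using a by (simp add: field_simps)
  next
    show "p 0 = 0"
      using low[OF zero] cInf_greatest[OF ne[of 0], of 0] pos unfolding p_def by (intro antisym) auto
  qed
  then obtain q where q: "sublinear q" "q \<le> p" "\<And>r. sublinear r \<Longrightarrow> r \<le> q \<Longrightarrow> r = q"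
    using minimal_sublinear_exists by blast
  have neg: "q (- x) = - q x" for x using minimal_sublinear_neg q by blast
  have sub: "q (x + y) \<le> q x + q y" for x y using q(1) by (auto simp: sublinear_def)
  have plus: "q (x + y) = q x + q y" for x y
    using sub[of x y] sub[of "x + y" "-y"] neg[of y] by auto
  have "q (a *\<^sub>R x) = a * q x" for a x
  proof (cases "0 \<le> a")
    case True then show ?thesis using q(1) by (auto simp: sublinear_def)
  next
    case False
    then have "0 \<le> -a" by simp
    with q(1) have "q ((-a) *\<^sub>R x) = (-a) * q x" unfolding sublinear_def by blast
    then show ?thesis using neg[of "a *\<^sub>R x"] by (simp only: scaleR_minus_left)
  qed
  with plus have "linear q" by (simp add: linear_iff)
  moreover have "q h \<le> s" if "R h s" for h s
    using low[OF that] le_funD[OF q(2), of h] by linarith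
  ultimately show thesis by (rule that)
qed

section \<open>Measures of positive functionals on a compact Hausdorff space\<close>

text \<open>This is the finite subcover argument as an induction rule: a property that holds near
  each point and survives binary unions holds on a compact set. The later compactness arguments of
  this kind only have to choose \<open>Q\<close>.\<close>

lemma compact_union_induct:
  assumes K: "compact K" and empty: "Q {}" and union: "\<And>A B. Q A \<Longrightarrow> Q B \<Longrightarrow> Q (A \<union> B)"
    and local: "\<And>x. x \<in> K \<Longrightarrow> \<exists>V. open V \<and> x \<in> V \<and> Q (K \<inter> V)"
  shows "Q K"
proof -
  obtain V where V: "\<And>x. x \<in> K \<Longrightarrow> open (V x) \<and> x \<in> V x \<and> Q (K \<inter> V x)"
    using local by metis
  obtain D where D: "D \<subseteq> K" "finite D" "K \<subseteq> (\<Union>x\<in>D. V x)"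
    using compactE_image[OF K, of K V] V by blast
  from D(2,1) have "Q (K \<inter> (\<Union>x\<in>D. V x))"
  proof (induction D rule: finite_induct)
    case (insert x F)
    then have "Q ((K \<inter> V x) \<union> (K \<inter> (\<Union>x\<in>F. V x)))" using V by (intro union) auto
    then show ?case by (simp add: Int_Un_distrib)
  qed (simp add: empty)
  then show ?thesis using D(3) by (simp add: Int_absorb2)
qed

lemma Urysohn_compact:
  fixes A B :: "'b::t2_space set"
  assumes "compact (UNIV :: 'b set)" "closed A" "closed B" "A \<inter> B = {}"
  obtains f :: "'b \<Rightarrow> real" where "continuous_on UNIV f" "\<And>x. 0 \<le> f x" "\<And>x. f x \<le> 1"
    "\<And>x. x \<in> A \<Longrightarrow> f x = 1" "\<And>x. x \<in> B \<Longrightarrow> f x = 0"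
proof -
  have "Hausdorff_space (euclidean :: 'b topology)"
    unfolding Hausdorff_space_def disjnt_def using hausdorff by (metis open_openin)
  then have "normal_space (euclidean :: 'b topology)"
    using assms(1) by (intro compact_Hausdorff_or_regular_imp_normal_space)
      (auto simp: compact_space_def)
  then obtain f where f: "continuous_map euclidean (top_of_set {0..1::real}) f" "f ` B \<subseteq> {0}" "f ` A \<subseteq> {1}"
    using Urysohn_lemma[of euclidean B A 0 1] assms by (auto simp: disjnt_def Int_commute)
  show thesis
  proof (rule that)
    show "continuous_on UNIV f" using f(1) by (auto simp: continuous_map_in_subtopology)
    show "0 \<le> f x" "f x \<le> 1" for x using f(1) by (auto simp: continuous_map_in_subtopology)
  qed (use f in auto)
qed

text \<open>The test functions of the Riesz construction for the open set \<open>G\<close>. They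
  vanish off \<open>G\<close>, but their support need not lie in \<open>G\<close>; arguments that
  need room at the boundary accept an error \<open>e\<close> or truncate at height
  \<open>e\<close>.\<close>

definition bump :: "'b::topological_space set \<Rightarrow> ('b \<Rightarrow> real) \<Rightarrow> bool" where
  "bump G h \<longleftrightarrow> continuous_on UNIV h \<and> (\<forall>x. 0 \<le> h x \<and> h x \<le> indicator G x)"

lemma bump_zero: "bump G (\<lambda>_. 0)"
  by (simp add: bump_def)

lemma bump_mono: "bump G h \<Longrightarrow> G \<subseteq> G' \<Longrightarrow> bump G' h"
  unfolding bump_def by (meson indicator_leI order_trans subset_iff)

lemma bump_max: "bump G f \<Longrightarrow> bump G g \<Longrightarrow> bump G (\<lambda>x. max (f x) (g x))"
  unfolding bump_def by (auto intro: continuous_on_max simp: le_max_iff_disj)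

lemma bump_le_1: "bump G h \<Longrightarrow> h x \<le> 1"
  unfolding bump_def by (metis indicator_le_1 order_trans)

lemma bump_outside: "bump G h \<Longrightarrow> x \<notin> G \<Longrightarrow> h x = 0"
  unfolding bump_def by (metis antisym indicator_simps(2))

lemma bump_Urysohn:
  fixes G :: "'b::t2_space set"
  assumes "compact (UNIV :: 'b set)" "closed F" "open G" "F \<subseteq> G"
  obtains h where "bump G h" "\<And>x. x \<in> F \<Longrightarrow> h x = 1"
proof -
  obtain f where "continuous_on UNIV f" "\<And>x. 0 \<le> f x" "\<And>x. f x \<le> 1"
    "\<And>x. x \<in> F \<Longrightarrow> f x = 1" "\<And>x. x \<in> - G \<Longrightarrow> (f x :: real) = 0"
    using Urysohn_compact[of F "-G"] assms by (auto simp: closed_Compl)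
  then have "bump G f" by (auto simp: bump_def indicator_def)
  then show thesis using that \<open>\<And>x. x \<in> F \<Longrightarrow> f x = 1\<close> by blast
qed

locale positive_functional =
  fixes \<Lambda> :: "('b::t2_space \<Rightarrow> real) \<Rightarrow> real"
  assumes compact_UNIV: "compact (UNIV :: 'b set)"
    and add: "\<And>f g. continuous_on UNIV f \<Longrightarrow> continuous_on UNIV g \<Longrightarrow> \<Lambda> (\<lambda>x. f x + g x) = \<Lambda> f + \<Lambda> g"
    and scale: "\<And>f a. continuous_on UNIV f \<Longrightarrow> \<Lambda> (\<lambda>x. a * f x) = a * \<Lambda> f"
    and mono: "\<And>f g. continuous_on UNIV f \<Longrightarrow> continuous_on UNIV g \<Longrightarrow> (\<And>x. f x \<le> g x) \<Longrightarrow> \<Lambda> f \<le> \<Lambda> g"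
    and one: "\<Lambda> (\<lambda>_. 1) = 1"
begin

lemma const: "\<Lambda> (\<lambda>_. a) = a"
  using scale[of "\<lambda>_. 1" a] one by simp

lemma sum: "(\<And>i. i \<in> I \<Longrightarrow> continuous_on UNIV (f i)) \<Longrightarrow> \<Lambda> (\<lambda>x. \<Sum>i\<in>I. f i x) = (\<Sum>i\<in>I. \<Lambda> (f i))"
proof (induction I rule: infinite_finite_induct)
  case (insert i I)
  then show ?case by (simp add: add continuous_on_sum)
qed (simp_all add: const)

lemma bump_nonneg: "bump G h \<Longrightarrow> 0 \<le> \<Lambda> h"
  using mono[of "\<lambda>_. 0" h] const[of 0] by (auto simp: bump_def)

lemma bump_image_le_1: "bump G h \<Longrightarrow> \<Lambda> h \<le> 1"
  using mono[of h "\<lambda>_. 1"] one bump_le_1[of G h] by (auto simp: bump_def)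

definition content :: "'b set \<Rightarrow> ennreal" where
  "content G = (SUP h\<in>{h. bump G h}. ennreal (\<Lambda> h))"

definition outer :: "'b set \<Rightarrow> ennreal" where
  "outer A = (INF G\<in>{G. open G \<and> A \<subseteq> G}. content G)"

lemma content_upper: "bump G h \<Longrightarrow> ennreal (\<Lambda> h) \<le> content G"
  unfolding content_def by (rule SUP_upper) simp

lemma content_mono: "G \<subseteq> G' \<Longrightarrow> content G \<le> content G'"
  unfolding content_def by (rule SUP_subset_mono) (auto intro: bump_mono)

lemma content_empty: "content {} = 0"
proof -
  have "h = (\<lambda>_. 0)" if "bump {} h" for h :: "'b \<Rightarrow> real" using bump_outside[OF that] by auto
  then have "{h :: 'b \<Rightarrow> real. bump {} h} = {\<lambda>_. 0}" by (auto simp: bump_zero)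
  then show ?thesis using const[of 0] by (simp add: content_def)
qed

lemma content_UNIV: "content UNIV = 1"
proof (rule antisym)
  show "content UNIV \<le> 1"
    unfolding content_def using bump_image_le_1 by (intro SUP_least) auto
  have "bump UNIV (\<lambda>_ :: 'b. 1)" by (simp add: bump_def)
  from content_upper[OF this] show "1 \<le> content UNIV" by (simp add: one)
qed

text \<open>A substitute for a partition of unity. Near a point of \<open>G j\<close> a Urysohn bump
  with value \<open>1\<close> there dominates \<open>h\<close>, up to \<open>e\<close>, because
  \<open>h\<close> is at most \<open>1\<close>; near a point outside the union \<open>h\<close>
  itself is below \<open>e\<close>. Compactness leaves finitely many bumps, and maxima combine two
  local solutions.\<close>

lemma bump_UN_le_sum:
  fixes G :: "nat \<Rightarrow> 'b set"
  assumes G: "\<And>i. open (G i)" and h: "bump (\<Union>i. G i) h" and e: "0 < e"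
  obtains N f where "\<And>i. bump (G i) (f i)" "\<And>x. h x \<le> e + (\<Sum>i<N. f i x)"
proof -
  have hc: "continuous_on UNIV h" using h by (simp add: bump_def)
  let ?Q = "\<lambda>A. \<exists>N :: nat. \<exists>f. (\<forall>i. bump (G i) (f i)) \<and> (\<forall>x\<in>A. h x \<le> e + (\<Sum>i<N. f i x))"
  have "?Q UNIV"
  proof (rule compact_union_induct[OF compact_UNIV])
    show "?Q {}" by (intro exI[of _ 0] exI[of _ "\<lambda>_ _. 0"]) (simp add: bump_zero)
  next
    fix A B assume "?Q A" "?Q B"
    then obtain N M f g where f: "\<And>i. bump (G i) (f i)" "\<And>x. x \<in> A \<Longrightarrow> h x \<le> e + (\<Sum>i<N. f i x)"
      and g: "\<And>i. bump (G i) (g i)" "\<And>x. x \<in> B \<Longrightarrow> h x \<le> e + (\<Sum>i<M. g i x)"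
      by metis
    have "(\<Sum>i<N. f i x) \<le> (\<Sum>i<max N M. max (f i x) (g i x))"
         "(\<Sum>i<M. g i x) \<le> (\<Sum>i<max N M. max (f i x) (g i x))" for x
      using f(1) g(1) by (intro sum_mono2 order_trans[OF sum_mono sum_mono2];
        auto simp: bump_def le_max_iff_disj)+
    then have "\<And>x. x \<in> A \<union> B \<Longrightarrow> h x \<le> e + (\<Sum>i<max N M. max (f i x) (g i x))"
      using f(2) g(2) by (meson UnE add_left_mono order_trans)
    then show "?Q (A \<union> B)"
      using f(1) g(1)
      by (intro exI[of _ "max N M"] exI[of _ "\<lambda>i x. max (f i x) (g i x)"]) (auto intro: bump_max)
  next
    fix x
    show "\<exists>V. open V \<and> x \<in> V \<and> ?Q (UNIV \<inter> V)"
    proof (cases "x \<in> (\<Union>i. G i)")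
      case False
      then have "h x = 0" using bump_outside[OF h] by blast
      moreover have "open {y. h y < e}" by (intro open_Collect_less hc continuous_intros)
      moreover have "?Q {y. h y < e}"
        by (rule exI[of _ 0], rule exI[of _ "\<lambda>_ _. 0"]) (auto simp: bump_zero)
      ultimately show ?thesis using e by (intro exI[of _ "{y. h y < e}"]) auto
    next
      case True
      then obtain j where j: "x \<in> G j" by auto
      obtain u where u: "bump (G j) u" "u x = 1"
        using bump_Urysohn[OF compact_UNIV, of "{x}" "G j"] G j by auto
      have uc: "continuous_on UNIV u" using u by (simp add: bump_def)
      have "open {y. h y < e + u y}"
        by (intro open_Collect_less continuous_intros hc uc)
      moreover have "h x \<le> 1" using bump_le_1[OF h] .
      moreover have "(\<Sum>i<Suc j. if i = j then u y else 0) = u y" for y by simp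
      moreover have "?Q {y. h y < e + u y}"
        using u(1) by (intro exI[of _ "Suc j"] exI[of _ "\<lambda>i. if i = j then u else (\<lambda>_. 0)"])
          (auto simp: bump_zero less_imp_le)
      ultimately show ?thesis using e u by (intro exI[of _ "{y. h y < e + u y}"]) auto
    qed
  qed
  then show thesis using that by auto
qed

lemma content_UN:
  fixes G :: "nat \<Rightarrow> 'b set"
  assumes G: "\<And>i. open (G i)"
  shows "content (\<Union>i. G i) \<le> (\<Sum>i. content (G i))"
  unfolding content_def[of "\<Union>i. G i"]
proof (rule SUP_least, rule ennreal_le_epsilon)
  fix h :: "'b \<Rightarrow> real" and e :: real assume h: "h \<in> {h. bump (\<Union>i. G i) h}" and e: "0 < e"
  then have hc: "continuous_on UNIV h" by (simp add: bump_def)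
  have hb: "bump (\<Union>i. G i) h" using h by simp
  obtain N :: nat and f where f: "\<And>i. bump (G i) (f i)" "\<And>x. h x \<le> e + (\<Sum>i<N. f i x)"
    by (rule bump_UN_le_sum[of G, OF G hb e]) (erule that)
  have fc: "continuous_on UNIV (f i)" for i using f by (simp add: bump_def)
  have "\<Lambda> h \<le> e + (\<Sum>i<N. \<Lambda> (f i))"
    using mono[OF hc _ f(2)] by (simp add: add const sum fc continuous_on_sum continuous_on_add)
  then have "ennreal (\<Lambda> h) \<le> ennreal (e + (\<Sum>i<N. \<Lambda> (f i)))" by (rule ennreal_leI)
  also have "\<dots> = (\<Sum>i<N. ennreal (\<Lambda> (f i))) + ennreal e"
    using e bump_nonneg[OF f(1)] by (simp add: sum_nonneg add.commute)
  also have "\<dots> \<le> (\<Sum>i<N. content (G i)) + ennreal e"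
    by (intro add_right_mono sum_mono content_upper f)
  also have "\<dots> \<le> (\<Sum>i. content (G i)) + ennreal e"
    by (intro add_right_mono sum_le_suminf) auto
  finally show "ennreal (\<Lambda> h) \<le> (\<Sum>i. content (G i)) + ennreal e" .
qed

lemma outer_open: "open G \<Longrightarrow> outer G = content G"
  unfolding outer_def by (intro antisym INF_lower INF_greatest) (auto intro: content_mono)

lemma outer_mono: "A \<subseteq> B \<Longrightarrow> outer A \<le> outer B"
  unfolding outer_def by (rule INF_superset_mono) auto

lemma outer_close: "outer A < e \<Longrightarrow> \<exists>G. open G \<and> A \<subseteq> G \<and> content G < e"
  unfolding outer_def by (auto simp: INF_less_iff)

lemma outer_UN: "outer (\<Union>i :: nat. A i) \<le> (\<Sum>i. outer (A i))"
proof (rule ennreal_le_epsilon)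
  fix e :: real assume e: "0 < e" "(\<Sum>n. outer (A n)) < top"
  then have *: "outer (A n) < outer (A n) + e * (1/2)^Suc n" for n
    by (auto simp add: less_top dest!: ennreal_suminf_lessD)
  obtain G where G: "\<And>n. open (G n)" "\<And>n. A n \<subseteq> G n" "\<And>n. content (G n) < outer (A n) + e * (1/2)^Suc n"
    using outer_close[OF *] by metis
  have "outer (\<Union>i. A i) \<le> content (\<Union>i. G i)"
    using G by (subst outer_open[symmetric]) (auto intro!: outer_mono UN_mono)
  also have "\<dots> \<le> (\<Sum>i. content (G i))" using G by (intro content_UN)
  also have "\<dots> \<le> (\<Sum>n. outer (A n) + ennreal (e * (1/2) ^ Suc n))"
    using G(3) by (intro suminf_le less_imp_le) auto
  also have "\<dots> = (\<Sum>n. outer (A n)) + (\<Sum>n. ennreal e * ennreal ((1/2) ^ Suc n))"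
    using e by (subst suminf_add[symmetric])
      (auto simp del: ennreal_suminf_cmult simp add: ennreal_mult[symmetric])
  also have "\<dots> = (\<Sum>n. outer (A n)) + e"
    unfolding ennreal_suminf_cmult
    by (subst suminf_ennreal_eq[OF zero_le_power power_half_series]) auto
  finally show "outer (\<Union>i. A i) \<le> (\<Sum>n. outer (A n)) + e" .
qed

lemma outer_measure_space_outer: "outer_measure_space (Pow UNIV) outer"
  unfolding outer_measure_space_def positive_def increasing_def countably_subadditive_def
  by (auto simp: outer_open content_empty intro: outer_mono outer_UN)

lemma outer_Un: "outer (A \<union> B) \<le> outer A + outer B"
proof -
  have "outer (A \<union> B) \<le> outer (\<Union>i. binaryset A B i)" by (simp add: UN_binaryset_eq)
  also have "\<dots> \<le> (\<Sum>i. outer (binaryset A B i))" by (rule outer_UN)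
  also have "\<dots> = outer A + outer B"
    by (rule suminf_binaryset_eq) (simp add: outer_open content_empty)
  finally show ?thesis .
qed

text \<open>The Caratheodory condition for an open \<open>G\<close>, tested on open
  \<open>E\<close>. The part of \<open>E\<close> where \<open>h < e\<close> is an open neighbourhood
  of \<open>E - G\<close>. A bump \<open>k\<close> of this part and the truncation of
  \<open>h\<close> at height \<open>e\<close> are never positive at the same point, so their sum is
  again a bump of \<open>E\<close>; truncating costs at most \<open>e\<close>.\<close>

lemma content_split:
  assumes G: "open G" and E: "open E"
  shows "content (E \<inter> G) + outer (E - G) \<le> content E"
proof -
  have "ennreal (\<Lambda> h) + outer (E - G) \<le> content E" if h: "bump (E \<inter> G) h" for h
  proof (rule ennreal_le_epsilon)
    fix e :: real assume e: "0 < e"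
    have hc: "continuous_on UNIV h" using h by (simp add: bump_def)
    define E' where "E' = E \<inter> {x. h x < e}"
    define h0 where "h0 x = max (h x - e) 0" for x
    have E': "open E'"
      unfolding E'_def by (intro open_Int E open_Collect_less hc continuous_intros)
    have h0c: "continuous_on UNIV h0" unfolding h0_def by (intro continuous_intros hc)
    have "E - G \<subseteq> E'" using bump_outside[OF h] e by (auto simp: E'_def)
    then have "ennreal (\<Lambda> h) + outer (E - G) \<le> ennreal (\<Lambda> h) + content E'"
      using E' by (metis add_left_mono outer_mono outer_open)
    also have "\<dots> = (SUP k\<in>{k. bump E' k}. ennreal (\<Lambda> h) + ennreal (\<Lambda> k))"
      unfolding content_def using bump_zero by (subst ennreal_SUP_add_right) auto
    also have "\<dots> \<le> content E + e"
    proof (rule SUP_least)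
      fix k assume "k \<in> {k. bump E' k}"
      then have k: "bump E' k" by simp
      have kc: "continuous_on UNIV k" using k by (simp add: bump_def)
      have "bump E (\<lambda>x. h0 x + k x)"
      proof -
        have "h0 x + k x \<le> indicator E x" for x
        proof (cases "x \<in> E'")
          case True
          then show ?thesis using bump_le_1[OF k, of x] by (auto simp: E'_def h0_def)
        next
          case False
          then have "k x = 0" using bump_outside[OF k] by blast
          moreover have "h x \<le> indicator E x" using bump_mono[OF h, of E] by (auto simp: bump_def)
          ultimately show ?thesis using e by (auto simp: h0_def)
        qed
        moreover have "0 \<le> h0 x + k x" for x using k by (auto simp: h0_def bump_def)
        ultimately show ?thesis by (auto simp: bump_def intro: continuous_on_add h0c kc)
      qed
      then have le: "ennreal (\<Lambda> h0 + \<Lambda> k) \<le> content E"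
        using content_upper[of E "\<lambda>x. h0 x + k x"] by (simp add: add h0c kc)
      have "\<Lambda> h \<le> \<Lambda> (\<lambda>x. h0 x + e)"
        by (intro mono hc continuous_intros h0c) (auto simp: h0_def)
      then have "\<Lambda> h \<le> \<Lambda> h0 + e" by (simp add: add h0c const)
      moreover have "0 \<le> \<Lambda> h0"
        using mono[of "\<lambda>_. 0" h0] h0c const[of 0] by (auto simp: h0_def)
      ultimately have "ennreal (\<Lambda> h) + ennreal (\<Lambda> k) \<le> ennreal (\<Lambda> h0 + \<Lambda> k) + ennreal e"
        using bump_nonneg[OF h] bump_nonneg[OF k] e by (simp add: ennreal_plus[symmetric] del: ennreal_plus)
      then show "ennreal (\<Lambda> h) + ennreal (\<Lambda> k) \<le> content E + e"
        using le by (meson add_right_mono order_trans)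
    qed
    finally show "ennreal (\<Lambda> h) + outer (E - G) \<le> content E + e" .
  qed
  then have "(SUP h\<in>{h. bump (E \<inter> G) h}. ennreal (\<Lambda> h) + outer (E - G)) \<le> content E"
    by (intro SUP_least) auto
  then show ?thesis
    unfolding content_def[of "E \<inter> G"] using bump_zero by (subst ennreal_SUP_add_left[symmetric]) auto
qed

lemma open_in_lambda_system:
  assumes "open G"
  shows "G \<in> lambda_system UNIV (Pow UNIV) outer"
proof -
  have "outer (A \<inter> G) + outer (A - G) = outer A" for A
  proof (rule antisym)
    show "outer A \<le> outer (A \<inter> G) + outer (A - G)"
      using outer_Un[of "A \<inter> G" "A - G"] by (simp add: Int_Diff_Un)
    show "outer (A \<inter> G) + outer (A - G) \<le> outer A"
      unfolding outer_def[of A]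
    proof (rule INF_greatest)
      fix E assume "E \<in> {E. open E \<and> A \<subseteq> E}"
      then have E: "open E" "A \<subseteq> E" by auto
      have "outer (A \<inter> G) + outer (A - G) \<le> outer (E \<inter> G) + outer (E - G)"
        using E by (intro add_mono outer_mono) auto
      also have "\<dots> \<le> content E"
        using content_split[OF assms E(1)] E assms by (simp add: outer_open open_Int)
      finally show "outer (A \<inter> G) + outer (A - G) \<le> content E" .
    qed
  qed
  then show ?thesis
    by (simp add: lambda_system_def Int_commute[of G] Diff_eq Int_commute[of "-G"])
qed

text \<open>Caratheodory's theorem makes \<open>outer\<close> a measure on the Borel sets. Its link
  to \<open>\<Lambda>\<close> is recorded as a supremum over bumps of open sets together with outer
  regularity, the form in which the marginals and the cost are computed later.\<close>

theorem Riesz_measure: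
  obtains P where "sets P = sets borel" "prob_space P"
    "\<And>G h. open G \<Longrightarrow> bump G h \<Longrightarrow> \<Lambda> h \<le> measure P G"
    "\<And>G e. open G \<Longrightarrow> 0 < e \<Longrightarrow> \<exists>h. bump G h \<and> measure P G < \<Lambda> h + e"
    "\<And>A e. A \<in> sets borel \<Longrightarrow> 0 < e \<Longrightarrow> \<exists>G. open G \<and> A \<subseteq> G \<and> measure P G < measure P A + e"
proof -
  let ?L = "lambda_system UNIV (Pow UNIV) outer"
  interpret UNIV: sigma_algebra UNIV "Pow UNIV :: 'b set set" by (rule sigma_algebra_Pow)
  have ms: "measure_space UNIV ?L outer"
    by (rule UNIV.caratheodory_lemma[OF outer_measure_space_outer])
  then interpret L: sigma_algebra UNIV ?L by (simp add: measure_space_def)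
  have "sigma_sets UNIV {S. open S} \<subseteq> ?L"
    by (rule L.sigma_sets_subset) (use open_in_lambda_system in blast)
  then have "sets borel \<subseteq> ?L"
    by (simp only: sets_borel)
  moreover have "sigma_algebra UNIV (sets (borel :: 'b measure))"
    using sets.sigma_algebra_axioms[of borel] by simp
  ultimately have ms': "measure_space UNIV (sets borel) outer"
    using measure_down[OF ms] by blast
  define P where "P = measure_of UNIV (sets borel) outer"
  have sets: "sets P = sets borel" unfolding P_def using sets.sigma_sets_eq[of borel] by simp
  have emeasure: "emeasure P A = outer A" if "A \<in> sets borel" for A
    unfolding P_def using that ms' sets.sigma_sets_eq[of "borel :: 'b measure"]
    by (intro emeasure_measure_of_sigma) (auto simp: measure_space_def)
  have "space P = UNIV" using sets_eq_imp_space_eq[OF sets] by simp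
  then interpret P: prob_space P
    by (intro prob_spaceI) (simp add: emeasure outer_open content_UNIV)
  have open_eq: "ennreal (measure P G) = content G" if "open G" for G
    using that emeasure[of G] by (simp add: P.emeasure_eq_measure outer_open)
  show thesis
  proof (rule that[OF sets P.prob_space_axioms])
    show "\<Lambda> h \<le> measure P G" if "open G" "bump G h" for G h
      using content_upper[OF that(2)] open_eq[OF that(1)] by (metis ennreal_le_iff measure_nonneg)
    show "\<exists>h. bump G h \<and> measure P G < \<Lambda> h + e" if "open G" "0 < e" for G and e :: real
    proof (rule ccontr)
      assume "\<nexists>h. bump G h \<and> measure P G < \<Lambda> h + e"
      then have *: "bump G h \<Longrightarrow> \<Lambda> h \<le> measure P G - e" for h by force
      then have "content G \<le> ennreal (measure P G - e)"
        unfolding content_def by (intro SUP_least ennreal_leI) auto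
      \<comment> \<open>The zero bump shows that the conversion of \<open>measure P G - e\<close> to
        \<open>ennreal\<close> does not truncate a negative number to \<open>0\<close>.\<close>
      moreover have "0 \<le> measure P G - e" using *[OF bump_zero] const[of 0] by simp
      ultimately show False
        using open_eq[OF that(1)] that(2) by (metis diff_ge_0_iff_ge ennreal_le_iff le_diff_eq
          add_le_same_cancel1 not_le)
    qed
    show "\<exists>G. open G \<and> A \<subseteq> G \<and> measure P G < measure P A + e" if "A \<in> sets borel" "0 < e" for A and e :: real
    proof -
      have "outer A < ennreal (measure P A + e)"
        using emeasure[OF that(1)] that(2) by (metis P.emeasure_eq_measure ennreal_lessI
          less_add_same_cancel1 measure_nonneg add_nonneg_pos)
      from outer_close[OF this] open_eq show ?thesis
        by (metis ennreal_less_iff measure_nonneg)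
    qed
  qed
qed

end

section \<open>Lattice costs and the dual bound\<close>

text \<open>Values off \<open>A\<close> are ignored, because the cost has no meaning outside
  \<open>X \<times> X\<close>; the neighbourhoods are open in the ambient space, so that superlevel
  sets are traces of open sets.\<close>

definition lsc_on :: "'b::topological_space set \<Rightarrow> ('b \<Rightarrow> real) \<Rightarrow> bool" where
  "lsc_on A u \<longleftrightarrow> (\<forall>x\<in>A. \<forall>a<u x. \<exists>V. open V \<and> x \<in> V \<and> (\<forall>y\<in>A \<inter> V. a < u y))"

lemma lsc_onD:
  assumes "lsc_on A u" "x \<in> A" "a < u x"
  shows "\<exists>V. open V \<and> x \<in> V \<and> (\<forall>y\<in>A \<inter> V. a < u y)"
  using assms unfolding lsc_on_def by blast

lemma openin_lsc_on:
  assumes "lsc_on A u"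
  shows "openin (top_of_set A) {x\<in>A. a < u x}"
proof (subst openin_subopen, intro ballI)
  fix x assume x: "x \<in> {x\<in>A. a < u x}"
  then obtain V where V: "open V" "x \<in> V" "\<forall>y\<in>A \<inter> V. a < u y"
    using lsc_onD[OF assms, of x a] by blast
  then show "\<exists>T. openin (top_of_set A) T \<and> x \<in> T \<and> T \<subseteq> {x\<in>A. a < u x}"
    using x by (intro exI[of _ "A \<inter> V"]) auto
qed

lemma lsc_on_measurable:
  assumes "lsc_on A u"
  shows "u \<in> borel_measurable (restrict_space borel A)"
proof (subst borel_measurable_iff_greater, intro allI)
  fix a
  obtain V where "open V" "{x\<in>A. a < u x} = A \<inter> V"
    using openin_lsc_on[OF assms, of a] by (auto simp: openin_open)
  then have "{x\<in>A. a < u x} \<in> sets (restrict_space borel A)"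
    by (auto simp: sets_restrict_space)
  then show "{w \<in> space (restrict_space borel A). a < u w} \<in> sets (restrict_space borel A)"
    by (simp add: space_restrict_space)
qed

lemma continuous_imp_lsc_on: "continuous_on A u \<Longrightarrow> lsc_on A u"
  unfolding lsc_on_def
proof (intro ballI allI impI)
  fix x a assume u: "continuous_on A u" and x: "x \<in> A" "a < u x"
  from u obtain V where "open V" "V \<inter> A = u -` {a<..} \<inter> A"
    by (metis continuous_on_open_invariant open_greaterThan)
  then show "\<exists>V. open V \<and> x \<in> V \<and> (\<forall>y\<in>A \<inter> V. a < u y)"
    using x by (intro exI[of _ V]) auto
qed

lemma lsc_on_compose:
  assumes u: "lsc_on B u" and g: "continuous_on A g" "g ` A \<subseteq> B"
  shows "lsc_on A (\<lambda>x. u (g x))"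
  unfolding lsc_on_def
proof (intro ballI allI impI)
  fix x a assume x: "x \<in> A" "a < u (g x)"
  have gB: "g y \<in> B" if "y \<in> A" for y using g(2) that by auto
  obtain V where V: "open V" "g x \<in> V" "\<forall>y\<in>B \<inter> V. a < u y"
    using lsc_onD[OF u gB[OF x(1)] x(2)] by blast
  have "\<exists>W. open W \<and> W \<inter> A = g -` V \<inter> A"
    using g(1) V(1) continuous_on_open_invariant by blast
  then obtain W where "open W" "W \<inter> A = g -` V \<inter> A"
    by blast
  then have mem: "y \<in> W \<longleftrightarrow> g y \<in> V" if "y \<in> A" for y
    using that by blast
  have "x \<in> W" using mem x(1) V(2) by blast
  moreover have "\<forall>y\<in>A \<inter> W. a < u (g y)"
  proof
    fix y assume "y \<in> A \<inter> W"
    then have "g y \<in> B" "g y \<in> V" using mem gB by blast+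
    then show "a < u (g y)" using V(3) by blast
  qed
  ultimately show "\<exists>V. open V \<and> x \<in> V \<and> (\<forall>y\<in>A \<inter> V. a < u (g y))"
    using \<open>open W\<close> by (intro exI[of _ W] conjI)
qed

lemma lsc_on_add:
  assumes u: "lsc_on A u" and v: "lsc_on A v"
  shows "lsc_on A (\<lambda>x. u x + v x)"
  unfolding lsc_on_def
proof (intro ballI allI impI)
  fix x a assume x: "x \<in> A" "a < u x + v x"
  define e where "e = (u x + v x - a) / 2"
  have e: "0 < e" using x by (simp add: e_def)
  obtain V where V: "open V" "x \<in> V" "\<forall>y\<in>A \<inter> V. u x - e < u y"
    using lsc_onD[OF u x(1), of "u x - e"] e by fastforce
  obtain W where W: "open W" "x \<in> W" "\<forall>y\<in>A \<inter> W. v x - e < v y"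
    using lsc_onD[OF v x(1), of "v x - e"] e by fastforce
  have "a < u y + v y" if "y \<in> A \<inter> (V \<inter> W)" for y
  proof -
    have "u x - e < u y" "v x - e < v y" using V(3) W(3) that by blast+
    then show ?thesis by (simp add: e_def field_simps)
  qed
  then show "\<exists>V. open V \<and> x \<in> V \<and> (\<forall>y\<in>A \<inter> V. a < u y + v y)"
    using V W by (intro exI[of _ "V \<inter> W"]) auto
qed

text \<open>The sum counts the positive integers up to \<open>N\<close> that are strictly below
  \<open>v\<close>. The induction carries the exact count \<open>N\<close> for \<open>v > N\<close>,
  since it is what the step needs when \<open>v\<close> lies between \<open>N\<close> and
  \<open>N + 1\<close>.\<close>

lemma sum_of_bool_less_ge:
  fixes v :: real
  shows "min v (real N) \<le> 1 + (\<Sum>i\<in>{1..N}. of_bool (real i < v))"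
proof -
  have "(v \<le> real N \<longrightarrow> v \<le> 1 + (\<Sum>i\<in>{1..N}. of_bool (real i < v))) \<and>
        (real N < v \<longrightarrow> (\<Sum>i\<in>{1..N}. of_bool (real i < v)) = real N)"
  proof (induction N)
    case (Suc N)
    have "(\<Sum>i\<in>{1..Suc N}. of_bool (real i < v)) =
        (\<Sum>i\<in>{1..N}. of_bool (real i < v)) + (of_bool (real (Suc N) < v) :: real)"
      by simp
    with Suc show ?case by (cases "v \<le> real N") auto
  qed auto
  then show ?thesis by (cases "v \<le> real N") auto
qed

text \<open>A layer-cake bound. With \<open>n * n\<close> levels of height \<open>1 / n\<close>, the
  step function \<open>s n\<close> reaches up to \<open>n\<close> and satisfies
  \<open>u - 1 / n \<le> s n\<close> as soon as \<open>n\<close> exceeds \<open>u\<close>; Fatou's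
  lemma passes to the limit. An integral bound is thereby reduced to measures of superlevel sets,
  which are open for a lower semicontinuous cost.\<close>

lemma nn_integral_le_layers:
  assumes "finite_measure M" and u[measurable]: "u \<in> borel_measurable M" and u0: "\<And>x. x \<in> space M \<Longrightarrow> 0 \<le> u x"
    and D: "\<And>n N :: nat. 0 < n \<Longrightarrow>
      (\<Sum>i\<in>{1..N}. measure M {x\<in>space M. real i / real n < u x}) / real n \<le> D"
  shows "(\<integral>\<^sup>+ x. ennreal (u x) \<partial>M) \<le> ennreal D"
proof -
  interpret finite_measure M by fact
  define s where "s n x = (\<Sum>i\<in>{1..n*n}. indicator {x\<in>space M. real i / real n < u x} x) / real n"
    for n :: nat and x
  have s_int: "(\<integral>\<^sup>+ x. ennreal (s n x) \<partial>M) \<le> ennreal D" if n: "0 < n" for n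
  proof -
    have ind: "integrable M (indicator {x\<in>space M. real i / real n < u x} :: _ \<Rightarrow> real)" for i
      by (intro integrable_real_indicator) (auto simp: less_top[symmetric])
    have int: "integrable M (s n)" unfolding s_def
      by (intro integrable_divide_zero Bochner_Integration.integrable_sum ind)
    have "(\<integral>\<^sup>+ x. ennreal (s n x) \<partial>M) = ennreal (\<integral>x. s n x \<partial>M)"
      by (intro nn_integral_eq_integral int) (auto simp: s_def intro!: sum_nonneg divide_nonneg_nonneg)
    also have "(\<integral>x. s n x \<partial>M) = (\<Sum>i\<in>{1..n*n}. measure M {x\<in>space M. real i / real n < u x}) / real n"
      using ind by (simp add: s_def Bochner_Integration.integral_sum Int_absorb2)
    finally show ?thesis using D[OF n] by (simp add: ennreal_leI)
  qed
  have "(\<integral>\<^sup>+ x. ennreal (u x) \<partial>M) \<le> (\<integral>\<^sup>+ x. liminf (\<lambda>n. ennreal (s n x)) \<partial>M)"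
  proof (rule nn_integral_mono)
    fix x assume x: "x \<in> space M"
    have "(\<lambda>n. ennreal (u x - 1 / real n)) \<longlonglongrightarrow> ennreal (u x - 0)"
      by (intro tendsto_ennrealI tendsto_diff tendsto_const lim_1_over_n)
    then have "ennreal (u x) = liminf (\<lambda>n. ennreal (u x - 1 / real n))"
      by (simp add: lim_imp_Liminf)
    also have "\<dots> \<le> liminf (\<lambda>n. ennreal (s n x))"
    proof (rule Liminf_mono)
      obtain n0 :: nat where n0: "u x \<le> real n0" using real_arch_simple by blast
      have "u x - 1 / real n \<le> s n x" if n: "n \<ge> max 1 n0" for n
      proof -
        have n': "0 < real n" "u x \<le> real n" using n n0 by linarith+
        have "real n * u x \<le> real (n * n)" using n' by simp
        then have "real n * u x \<le> 1 + (\<Sum>i\<in>{1..n*n}. of_bool (real i < real n * u x))"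
          using sum_of_bool_less_ge[of "real n * u x" "n*n"] by simp
        also have "(\<Sum>i\<in>{1..n*n}. of_bool (real i < real n * u x)) = real n * s n x"
          unfolding s_def using n' x by (simp add: indicator_def field_simps)
        finally show ?thesis using n' by (simp add: field_simps)
      qed
      then show "\<forall>\<^sub>F n in sequentially. ennreal (u x - 1 / real n) \<le> ennreal (s n x)"
        by (auto simp: eventually_sequentially intro!: exI[of _ "max 1 n0"] ennreal_leI)
    qed
    finally show "ennreal (u x) \<le> liminf (\<lambda>n. ennreal (s n x))" .
  qed
  also have "\<dots> \<le> liminf (\<lambda>n. \<integral>\<^sup>+ x. ennreal (s n x) \<partial>M)"
    by (intro nn_integral_liminf) (auto simp: s_def)
  also have "\<dots> \<le> liminf (\<lambda>n. ennreal D)"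
    using s_int by (intro Liminf_mono eventually_sequentiallyI[of 1]) auto
  also have "\<dots> = ennreal D" by (simp add: Liminf_const)
  finally show ?thesis .
qed

section \<open>Radon measures on a subspace\<close>

lemma sets_radon_measure_on:
  assumes "radon_measure_on X M" "X \<in> sets borel"
  shows "A \<in> sets M \<longleftrightarrow> A \<in> sets borel \<and> A \<subseteq> X"
  using assms by (auto simp: radon_measure_on_def sets_restrict_space_iff)

lemma space_radon_measure_on:
  assumes "radon_measure_on X M"
  shows "space M = X"
proof -
  have "sets M = sets (restrict_space borel X)" using assms by (simp add: radon_measure_on_def)
  from sets_eq_imp_space_eq[OF this] show ?thesis by (simp add: space_restrict_space)
qed

text \<open>Regularity gives a set \<open>F\<close> that is closed only relative to
  \<open>X\<close>; intersecting it with a compact set from tightness makes it compact. The two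
  losses are \<open>e/2\<close> each.\<close>

lemma radon_measure_on_inner_compact:
  fixes X :: "'b::t2_space set"
  assumes M: "radon_measure_on X M" and X: "X \<in> sets borel" and A: "A \<in> sets M" and e: "0 < e"
  obtains K where "compact K" "K \<subseteq> A" "measure M (A - K) < e"
proof -
  note sets = sets_radon_measure_on[OF M X]
  interpret finite_measure M using M by (simp add: radon_measure_on_def)
  have e2: "0 < e/2" using e by simp
  obtain F G where FG: "closedin (top_of_set X) F" "openin (top_of_set X) G"
    "F \<subseteq> A" "A \<subseteq> G" "measure M (G - F) < e/2"
    using M A e2 unfolding radon_measure_on_def by metis
  obtain K where K: "compact K" "K \<subseteq> X" "measure M (X - K) < e/2"
    using M e2 unfolding radon_measure_on_def by metis
  obtain F' where F': "closed F'" "F = X \<inter> F'" using FG(1) by (auto simp: closedin_closed)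
  obtain G' where G': "open G'" "G = X \<inter> G'" using FG(2) by (auto simp: openin_open)
  have cl: "closed K" using K compact_imp_closed by blast
  have meas: "G - F \<in> sets M" "X - K \<in> sets M"
    using X F' G' cl by (auto simp: sets)
  show thesis
  proof (rule that)
    have "F \<inter> K = F' \<inter> K" using F' K by auto
    then show "compact (F \<inter> K)" using F' K by (simp add: closed_Int_compact)
    show "F \<inter> K \<subseteq> A" using FG by auto
    have "measure M (A - F \<inter> K) \<le> measure M ((G - F) \<union> (X - K))"
      using meas FG(4) A by (intro finite_measure_mono) (auto simp: sets)
    also have "\<dots> \<le> measure M (G - F) + measure M (X - K)"
      using meas by (intro measure_Un_le)
    finally show "measure M (A - F \<inter> K) < e" using FG K by linarith
  qed
qed

lemma continuous_radon_integrable: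
  assumes M: "radon_measure_on X M" and u: "continuous_on UNIV u" and B: "\<And>x. \<bar>u x\<bar> \<le> (B :: real)"
  shows "integrable M u"
proof -
  interpret finite_measure M using M by (simp add: radon_measure_on_def)
  have "u \<in> borel_measurable (restrict_space borel X)"
    using borel_measurable_continuous_onI[OF u] by (rule measurable_restrict_space1)
  then have "u \<in> borel_measurable M"
    using M measurable_cong_sets[of M "restrict_space borel X" borel "borel :: real measure"] by (simp add: radon_measure_on_def)
  then show ?thesis by (intro integrable_const_bound[where B=B]) (auto simp: B)
qed

text \<open>\<open>L\<close> abstracts the extensions of \<open>1\<close>-Lipschitz functions: all that matters is that they form
  a lattice of continuous functions and that \<open>c\<close> is the induced metric.\<close>

locale lattice_cost =
  fixes X :: "'u::t2_space set" and L :: "('u \<Rightarrow> real) set" and c :: "'u \<Rightarrow> 'u \<Rightarrow> real"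
  assumes compact_UNIV: "compact (UNIV :: 'u set)"
    and open_X: "open X"
    and L_continuous: "\<And>f. f \<in> L \<Longrightarrow> continuous_on X f"
    and L_const: "\<And>a. (\<lambda>_. a) \<in> L"
    and L_uminus: "\<And>f. f \<in> L \<Longrightarrow> (\<lambda>x. - f x) \<in> L"
    and L_shift: "\<And>f a. f \<in> L \<Longrightarrow> (\<lambda>x. f x + a) \<in> L"
    and L_max: "\<And>f g. f \<in> L \<Longrightarrow> g \<in> L \<Longrightarrow> (\<lambda>x. max (f x) (g x)) \<in> L"
    and cost_upper: "\<And>f x y. f \<in> L \<Longrightarrow> x \<in> X \<Longrightarrow> y \<in> X \<Longrightarrow> f x - f y \<le> c x y"
    and cost_approx: "\<And>x y a. x \<in> X \<Longrightarrow> y \<in> X \<Longrightarrow> a < c x y \<Longrightarrow> \<exists>f\<in>L. a < f x - f y"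
begin

lemma L_min: "f \<in> L \<Longrightarrow> g \<in> L \<Longrightarrow> (\<lambda>x. min (f x) (g x)) \<in> L"
  using L_uminus[OF L_max[OF L_uminus L_uminus]] by (simp add: minus_max_eq_min)

lemma cost_nonneg: "x \<in> X \<Longrightarrow> y \<in> X \<Longrightarrow> 0 \<le> c x y"
  using cost_upper[OF L_const[of 0]] by simp

lemma cost_self: "x \<in> X \<Longrightarrow> c x x = 0"
  using cost_nonneg[of x x] cost_approx[of x x 0] by fastforce

lemma cost_sym_le:
  assumes "x \<in> X" "y \<in> X"
  shows "c x y \<le> c y x"
proof (rule ccontr)
  assume "\<not> c x y \<le> c y x"
  then obtain f where "f \<in> L" "c y x < f x - f y" using cost_approx assms by (meson not_le)
  then show False using cost_upper[OF L_uminus, of f y x] assms by auto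
qed

lemma cost_sym: "x \<in> X \<Longrightarrow> y \<in> X \<Longrightarrow> c x y = c y x"
  by (intro antisym cost_sym_le)

lemma cost_triangle:
  assumes "x \<in> X" "y \<in> X" "w \<in> X"
  shows "c x w \<le> c x y + c y w"
proof (rule ccontr)
  assume "\<not> c x w \<le> c x y + c y w"
  then obtain f where "f \<in> L" "c x y + c y w < f x - f w" using cost_approx assms by (meson not_le)
  then show False using cost_upper[of f x y] cost_upper[of f y w] assms by auto
qed

lemma lsc_cost: "lsc_on (X \<times> X) (\<lambda>p. c (fst p) (snd p))"
  unfolding lsc_on_def
proof (intro ballI allI impI)
  fix p a assume p: "p \<in> X \<times> X" "a < c (fst p) (snd p)"
  then have px: "fst p \<in> X" "snd p \<in> X" by auto
  obtain f where f: "f \<in> L" "a < f (fst p) - f (snd p)" using cost_approx[OF px p(2)] by blast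
  have cont: "continuous_on (X \<times> X) (\<lambda>p. f (fst p) - f (snd p))"
    by (intro continuous_on_diff continuous_on_compose2[OF L_continuous[OF f(1)]]
      continuous_on_fst continuous_on_snd continuous_on_id) auto
  obtain V where V: "open V" "p \<in> V" "\<forall>q\<in>X \<times> X \<inter> V. a < f (fst q) - f (snd q)"
    using lsc_onD[OF continuous_imp_lsc_on[OF cont] p(1) f(2)] by blast
  have "a < c (fst q) (snd q)" if "q \<in> X \<times> X" "q \<in> V" for q
  proof -
    have "fst q \<in> X" "snd q \<in> X" "a < f (fst q) - f (snd q)" using that V(3) by auto
    then show ?thesis using cost_upper[OF f(1), of "fst q" "snd q"] by linarith
  qed
  then show "\<exists>V. open V \<and> p \<in> V \<and> (\<forall>y\<in>X \<times> X \<inter> V. a < c (fst y) (snd y))"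
    using V by blast
qed

lemma lsc_cost_slice: "y \<in> X \<Longrightarrow> lsc_on X (\<lambda>x. c x y)"
  using lsc_on_compose[OF lsc_cost, of X "\<lambda>x. (x, y)"]
    continuous_on_Pair[OF continuous_on_id continuous_on_const, of X y] by (auto simp: image_subset_iff)

text \<open>The hypothesis bounds every difference of prescribed values by the cost, so
  \<open>cost_approx\<close> solves the problem at each pair of points with some margin. For fixed
  \<open>x\<close>, finitely many solutions have a minimum below \<open>g + e\<close> on all of
  \<open>K\<close>; a finite maximum over \<open>x\<close> of such minima then also lies above
  \<open>\<phi> - e\<close>.\<close>

lemma interpolation:
  assumes K: "compact K" "K \<subseteq> X" and \<phi>: "continuous_on K \<phi>" and g: "continuous_on K g"
    and le: "\<And>x y. x \<in> K \<Longrightarrow> y \<in> K \<Longrightarrow> \<phi> x - g y \<le> c x y" and e: "0 < e"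
  obtains f where "f \<in> L" "\<And>x. x \<in> K \<Longrightarrow> \<phi> x - e < f x" "\<And>x. x \<in> K \<Longrightarrow> f x < g x + e"
proof -
  have fc: "continuous_on K f" if "f \<in> L" for f
    using L_continuous[OF that] K(2) by (rule continuous_on_subset)
  have nbhd: "\<exists>V. open V \<and> x \<in> V \<and> (\<forall>y\<in>K \<inter> V. u y < v y)"
    if "continuous_on K u" "continuous_on K v" "x \<in> K" "u x < v x" for u v :: "'u \<Rightarrow> real" and x
    using open_Collect_less_Int[OF that(1,2)] that(3,4) by blast
  have step1: "\<exists>f\<in>L. (\<forall>y\<in>K. f y < g y + e) \<and> \<phi> x - e < f x" if x: "x \<in> K" for x
  proof -
    let ?Q = "\<lambda>A. \<exists>f\<in>L. (\<forall>y\<in>A. f y < g y + e) \<and> \<phi> x - e < f x"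
    show "?Q K"
    proof (rule compact_union_induct[OF K(1)])
      show "?Q {}" using L_const[of "\<phi> x"] e by (intro bexI[of _ "\<lambda>_. \<phi> x"]) auto
      show "?Q (A \<union> B)" if A: "?Q A" and B: "?Q B" for A B
      proof -
        obtain f1 where f1: "f1 \<in> L" "\<And>y. y \<in> A \<Longrightarrow> f1 y < g y + e" "\<phi> x - e < f1 x" using A by blast
        obtain f2 where f2: "f2 \<in> L" "\<And>y. y \<in> B \<Longrightarrow> f2 y < g y + e" "\<phi> x - e < f2 x" using B by blast
        from f1 f2 show ?thesis
          by (intro bexI[of _ "\<lambda>y. min (f1 y) (f2 y)"] L_min) (auto simp: min_less_iff_disj)
      qed
      fix y assume y: "y \<in> K"
      have "\<phi> x - g y - e < c x y" using le[OF x y] e by linarith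
      then obtain f where f: "f \<in> L" "\<phi> x - g y - e < f x - f y"
        using cost_approx[of x y] x y K(2) by blast
      \<comment> \<open>The shift sets the value at \<open>x\<close> to
        \<open>\<phi> x - e/2\<close>, in the middle of the tolerance, so that the value at
        \<open>y\<close> stays below \<open>g y + e/2\<close>.\<close>
      define f' where "f' = (\<lambda>w. f w + (\<phi> x - e/2 - f x))"
      have f': "f' \<in> L" unfolding f'_def using L_shift[OF f(1)] .
      have "f' y < g y + e" using f(2) e unfolding f'_def by linarith
      then obtain V where "open V" "y \<in> V" "\<forall>w\<in>K \<inter> V. f' w < g w + e"
        using nbhd[OF fc[OF f'] continuous_on_add[OF g continuous_on_const[of K e]] y] by blast
      moreover have "\<phi> x - e < f' x" using e by (simp add: f'_def)
      ultimately show "\<exists>V. open V \<and> y \<in> V \<and> ?Q (K \<inter> V)" using f' by blast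
    qed
  qed
  let ?Q = "\<lambda>A. \<exists>f\<in>L. (\<forall>y\<in>K. f y < g y + e) \<and> (\<forall>y\<in>A. \<phi> y - e < f y)"
  have "?Q K"
  proof (rule compact_union_induct[OF K(1), where Q="?Q"])
    show "?Q {}"
    proof (cases "K = {}")
      case True then show ?thesis using L_const by auto
    next
      case False then show ?thesis using step1 by blast
    qed
    show "?Q (A \<union> B)" if A: "?Q A" and B: "?Q B" for A B
    proof -
      obtain f1 where f1: "f1 \<in> L" "\<And>y. y \<in> K \<Longrightarrow> f1 y < g y + e" "\<And>y. y \<in> A \<Longrightarrow> \<phi> y - e < f1 y" using A by blast
      obtain f2 where f2: "f2 \<in> L" "\<And>y. y \<in> K \<Longrightarrow> f2 y < g y + e" "\<And>y. y \<in> B \<Longrightarrow> \<phi> y - e < f2 y" using B by blast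
      from f1 f2 show ?thesis
        by (intro bexI[of _ "\<lambda>y. max (f1 y) (f2 y)"] L_max) (auto simp: less_max_iff_disj)
    qed
    fix x assume x: "x \<in> K"
    then obtain f where f: "f \<in> L" "\<forall>y\<in>K. f y < g y + e" "\<phi> x - e < f x" using step1 by blast
    then obtain V where "open V" "x \<in> V" "\<forall>w\<in>K \<inter> V. \<phi> w - e < f w"
      using nbhd[OF continuous_on_diff[OF \<phi> continuous_on_const[of K e]] fc[OF f(1)] x] by blast
    with f show "\<exists>V. open V \<and> x \<in> V \<and> ?Q (K \<inter> V)" by blast
  qed
  then show thesis using that by blast
qed

definition admissible :: "'u measure \<Rightarrow> bool" where
  "admissible M \<longleftrightarrow> radon_measure_on X M \<and> prob_space M \<and>
     (\<exists>x0\<in>X. (\<integral>\<^sup>+ x. ennreal (c x x0) \<partial>M) < \<infinity>)"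

lemma borel_X: "X \<in> sets borel"
  using open_X by simp

lemma borel_XX: "X \<times> X \<in> sets borel"
  using open_Times[OF open_X open_X] by simp

lemma measurable_radon_iff:
  fixes f :: "'b::topological_space \<Rightarrow> real"
  assumes "radon_measure_on Y M"
  shows "f \<in> borel_measurable M \<longleftrightarrow> f \<in> borel_measurable (restrict_space borel Y)"
  using assms measurable_cong_sets[of M "restrict_space borel Y" borel "borel :: real measure"]
  by (auto simp: radon_measure_on_def)

text \<open>The bound \<open>\<bar>f x0\<bar> + c x x0\<close> is integrable by the first moment.
  Measurability is assumed separately: the Lipschitz condition concerns the metric \<open>c\<close>
  and does not imply it for the topology.\<close>

lemma admissible_integrable:
  assumes M: "admissible M" and f: "f \<in> borel_measurable (restrict_space borel X)"
    and lip: "\<And>x y. x \<in> X \<Longrightarrow> y \<in> X \<Longrightarrow> f x - f y \<le> c x y"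
  shows "integrable M f"
proof -
  have radon: "radon_measure_on X M" using M by (simp add: admissible_def)
  interpret prob_space M using M by (simp add: admissible_def)
  have space: "space M = X" using space_radon_measure_on[OF radon] .
  obtain x0 where x0: "x0 \<in> X" "(\<integral>\<^sup>+ x. ennreal (c x x0) \<partial>M) < \<infinity>"
    using M by (auto simp: admissible_def)
  have f': "f \<in> borel_measurable M" using f measurable_radon_iff[OF radon] by blast
  have cm: "(\<lambda>x. c x x0) \<in> borel_measurable M"
    using lsc_on_measurable[OF lsc_cost_slice[OF x0(1)]] measurable_radon_iff[OF radon] by blast
  have "integrable M (\<lambda>x. c x x0)"
  proof (rule integrableI_nonneg[OF cm])
    show "AE x in M. 0 \<le> c x x0" using cost_nonneg x0 space by (intro AE_I2) auto
  qed (use x0 in auto)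
  then have "integrable M (\<lambda>x. \<bar>f x0\<bar> + c x x0)" by auto
  moreover have "\<bar>f x\<bar> \<le> \<bar>f x0\<bar> + c x x0" if "x \<in> X" for x
    using lip[OF that x0(1)] lip[OF x0(1) that] cost_sym[OF that x0(1)] by linarith
  ultimately show ?thesis
    using f' space cost_nonneg x0(1) by (elim Bochner_Integration.integrable_bound) (auto intro!: AE_I2)
qed

lemma L_measurable: "f \<in> L \<Longrightarrow> f \<in> borel_measurable (restrict_space borel X)"
  using lsc_on_measurable continuous_imp_lsc_on L_continuous by blast

lemma L_integrable: "admissible M \<Longrightarrow> f \<in> L \<Longrightarrow> integrable M f"
  by (intro admissible_integrable L_measurable cost_upper)

lemma cost_integrable:
  assumes "admissible M" "y \<in> X"
  shows "integrable M (\<lambda>x. c x y)"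
proof (rule admissible_integrable[OF assms(1)])
  show "c x y - c x' y \<le> c x x'" if "x \<in> X" "x' \<in> X" for x x'
    using cost_triangle[of x x' y] that assms by simp
qed (use lsc_on_measurable lsc_cost_slice assms in blast)

end

section \<open>The dual value of a transport problem\<close>

locale transport_problem = lattice_cost X L c for X :: "'u::t2_space set" and L c +
  fixes \<mu> \<nu> :: "'u measure"
  assumes \<mu>: "admissible \<mu>" and \<nu>: "admissible \<nu>"
begin

lemma radon: "radon_measure_on X \<mu>" "radon_measure_on X \<nu>"
  using \<mu> \<nu> by (auto simp: admissible_def)

sublocale \<mu>: prob_space \<mu>
  using \<mu> by (simp add: admissible_def)

sublocale \<nu>: prob_space \<nu>
  using \<nu> by (simp add: admissible_def)

definition dual_value :: real where
  "dual_value = (SUP f\<in>L. (\<integral>x. f x \<partial>\<mu>) - (\<integral>x. f x \<partial>\<nu>))"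

lemma X_nonempty: "X \<noteq> {}"
  using \<mu> by (auto simp: admissible_def)

text \<open>Comparing \<open>f\<close> with \<open>f x0\<close> up to the error
  \<open>c x x0\<close> cancels \<open>f x0\<close> and leaves the two first moments as a bound for
  all \<open>f\<close>. This makes the real supremum in \<open>dual_value\<close> a true
  one.\<close>

lemma dual_bdd: "bdd_above ((\<lambda>f. (\<integral>x. f x \<partial>\<mu>) - (\<integral>x. f x \<partial>\<nu>)) ` L)"
proof -
  obtain x0 where x0: "x0 \<in> X" using X_nonempty by auto
  have "(\<integral>x. f x \<partial>\<mu>) - (\<integral>x. f x \<partial>\<nu>) \<le> (\<integral>x. c x x0 \<partial>\<mu>) + (\<integral>x. c x x0 \<partial>\<nu>)" if f: "f \<in> L" for f
  proof -
    have "(\<integral>x. f x \<partial>\<mu>) \<le> (\<integral>x. c x x0 + f x0 \<partial>\<mu>)"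
    proof (rule integral_mono)
      show "integrable \<mu> (\<lambda>x. c x x0 + f x0)" using cost_integrable[OF \<mu> x0] by simp
      show "f x \<le> c x x0 + f x0" if "x \<in> space \<mu>" for x
        using cost_upper[OF f _ x0, of x] space_radon_measure_on[OF radon(1)] that by auto
    qed (rule L_integrable[OF \<mu> f])
    moreover have "(\<integral>x. f x0 - c x x0 \<partial>\<nu>) \<le> (\<integral>x. f x \<partial>\<nu>)"
    proof (rule integral_mono)
      show "integrable \<nu> (\<lambda>x. f x0 - c x x0)" using cost_integrable[OF \<nu> x0] by simp
      show "f x0 - c x x0 \<le> f x" if "x \<in> space \<nu>" for x
        using cost_upper[OF f x0, of x] cost_sym[OF x0, of x] space_radon_measure_on[OF radon(2)] that by auto
    qed (rule L_integrable[OF \<nu> f])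
    ultimately show ?thesis
      using cost_integrable[OF \<mu> x0] cost_integrable[OF \<nu> x0] by (simp add: \<mu>.prob_space \<nu>.prob_space)
  qed
  then show ?thesis by (intro bdd_aboveI2)
qed

lemma dual_upper: "f \<in> L \<Longrightarrow> (\<integral>x. f x \<partial>\<mu>) - (\<integral>x. f x \<partial>\<nu>) \<le> dual_value"
  unfolding dual_value_def by (rule cSUP_upper[OF _ dual_bdd])

lemma dual_nonneg: "0 \<le> dual_value"
  using dual_upper[OF L_const[of 0]] by simp

lemma continuous_bounded:
  fixes u :: "'b::topological_space \<Rightarrow> real"
  assumes "compact (UNIV :: 'b set)" "continuous_on UNIV u"
  shows "\<exists>B. \<forall>x. \<bar>u x\<bar> \<le> B"
  using compact_imp_bounded[OF compact_continuous_image[OF assms(2,1)]]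
  by (auto simp: bounded_iff)

text \<open>A compact \<open>K\<close> carrying almost all of both measures reduces the claim to
  \<open>interpolation\<close> with \<open>g = - \<psi>\<close>. The resulting member of the lattice
  lies above \<open>\<phi> - e/4\<close> and below \<open>- \<psi> + e/4\<close> on
  \<open>K\<close>, so it is a dual candidate nearly as good as the pair.\<close>

lemma dual_bound:
  assumes \<phi>: "continuous_on UNIV \<phi>" and \<psi>: "continuous_on UNIV \<psi>"
    and le: "\<And>x y. x \<in> X \<Longrightarrow> y \<in> X \<Longrightarrow> \<phi> x + \<psi> y \<le> c x y"
  shows "(\<integral>x. \<phi> x \<partial>\<mu>) + (\<integral>x. \<psi> x \<partial>\<nu>) \<le> dual_value"
proof (rule field_le_epsilon)
  fix e :: real assume e: "0 < e"
  obtain B1 where B1: "\<forall>x. \<bar>\<phi> x\<bar> \<le> B1" using continuous_bounded[OF compact_UNIV \<phi>] by blast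
  obtain B2 where B2: "\<forall>x. \<bar>\<psi> x\<bar> \<le> B2" using continuous_bounded[OF compact_UNIV \<psi>] by blast
  define B where "B = B1 + B2"
  have B: "\<bar>\<phi> x\<bar> \<le> B" "\<bar>\<psi> x\<bar> \<le> B" "0 \<le> B" for x
    using B1[rule_format, of x] B2[rule_format, of x] by (auto simp: B_def)
  \<comment> \<open>Off \<open>K\<close> each integral loses at most
    \<open>2 * B * d \<le> e/4\<close>; with the interpolation error \<open>e/4\<close> on each side
    the total is \<open>e\<close>. The summand \<open>1\<close> covers the case
    \<open>B = 0\<close>.\<close>
  define d where "d = e / (8 * (B + 1))"
  have d: "0 < d" "B * d \<le> e / 8" using e B(3) by (auto simp: d_def field_simps)
  have X: "X \<in> sets \<mu>" "X \<in> sets \<nu>" using sets_radon_measure_on[OF _ borel_X] radon borel_X by auto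
  obtain K1 where K1: "compact K1" "K1 \<subseteq> X" "measure \<mu> (X - K1) < d"
    using radon_measure_on_inner_compact[OF radon(1) borel_X X(1) d(1)] .
  obtain K2 where K2: "compact K2" "K2 \<subseteq> X" "measure \<nu> (X - K2) < d"
    using radon_measure_on_inner_compact[OF radon(2) borel_X X(2) d(1)] .
  define K where "K = K1 \<union> K2"
  have K: "compact K" "K \<subseteq> X" using K1 K2 by (auto simp: K_def)
  have cl: "closed K1" "closed K2" "closed K" using K1 K2 K compact_imp_closed by auto
  have sets1: "A \<in> sets \<mu>" if "A \<in> sets borel" "A \<subseteq> X" for A
    using that sets_radon_measure_on[OF radon(1) borel_X] by blast
  have sets2: "A \<in> sets \<nu>" if "A \<in> sets borel" "A \<subseteq> X" for A
    using that sets_radon_measure_on[OF radon(2) borel_X] by blast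
  have prob: "measure \<mu> X = 1" "measure \<nu> X = 1"
    using \<mu>.prob_space \<nu>.prob_space radon by (simp_all add: space_radon_measure_on)
  have XK: "X - K \<in> sets \<mu>" "X - K \<in> sets \<nu>"
    using cl borel_X by (auto intro!: sets1 sets2)
  have "measure \<mu> (X - K) \<le> measure \<mu> (X - K1)"
    using cl borel_X by (intro \<mu>.finite_measure_mono sets1) (auto simp: K_def)
  then have m1: "measure \<mu> (X - K) \<le> d" using K1 by simp
  have "measure \<nu> (X - K) \<le> measure \<nu> (X - K2)"
    using cl borel_X by (intro \<nu>.finite_measure_mono sets2) (auto simp: K_def)
  then have m2: "measure \<nu> (X - K) \<le> d" using K2 by simp
  have "\<phi> x - - \<psi> y \<le> c x y" if "x \<in> K" "y \<in> K" for x y using le[of x y] that K by auto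
  then obtain f0 where f0: "f0 \<in> L" "\<And>x. x \<in> K \<Longrightarrow> \<phi> x - e/4 < f0 x" "\<And>x. x \<in> K \<Longrightarrow> f0 x < - \<psi> x + e/4"
    using interpolation[OF K continuous_on_subset[OF \<phi>] continuous_on_subset[OF continuous_on_minus[OF \<psi>]], of "e/4"] e
    by auto
  \<comment> \<open>Truncation at \<open>B\<close> respects both interpolation inequalities on
    \<open>K\<close>, as \<open>\<phi>\<close> and \<open>\<psi>\<close> are bounded by
    \<open>B\<close>, and it limits the error off \<open>K\<close> to \<open>2 * B\<close>.\<close>
  define f where "f x = max (-B) (min B (f0 x))" for x
  have f: "f \<in> L" unfolding f_def by (intro L_max L_min L_const f0)
  have f_bd: "- B \<le> f x" "f x \<le> B" for x using B(3) by (auto simp: f_def)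
  have ind: "indicator (X - K) x = (1::real)" if "x \<in> X" "x \<notin> K" for x using that by simp
  have "(\<integral>x. \<phi> x \<partial>\<mu>) \<le> (\<integral>x. (f x + e/4) + 2 * B * indicator (X - K) x \<partial>\<mu>)"
  proof (rule integral_mono)
    show "integrable \<mu> \<phi>" by (rule continuous_radon_integrable[OF radon(1) \<phi> B(1)])
    show "integrable \<mu> (\<lambda>x. (f x + e/4) + 2 * B * indicator (X - K) x)"
      using L_integrable[OF \<mu> f] XK by (auto simp: less_top[symmetric])
    fix x assume "x \<in> space \<mu>"
    then have x: "x \<in> X" using space_radon_measure_on[OF radon(1)] by simp
    show "\<phi> x \<le> (f x + e/4) + 2 * B * indicator (X - K) x"
    proof (cases "x \<in> K")
      case True
      then show ?thesis using f0(2)[OF True] B(1)[of x] e by (auto simp: f_def max_def min_def)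
    next
      case False
      then show ?thesis using ind[OF x False] B(1)[of x] f_bd[of x] e by auto
    qed
  qed
  also have "\<dots> = (\<integral>x. f x \<partial>\<mu>) + e/4 + 2 * B * measure \<mu> (X - K)"
    using L_integrable[OF \<mu> f] XK space_radon_measure_on[OF radon(1)] by (simp add: prob less_top[symmetric] Int_absorb2)
  also have "\<dots> \<le> (\<integral>x. f x \<partial>\<mu>) + e/4 + 2 * (B * d)"
    using m1 B(3) by (simp add: mult_left_mono)
  finally have 1: "(\<integral>x. \<phi> x \<partial>\<mu>) \<le> (\<integral>x. f x \<partial>\<mu>) + e/4 + 2 * (B * d)" .
  have "(\<integral>x. \<psi> x \<partial>\<nu>) \<le> (\<integral>x. (- f x + e/4) + 2 * B * indicator (X - K) x \<partial>\<nu>)"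
  proof (rule integral_mono)
    show "integrable \<nu> \<psi>" by (rule continuous_radon_integrable[OF radon(2) \<psi> B(2)])
    show "integrable \<nu> (\<lambda>x. (- f x + e/4) + 2 * B * indicator (X - K) x)"
      using L_integrable[OF \<nu> f] XK by (auto simp: less_top[symmetric])
    fix x assume "x \<in> space \<nu>"
    then have x: "x \<in> X" using space_radon_measure_on[OF radon(2)] by simp
    show "\<psi> x \<le> (- f x + e/4) + 2 * B * indicator (X - K) x"
    proof (cases "x \<in> K")
      case True
      then show ?thesis using f0(3)[OF True] B(2)[of x] e by (auto simp: f_def max_def min_def)
    next
      case False
      then show ?thesis using ind[OF x False] B(2)[of x] f_bd[of x] e by auto
    qed
  qed
  also have "\<dots> = - (\<integral>x. f x \<partial>\<nu>) + e/4 + 2 * B * measure \<nu> (X - K)"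
    using L_integrable[OF \<nu> f] XK space_radon_measure_on[OF radon(2)] by (simp add: prob less_top[symmetric] Int_absorb2)
  also have "\<dots> \<le> - (\<integral>x. f x \<partial>\<nu>) + e/4 + 2 * (B * d)"
    using m2 B(3) by (simp add: mult_left_mono)
  finally have "(\<integral>x. \<psi> x \<partial>\<nu>) \<le> - (\<integral>x. f x \<partial>\<nu>) + e/4 + 2 * (B * d)" .
  with 1 dual_upper[OF f] d(2)
  show "(\<integral>x. \<phi> x \<partial>\<mu>) + (\<integral>x. \<psi> x \<partial>\<nu>) \<le> dual_value + e" by linarith
qed

end

section \<open>Existence of an optimal coupling\<close>

lemma bcontfun_compact:
  fixes u :: "'b::topological_space \<Rightarrow> real"
  assumes "compact (UNIV :: 'b set)" "continuous_on UNIV u"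
  shows "apply_bcontfun (Bcontfun u) = u"
  using assms compact_imp_bounded[OF compact_continuous_image[OF assms(2,1)]]
  by (intro Bcontfun_inverse) (simp add: bcontfun_def)

section \<open>Inner regularity and marginals of the Riesz measure\<close>

text \<open>The complement of an open set slightly larger than \<open>- A\<close> is closed in a
  compact space, hence compact.\<close>

lemma outer_regular_inner_compact:
  fixes P :: "'b::t2_space measure"
  assumes compact: "compact (UNIV :: 'b set)" and sets: "sets P = sets borel" and "prob_space P"
    and outer: "\<And>A e. A \<in> sets borel \<Longrightarrow> 0 < e \<Longrightarrow> \<exists>G. open G \<and> A \<subseteq> G \<and> measure P G < measure P A + e"
    and A: "A \<in> sets borel" and e: "0 < e"
  shows "\<exists>K. compact K \<and> K \<subseteq> A \<and> measure P (A - K) < e"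
proof -
  interpret prob_space P by fact
  obtain G where G: "open G" "- A \<subseteq> G" "measure P G < measure P (- A) + e"
    using outer[of "- A" e] A e by auto
  have "closed (- G)" using G(1) by (simp add: closed_Compl)
  then have "compact (- G)" using compact_Int_closed[OF compact] by fastforce
  moreover have "- G \<subseteq> A" using G(2) by auto
  moreover have "measure P (G - - A) = measure P G - measure P (- A)"
    using G A sets by (intro finite_measure_Diff) auto
  moreover have "A - - G = G - - A" by auto
  ultimately show ?thesis using G(3) by (intro exI[of _ "- G"]) auto
qed

text \<open>\<open>\<Lambda>\<close> sees \<open>M\<close> only through integrals of continuous
  functions. A Urysohn function that is \<open>1\<close> on a compact part of
  \<open>G \<inter> X\<close> and vanishes off \<open>G\<close> transfers the mass: its pullback
  under \<open>pr\<close> is a bump of the preimage of \<open>G\<close>.\<close>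

lemma marginal_open_ge:
  fixes pr :: "'b::t2_space \<Rightarrow> 'u::t2_space"
  assumes "positive_functional \<Lambda>"
    and cU: "compact (UNIV :: 'u set)"
    and P: "\<And>G h. open G \<Longrightarrow> bump G h \<Longrightarrow> \<Lambda> h \<le> measure P G"
    and pr: "continuous_on UNIV pr"
    and X: "X \<in> sets borel" and M: "radon_measure_on X M"
    and \<Lambda>: "\<And>\<phi>. continuous_on UNIV \<phi> \<Longrightarrow> \<Lambda> (\<lambda>p. \<phi> (pr p)) = (\<integral>x. \<phi> x \<partial>M)"
    and G: "open G"
  shows "measure M (G \<inter> X) \<le> measure P (pr -` G)"
proof (rule field_le_epsilon)
  fix e :: real assume e: "0 < e"
  interpret positive_functional \<Lambda> by fact
  interpret M: finite_measure M using M by (simp add: radon_measure_on_def)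
  have GX: "G \<inter> X \<in> sets M" using G X sets_radon_measure_on[OF M X] by auto
  obtain K where K: "compact K" "K \<subseteq> G \<inter> X" "measure M (G \<inter> X - K) < e"
    using radon_measure_on_inner_compact[OF M X GX e] .
  have "closed K" using K compact_imp_closed by blast
  then have KM: "K \<in> sets M" using K sets_radon_measure_on[OF M X] by auto
  obtain \<phi> where \<phi>: "bump G \<phi>" "\<And>x. x \<in> K \<Longrightarrow> \<phi> x = 1"
    using bump_Urysohn[OF cU \<open>closed K\<close> G] K by auto
  have \<phi>c: "continuous_on UNIV \<phi>" using \<phi> by (simp add: bump_def)
  have "measure M (G \<inter> X - K) = measure M (G \<inter> X) - measure M K"
    using GX KM K by (intro M.finite_measure_Diff) auto
  then have "measure M (G \<inter> X) \<le> measure M K + e" using K by simp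
  moreover have "measure M K = (\<integral>x. indicator K x \<partial>M)"
    using KM sets.sets_into_space[OF KM] by (simp add: Int_absorb2)
  moreover have "\<dots> \<le> (\<integral>x. \<phi> x \<partial>M)"
  proof (rule integral_mono)
    show "integrable M (indicator K :: 'u \<Rightarrow> real)"
      using KM by (intro integrable_real_indicator) (auto simp: less_top[symmetric])
    show "integrable M \<phi>"
      using \<phi>(1) bump_le_1[OF \<phi>(1)] by (intro continuous_radon_integrable[OF M \<phi>c, of 1]) (auto simp: bump_def)
    show "indicator K x \<le> \<phi> x" for x
      using \<phi> by (auto simp: bump_def indicator_def)
  qed
  moreover have "(\<integral>x. \<phi> x \<partial>M) \<le> measure P (pr -` G)"
  proof -
    have "bump (pr -` G) (\<lambda>p. \<phi> (pr p))"
      using \<phi>(1) continuous_on_compose2[OF \<phi>c pr] by (auto simp: bump_def indicator_def)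
    moreover have "open (pr -` G)" using G pr by (simp add: continuous_on_open_vimage)
    ultimately show ?thesis using P \<Lambda>[OF \<phi>c] by force
  qed
  ultimately show "measure M (G \<inter> X) \<le> measure P (pr -` G) + e" by linarith
qed

text \<open>A lower bound on open sets determines everything because both masses are
  \<open>1\<close>. A compact set in the preimage of \<open>B\<close> has a closed image in
  \<open>B\<close>; the open complement of this image turns the lower bound into an upper bound for
  \<open>B\<close>. The upper bounds for \<open>A\<close> and \<open>X - A\<close> together leave no
  room for a strict inequality.\<close>

lemma marginal_eq:
  fixes pr :: "'b::t2_space \<Rightarrow> 'u::t2_space"
  assumes sets: "sets P = sets borel" and "prob_space P"
    and inner: "\<And>A e. A \<in> sets borel \<Longrightarrow> 0 < e \<Longrightarrow> \<exists>K. compact K \<and> K \<subseteq> A \<and> measure P (A - K) < e"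
    and ge: "\<And>G. open G \<Longrightarrow> measure M (G \<inter> X) \<le> measure P (pr -` G)"
    and pr: "continuous_on UNIV pr" and X: "open X" and M: "radon_measure_on X M" "prob_space M"
    and A: "A \<in> sets M"
  shows "measure P (pr -` A) = measure M A"
proof -
  interpret P: prob_space P by fact
  interpret M: prob_space M by fact
  have bX: "X \<in> sets borel" using X by simp
  note setsM = sets_radon_measure_on[OF M(1) bX]
  have space: "space M = X" "space P = UNIV"
    using space_radon_measure_on[OF M(1)] sets_eq_imp_space_eq[OF sets] by auto
  have vim: "pr -` B \<in> sets P" if "B \<in> sets borel" for B
    using measurable_sets[OF borel_measurable_continuous_onI[OF pr] that] sets by simp
  have le: "measure P (pr -` B) \<le> measure M B" if B: "B \<in> sets M" for B
  proof (rule field_le_epsilon)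
    fix e :: real assume e: "0 < e"
    have bB: "B \<in> sets borel" "B \<subseteq> X" using B setsM by auto
    obtain K where K: "compact K" "K \<subseteq> pr -` B" "measure P (pr -` B - K) < e"
      using inner[of "pr -` B" e] vim[OF bB(1)] sets e by auto
    define K' where "K' = pr ` K"
    have "compact K'" unfolding K'_def using K pr
      by (intro compact_continuous_image) (auto intro: continuous_on_subset)
    then have cl: "closed K'" by (rule compact_imp_closed)
    have K'B: "K' \<subseteq> B" using K by (auto simp: K'_def)
    have K'M: "K' \<in> sets M" using cl K'B bB setsM by auto
    have KP: "K \<in> sets P" using compact_imp_closed[OF K(1)] sets by auto
    have "measure P (pr -` B) = measure P (pr -` B - K) + measure P K"
      using P.finite_measure_Diff[OF vim[OF bB(1)] KP K(2)] by simp
    moreover have "measure P K \<le> measure P (pr -` K')"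
      using cl by (intro P.finite_measure_mono vim) (auto simp: K'_def)
    moreover have "measure P (pr -` K') = 1 - measure P (pr -` (- K'))"
      using P.prob_compl[OF vim[of "- K'"]] cl by (simp add: space vimage_Compl[symmetric] Compl_eq_Diff_UNIV[symmetric])
    moreover have "measure M (- K' \<inter> X) \<le> measure P (pr -` (- K'))"
      using cl by (intro ge) auto
    moreover have "measure M (- K' \<inter> X) = 1 - measure M K'"
      using M.prob_compl[OF K'M] by (simp add: space Diff_eq Int_commute)
    moreover have "measure M K' \<le> measure M B"
      using B K'B by (intro M.finite_measure_mono) auto
    ultimately show "measure P (pr -` B) \<le> measure M B + e" using K(3) by linarith
  qed
  have bA: "A \<in> sets borel" "A \<subseteq> X" using A setsM by auto
  have XA: "X - A \<in> sets M" using bA bX setsM by auto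
  have "1 \<le> measure P (pr -` X)" using ge[OF X] M.prob_space space by simp
  also have "pr -` X = pr -` (X - A) \<union> pr -` A" using bA by auto
  also have "measure P \<dots> \<le> measure P (pr -` (X - A)) + measure P (pr -` A)"
    using bA bX by (intro measure_Un_le vim) auto
  also have "measure P (pr -` (X - A)) \<le> measure M (X - A)" by (rule le[OF XA])
  also have "measure M (X - A) = 1 - measure M A" using M.prob_compl[OF A] space by simp
  finally show ?thesis using le[OF A] by linarith
qed

context transport_problem
begin

text \<open>\<open>demand h s\<close> collects the bounds \<open>\<Lambda> h \<le> s\<close> that hold for every positive functional \<open>\<Lambda>\<close> on the
  square with marginals \<open>\<mu>\<close>, \<open>\<nu>\<close> and cost at most \<^term>\<open>dual_value\<close>.\<close>

definition demand :: "(('u \<times> 'u) \<Rightarrow>\<^sub>C real) \<Rightarrow> real \<Rightarrow> bool" where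
  "demand h s \<longleftrightarrow> (\<exists>\<phi> \<psi> k t. continuous_on UNIV \<phi> \<and> continuous_on UNIV \<psi> \<and> continuous_on UNIV k \<and> 0 \<le> t \<and>
     (\<forall>x\<in>X. \<forall>y\<in>X. k (x, y) \<le> t * c x y) \<and>
     (\<forall>x\<in>X. \<forall>y\<in>X. apply_bcontfun h (x, y) \<le> \<phi> x + \<psi> y + k (x, y)) \<and>
     s = (\<integral>x. \<phi> x \<partial>\<mu>) + (\<integral>x. \<psi> x \<partial>\<nu>) + t * dual_value)"

lemma continuous_integrable:
  assumes "continuous_on UNIV u" "radon_measure_on X M"
  shows "integrable M (u :: 'u \<Rightarrow> real)"
proof -
  obtain B where "\<forall>x. \<bar>u x\<bar> \<le> B" using continuous_bounded[OF compact_UNIV assms(1)] by blast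
  then show ?thesis using continuous_radon_integrable[OF assms(2,1)] by blast
qed

lemma demand_add:
  assumes "demand h s" "demand h' s'"
  shows "demand (h + h') (s + s')"
proof -
  obtain \<phi> \<psi> k t where 1: "continuous_on UNIV \<phi>" "continuous_on UNIV \<psi>" "continuous_on UNIV k" "0 \<le> t"
     "\<forall>x\<in>X. \<forall>y\<in>X. k (x, y) \<le> t * c x y"
     "\<forall>x\<in>X. \<forall>y\<in>X. apply_bcontfun h (x, y) \<le> \<phi> x + \<psi> y + k (x, y)"
     "s = (\<integral>x. \<phi> x \<partial>\<mu>) + (\<integral>x. \<psi> x \<partial>\<nu>) + t * dual_value"
    using assms(1) unfolding demand_def by blast
  obtain \<phi>' \<psi>' k' t' where 2: "continuous_on UNIV \<phi>'" "continuous_on UNIV \<psi>'" "continuous_on UNIV k'" "0 \<le> t'"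
     "\<forall>x\<in>X. \<forall>y\<in>X. k' (x, y) \<le> t' * c x y"
     "\<forall>x\<in>X. \<forall>y\<in>X. apply_bcontfun h' (x, y) \<le> \<phi>' x + \<psi>' y + k' (x, y)"
     "s' = (\<integral>x. \<phi>' x \<partial>\<mu>) + (\<integral>x. \<psi>' x \<partial>\<nu>) + t' * dual_value"
    using assms(2) unfolding demand_def by blast
  have "k (x, y) + k' (x, y) \<le> (t + t') * c x y" if "x \<in> X" "y \<in> X" for x y
    using 1(5) 2(5) that by (simp add: distrib_right add_mono)
  moreover have "apply_bcontfun (h + h') (x, y) \<le> (\<phi> x + \<phi>' x) + (\<psi> y + \<psi>' y) + (k (x, y) + k' (x, y))"
    if "x \<in> X" "y \<in> X" for x y
  proof -
    have "apply_bcontfun h (x, y) \<le> \<phi> x + \<psi> y + k (x, y)" "apply_bcontfun h' (x, y) \<le> \<phi>' x + \<psi>' y + k' (x, y)"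
      using 1(6) 2(6) that by blast+
    then show ?thesis by simp
  qed
  moreover have "s + s' = (\<integral>x. \<phi> x + \<phi>' x \<partial>\<mu>) + (\<integral>x. \<psi> x + \<psi>' x \<partial>\<nu>) + (t + t') * dual_value"
    using 1 2 radon by (simp add: continuous_integrable distrib_right)
  ultimately show ?thesis
    unfolding demand_def using 1(1-4) 2(1-4)
    by (intro exI[of _ "\<lambda>x. \<phi> x + \<phi>' x"] exI[of _ "\<lambda>x. \<psi> x + \<psi>' x"] exI[of _ "\<lambda>x. k x + k' x"]
        exI[of _ "t + t'"]) (simp add: continuous_on_add)
qed

lemma demand_scale:
  assumes a: "0 < a" and "demand h s"
  shows "demand (a *\<^sub>R h) (a * s)"
proof -
  obtain \<phi> \<psi> k t where 1: "continuous_on UNIV \<phi>" "continuous_on UNIV \<psi>" "continuous_on UNIV k" "0 \<le> t"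
     "\<forall>x\<in>X. \<forall>y\<in>X. k (x, y) \<le> t * c x y"
     "\<forall>x\<in>X. \<forall>y\<in>X. apply_bcontfun h (x, y) \<le> \<phi> x + \<psi> y + k (x, y)"
     "s = (\<integral>x. \<phi> x \<partial>\<mu>) + (\<integral>x. \<psi> x \<partial>\<nu>) + t * dual_value"
    using assms(2) unfolding demand_def by blast
  have "a * k (x, y) \<le> (a * t) * c x y" if "x \<in> X" "y \<in> X" for x y
    using 1(5) that a by simp
  moreover have "apply_bcontfun (a *\<^sub>R h) (x, y) \<le> a * \<phi> x + a * \<psi> y + a * k (x, y)"
    if "x \<in> X" "y \<in> X" for x y
  proof -
    have "a * apply_bcontfun h (x, y) \<le> a * (\<phi> x + \<psi> y + k (x, y))"
      using 1(6) that a by (intro mult_left_mono) auto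
    then show ?thesis by (simp add: distrib_left)
  qed
  moreover have "a * s = (\<integral>x. a * \<phi> x \<partial>\<mu>) + (\<integral>x. a * \<psi> x \<partial>\<nu>) + (a * t) * dual_value"
    using 1 by (simp add: distrib_left)
  ultimately show ?thesis
    unfolding demand_def using 1(1-4) a
    by (intro exI[of _ "\<lambda>x. a * \<phi> x"] exI[of _ "\<lambda>x. a * \<psi> x"] exI[of _ "\<lambda>x. a * k x"]
        exI[of _ "a * t"]) (simp add: continuous_on_mult_left)
qed

text \<open>Consistency of the demands is the dual bound in disguise: a demand on \<open>0\<close>
  means \<open>- \<phi> - \<psi> \<le> k \<le> t * c\<close> on the square, so
  \<open>- \<phi> / t\<close> and \<open>- \<psi> / t\<close> are admissible dual functions when
  \<open>t\<close> is positive.\<close>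

lemma demand_zero_nonneg:
  assumes "demand 0 s"
  shows "0 \<le> s"
proof -
  obtain \<phi> \<psi> k t where 1: "continuous_on UNIV \<phi>" "continuous_on UNIV \<psi>" "0 \<le> t"
     "\<forall>x\<in>X. \<forall>y\<in>X. k (x, y) \<le> t * c x y"
     "\<forall>x\<in>X. \<forall>y\<in>X. 0 \<le> \<phi> x + \<psi> y + k (x, y)"
     "s = (\<integral>x. \<phi> x \<partial>\<mu>) + (\<integral>x. \<psi> x \<partial>\<nu>) + t * dual_value"
    using assms unfolding demand_def by auto
  have *: "0 \<le> s + d * dual_value" if d: "0 < d" for d
  proof -
    \<comment> \<open>\<open>t\<close> may be \<open>0\<close>, so it is enlarged by an arbitrarily
      small \<open>d\<close> before dividing; nonnegativity of the cost keeps the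
      inequality.\<close>
    define r where "r = t + d"
    have r: "0 < r" using 1 d by (simp add: r_def)
    have "(\<integral>x. - \<phi> x / r \<partial>\<mu>) + (\<integral>x. - \<psi> x / r \<partial>\<nu>) \<le> dual_value"
    proof (rule dual_bound)
      show "continuous_on UNIV (\<lambda>x. - \<phi> x / r)" "continuous_on UNIV (\<lambda>x. - \<psi> x / r)"
        using r 1 by (auto intro!: continuous_intros)
      fix x y assume xy: "x \<in> X" "y \<in> X"
      have "k (x, y) \<le> t * c x y" "0 \<le> \<phi> x + \<psi> y + k (x, y)" using 1(4,5) xy by blast+
      moreover have "t * c x y \<le> r * c x y"
        using cost_nonneg[OF xy] d by (intro mult_right_mono) (auto simp: r_def)
      ultimately have "- \<phi> x - \<psi> y \<le> r * c x y" by linarith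
      then show "- \<phi> x / r + - \<psi> y / r \<le> c x y" using r by (simp add: field_simps)
    qed
    then have "- (\<integral>x. \<phi> x \<partial>\<mu>) - (\<integral>x. \<psi> x \<partial>\<nu>) \<le> r * dual_value"
      using r by (simp add: field_simps)
    then show ?thesis by (simp add: 1(6) r_def distrib_right)
  qed
  show "0 \<le> s"
  proof (rule ccontr)
    assume s: "\<not> 0 \<le> s"
    \<comment> \<open>This makes \<open>d * dual_value\<close> at most \<open>- s / 2\<close>, too
      little to lift a negative \<open>s\<close> to \<open>0\<close>; the summand \<open>1\<close>
      covers a vanishing dual value.\<close>
    define d where "d = - s / (2 * (dual_value + 1))"
    have "0 < d" unfolding d_def using s dual_nonneg by (intro divide_pos_pos) auto
    moreover have "d * dual_value \<le> d * (dual_value + 1)" using \<open>0 < d\<close> by simp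
    moreover have "d * (dual_value + 1) = - s / 2" using dual_nonneg by (simp add: d_def field_simps)
    ultimately show False using *[of d] s by linarith
  qed
qed

lemma demand_const: "demand (const_bcontfun a) a"
  unfolding demand_def
  by (intro exI[of _ "\<lambda>_. a"] exI[of _ "\<lambda>_. 0"] exI[of _ 0])
    (simp add: \<mu>.prob_space)

lemma demand_le:
  assumes "demand h s" "\<And>x y. x \<in> X \<Longrightarrow> y \<in> X \<Longrightarrow> apply_bcontfun h' (x, y) \<le> apply_bcontfun h (x, y)"
  shows "demand h' s"
proof -
  obtain \<phi> \<psi> k t where 1: "continuous_on UNIV \<phi>" "continuous_on UNIV \<psi>" "continuous_on UNIV k" "0 \<le> t"
     "\<forall>x\<in>X. \<forall>y\<in>X. k (x, y) \<le> t * c x y"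
     "\<forall>x\<in>X. \<forall>y\<in>X. apply_bcontfun h (x, y) \<le> \<phi> x + \<psi> y + k (x, y)"
     "s = (\<integral>x. \<phi> x \<partial>\<mu>) + (\<integral>x. \<psi> x \<partial>\<nu>) + t * dual_value"
    using assms(1) unfolding demand_def by blast
  have "\<forall>x\<in>X. \<forall>y\<in>X. apply_bcontfun h' (x, y) \<le> \<phi> x + \<psi> y + k (x, y)"
    using assms(2) 1(6) by (blast intro: order_trans)
  with 1 show ?thesis
    unfolding demand_def by (intro exI[of _ \<phi>] exI[of _ \<psi>] exI[of _ k] exI[of _ t]) simp
qed

lemma compact_UNIV2: "compact (UNIV :: ('u \<times> 'u) set)"
  using compact_Times[OF compact_UNIV compact_UNIV] by simp

text \<open>Each property comes from a special demand. All components zero gives positivity,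
  \<open>\<phi>\<close> or \<open>\<psi>\<close> alone gives one inequality for a marginal and its
  negative gives the other, and \<open>k\<close> with \<open>t = 1\<close> gives the cost bound. The
  Hahn-Banach argument runs on the vector space of bounded continuous functions and is carried over
  to plain functions by \<open>Bcontfun\<close>.\<close>

lemma exists_functional:
  obtains \<Lambda> :: "(('u \<times> 'u) \<Rightarrow> real) \<Rightarrow> real" where "positive_functional \<Lambda>"
    "\<And>\<phi>. continuous_on UNIV \<phi> \<Longrightarrow> \<Lambda> (\<lambda>p. \<phi> (fst p)) = (\<integral>x. \<phi> x \<partial>\<mu>)"
    "\<And>\<phi>. continuous_on UNIV \<phi> \<Longrightarrow> \<Lambda> (\<lambda>p. \<phi> (snd p)) = (\<integral>x. \<phi> x \<partial>\<nu>)"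
    "\<And>k. continuous_on UNIV k \<Longrightarrow> (\<And>x y. x \<in> X \<Longrightarrow> y \<in> X \<Longrightarrow> k (x, y) \<le> c x y) \<Longrightarrow> \<Lambda> k \<le> dual_value"
proof -
  note app = bcontfun_compact[OF compact_UNIV2]
  have total: "\<exists>s. demand h s" for h
  proof -
    have "apply_bcontfun h p \<le> norm h" for p
      using norm_bounded[of h p] by simp
    then show ?thesis using demand_le[OF demand_const[of "norm h"], of h] by auto
  qed
  have "demand 0 0" using demand_const[of 0] by simp
  then obtain \<Lambda>' where lin: "linear \<Lambda>'" and dom: "\<And>h s. demand h s \<Longrightarrow> \<Lambda>' h \<le> s"
    using linear_below_cone[of demand] demand_add demand_scale demand_zero_nonneg total by metis
  define \<Lambda> where "\<Lambda> h = \<Lambda>' (Bcontfun h)" for h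
  have neg: "\<Lambda> (\<lambda>p. - h p) = - \<Lambda> h" if "continuous_on UNIV h" for h
  proof -
    have "Bcontfun (\<lambda>p. - h p) = - Bcontfun h"
      using that by (intro bcontfun_eqI) (simp add: app continuous_on_minus)
    then show ?thesis unfolding \<Lambda>_def using linear_neg[OF lin] by simp
  qed
  have add: "\<Lambda> (\<lambda>x. f x + g x) = \<Lambda> f + \<Lambda> g" if "continuous_on UNIV f" "continuous_on UNIV g" for f g
  proof -
    have "Bcontfun (\<lambda>x. f x + g x) = Bcontfun f + Bcontfun g"
      using that by (intro bcontfun_eqI) (simp add: app continuous_on_add)
    then show ?thesis unfolding \<Lambda>_def using linear_add[OF lin] by simp
  qed
  have scale: "\<Lambda> (\<lambda>x. a * f x) = a * \<Lambda> f" if "continuous_on UNIV f" for f and a :: real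
  proof -
    have "Bcontfun (\<lambda>x. a * f x) = a *\<^sub>R Bcontfun f"
      using that by (intro bcontfun_eqI) (simp add: app continuous_on_mult_left)
    then show ?thesis unfolding \<Lambda>_def using linear_scale[OF lin] by simp
  qed
  have bound: "\<Lambda> h \<le> (\<integral>x. \<phi> x \<partial>\<mu>) + (\<integral>x. \<psi> x \<partial>\<nu>) + t * dual_value"
    if "continuous_on UNIV h" "continuous_on UNIV \<phi>" "continuous_on UNIV \<psi>" "continuous_on UNIV k" "0 \<le> t"
      "\<And>x y. x \<in> X \<Longrightarrow> y \<in> X \<Longrightarrow> k (x, y) \<le> t * c x y"
      "\<And>x y. x \<in> X \<Longrightarrow> y \<in> X \<Longrightarrow> h (x, y) \<le> \<phi> x + \<psi> y + k (x, y)" for h \<phi> \<psi> k t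
  proof -
    have "demand (Bcontfun h) ((\<integral>x. \<phi> x \<partial>\<mu>) + (\<integral>x. \<psi> x \<partial>\<nu>) + t * dual_value)"
      unfolding demand_def using that
      by (intro exI[of _ \<phi>] exI[of _ \<psi>] exI[of _ k] exI[of _ t]) (simp add: app)
    from dom[OF this] show ?thesis by (simp add: \<Lambda>_def)
  qed
  have nonpos: "\<Lambda> h \<le> 0" if "continuous_on UNIV h" "\<And>p. h p \<le> 0" for h
    using bound[OF that(1), of "\<lambda>_. 0" "\<lambda>_. 0" "\<lambda>_. 0" 0] that(2) by simp
  have fst_le: "\<Lambda> (\<lambda>p. \<phi> (fst p)) \<le> (\<integral>x. \<phi> x \<partial>\<mu>)" if "continuous_on UNIV \<phi>" for \<phi>
    using bound[of "\<lambda>p. \<phi> (fst p)" \<phi> "\<lambda>_. 0" "\<lambda>_. 0" 0] that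
    by (simp add: continuous_on_compose2[OF that continuous_on_fst[OF continuous_on_id]])
  have snd_le: "\<Lambda> (\<lambda>p. \<phi> (snd p)) \<le> (\<integral>x. \<phi> x \<partial>\<nu>)" if "continuous_on UNIV \<phi>" for \<phi>
    using bound[of "\<lambda>p. \<phi> (snd p)" "\<lambda>_. 0" \<phi> "\<lambda>_. 0" 0] that
    by (simp add: continuous_on_compose2[OF that continuous_on_snd[OF continuous_on_id]])
  have fst_eq: "\<Lambda> (\<lambda>p. \<phi> (fst p)) = (\<integral>x. \<phi> x \<partial>\<mu>)" if c: "continuous_on UNIV \<phi>" for \<phi>
    using fst_le[OF c] fst_le[OF continuous_on_minus[OF c]]
      neg[OF continuous_on_compose2[OF c continuous_on_fst[OF continuous_on_id]]] by simp
  have snd_eq: "\<Lambda> (\<lambda>p. \<phi> (snd p)) = (\<integral>x. \<phi> x \<partial>\<nu>)" if c: "continuous_on UNIV \<phi>" for \<phi>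
    using snd_le[OF c] snd_le[OF continuous_on_minus[OF c]]
      neg[OF continuous_on_compose2[OF c continuous_on_snd[OF continuous_on_id]]] by simp
  have "positive_functional \<Lambda>"
  proof
    show "\<Lambda> f \<le> \<Lambda> g" if "continuous_on UNIV f" "continuous_on UNIV g" "\<And>x. f x \<le> g x" for f g
    proof -
      have "\<Lambda> (\<lambda>x. f x + - g x) \<le> 0" using that by (intro nonpos continuous_on_add continuous_on_minus) auto
      then show ?thesis using add[OF that(1) continuous_on_minus[OF that(2)]] neg[OF that(2)] by simp
    qed
    show "\<Lambda> (\<lambda>_. 1) = 1" using fst_eq[of "\<lambda>_. 1"] \<mu>.prob_space by simp
  qed (use compact_UNIV2 add scale in auto)
  moreover have "\<Lambda> k \<le> dual_value" if "continuous_on UNIV k" "\<And>x y. x \<in> X \<Longrightarrow> y \<in> X \<Longrightarrow> k (x, y) \<le> c x y" for k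
    using bound[OF that(1), of "\<lambda>_. 0" "\<lambda>_. 0" k 1] that by simp
  ultimately show thesis using that fst_eq snd_eq by blast
qed

definition cost :: "('u \<times> 'u) measure \<Rightarrow> ennreal" where
  "cost \<pi> = (\<integral>\<^sup>+ p. ennreal (c (fst p) (snd p)) \<partial>\<pi>)"

lemma cost_measurable: "(\<lambda>p. c (fst p) (snd p)) \<in> borel_measurable (restrict_space borel (X \<times> X))"
  by (rule lsc_on_measurable[OF lsc_cost])

text \<open>The Riesz measure \<open>P\<close> lives on the compact square, but both its marginals
  put full mass on \<open>X\<close>, so it is concentrated on the open set
  \<open>X \<times> X\<close> and \<open>\<pi>\<close> is its restriction. Since
  \<open>\<Lambda>\<close> controls only continuous minorants of the cost, the cost integral is
  bounded through layers: each superlevel set is replaced by a bump, and these bumps add up to such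
  a minorant.\<close>

theorem exists_coupling_le_dual:
  obtains \<pi> where "\<pi> \<in> couplings X \<mu> \<nu>" "cost \<pi> \<le> ennreal dual_value"
proof -
  obtain \<Lambda> :: "(('u \<times> 'u) \<Rightarrow> real) \<Rightarrow> real" where pf: "positive_functional \<Lambda>" and
    fst: "\<And>\<phi>. continuous_on UNIV \<phi> \<Longrightarrow> \<Lambda> (\<lambda>p. \<phi> (fst p)) = (\<integral>x. \<phi> x \<partial>\<mu>)" and
    snd: "\<And>\<phi>. continuous_on UNIV \<phi> \<Longrightarrow> \<Lambda> (\<lambda>p. \<phi> (snd p)) = (\<integral>x. \<phi> x \<partial>\<nu>)" and
    le: "\<And>k. continuous_on UNIV k \<Longrightarrow> (\<And>x y. x \<in> X \<Longrightarrow> y \<in> X \<Longrightarrow> k (x, y) \<le> c x y) \<Longrightarrow> \<Lambda> k \<le> dual_value"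
    using exists_functional by metis
  interpret \<Lambda>: positive_functional \<Lambda> by (rule pf)
  obtain P where P: "sets P = sets borel" "prob_space P"
    "\<And>G h. open G \<Longrightarrow> bump G h \<Longrightarrow> \<Lambda> h \<le> measure P G"
    "\<And>G e. open G \<Longrightarrow> 0 < e \<Longrightarrow> \<exists>h. bump G h \<and> measure P G < \<Lambda> h + e"
    "\<And>A e. A \<in> sets borel \<Longrightarrow> 0 < e \<Longrightarrow> \<exists>G. open G \<and> A \<subseteq> G \<and> measure P G < measure P A + e"
    by (rule \<Lambda>.Riesz_measure) (rule that)
  interpret P: prob_space P by fact
  have spaceP: "space P = UNIV" using sets_eq_imp_space_eq[OF P(1)] by simp
  have inner: "\<exists>K. compact K \<and> K \<subseteq> A \<and> measure P (A - K) < e" if "A \<in> sets borel" "0 < e" for A e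
    by (rule outer_regular_inner_compact[OF compact_UNIV2 P(1,2) _ that]) (rule P(5))
  have prc: "continuous_on UNIV (fst :: 'u \<times> 'u \<Rightarrow> 'u)" "continuous_on UNIV (snd :: 'u \<times> 'u \<Rightarrow> 'u)"
    by (simp_all add: continuous_on_fst continuous_on_snd continuous_on_id)
  have fst_eq: "measure P (fst -` A) = measure \<mu> A" if A: "A \<in> sets \<mu>" for A
  proof (rule marginal_eq[OF P(1,2) inner _ prc(1) open_X radon(1) \<mu>.prob_space_axioms A])
    show "measure \<mu> (G \<inter> X) \<le> measure P (fst -` G)" if "open G" for G
      by (rule marginal_open_ge[OF pf compact_UNIV P(3) prc(1) borel_X radon(1) fst that])
  qed
  have snd_eq: "measure P (snd -` A) = measure \<nu> A" if A: "A \<in> sets \<nu>" for A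
  proof (rule marginal_eq[OF P(1,2) inner _ prc(2) open_X radon(2) \<nu>.prob_space_axioms A])
    show "measure \<nu> (G \<inter> X) \<le> measure P (snd -` G)" if "open G" for G
      by (rule marginal_open_ge[OF pf compact_UNIV P(3) prc(2) borel_X radon(2) snd that])
  qed
  have XX: "X \<times> X \<in> sets P" using borel_XX P(1) by simp
  have vim: "pr -` A \<in> sets P" if "continuous_on UNIV pr" "A \<in> sets borel" for A and pr :: "'u \<times> 'u \<Rightarrow> 'u"
    using measurable_sets[OF borel_measurable_continuous_onI[OF that(1)] that(2)] P(1) by simp
  have Xm: "X \<in> sets \<mu>" "X \<in> sets \<nu>" using sets_radon_measure_on[OF _ borel_X] radon borel_X by auto
  have "measure P (fst -` X) = 1" "measure P (snd -` X) = 1"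
    using fst_eq[OF Xm(1)] snd_eq[OF Xm(2)] \<mu>.prob_space \<nu>.prob_space radon by (simp_all add: space_radon_measure_on)
  then have "AE p in P. p \<in> fst -` X" "AE p in P. p \<in> snd -` X"
    by (simp_all only: P.AE_in_set_eq_1[OF vim[OF prc(1) borel_X]] P.AE_in_set_eq_1[OF vim[OF prc(2) borel_X]])
  then have "AE p in P. p \<in> X \<times> X" by eventually_elim (auto simp: mem_Times_iff)
  then have PXX: "measure P (X \<times> X) = 1" using P.AE_in_set_eq_1[OF XX] by simp
  define \<pi> where "\<pi> = restrict_space P (X \<times> X)"
  have sets: "sets \<pi> = sets (restrict_space borel (X \<times> X))"
    unfolding \<pi>_def using P(1) by (rule sets_restrict_space_cong)
  have sets_iff: "A \<in> sets \<pi> \<longleftrightarrow> A \<in> sets borel \<and> A \<subseteq> X \<times> X" for A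
    unfolding sets using borel_XX by (auto simp: sets_restrict_space_iff)
  have space: "space \<pi> = X \<times> X" unfolding \<pi>_def by (simp add: space_restrict_space spaceP)
  have measure: "measure \<pi> A = measure P A" if "A \<subseteq> X \<times> X" for A
    unfolding \<pi>_def using XX that spaceP by (intro measure_restrict_space) (auto simp: Int_absorb2)
  have "prob_space \<pi>"
    unfolding \<pi>_def using PXX spaceP XX by (intro prob_space_restrict_space) (auto simp: P.emeasure_eq_measure)
  then interpret \<pi>: prob_space \<pi> .
  have radon_\<pi>: "radon_measure_on (X \<times> X) \<pi>"
    unfolding radon_measure_on_def
  proof (intro conjI ballI allI impI)
    show "finite_measure \<pi>" by unfold_locales
    show "sets \<pi> = sets (restrict_space borel (X \<times> X))" by (rule sets)
    fix e :: real assume e: "0 < e"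
    obtain K where "compact K" "K \<subseteq> X \<times> X" "measure P (X \<times> X - K) < e"
      using inner[OF borel_XX e] by blast
    then show "\<exists>K. compact K \<and> K \<subseteq> X \<times> X \<and> measure \<pi> (X \<times> X - K) < e"
      by (intro exI[of _ K]) (simp add: measure)
    fix A assume "A \<in> sets \<pi>"
    then have A: "A \<in> sets borel" "A \<subseteq> X \<times> X" using sets_iff by auto
    obtain K where K: "compact K" "K \<subseteq> A" "measure P (A - K) < e/2"
      using inner[OF A(1), of "e/2"] e by auto
    obtain G where G: "open G" "A \<subseteq> G" "measure P G < measure P A + e/2"
      using P(5)[OF A(1), of "e/2"] e by auto
    have clK: "closed K" using K compact_imp_closed by blast
    have "measure P (X \<times> X \<inter> G - K) \<le> measure P ((G - A) \<union> (A - K))"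
      using G clK A P(1) by (intro P.finite_measure_mono) auto
    also have "\<dots> \<le> measure P (G - A) + measure P (A - K)"
      using G clK A P(1) by (intro measure_Un_le) auto
    also have "measure P (G - A) = measure P G - measure P A"
      using G A P(1) by (intro P.finite_measure_Diff) auto
    finally have "measure P (X \<times> X \<inter> G - K) < e" using K G by linarith
    then have "measure \<pi> (X \<times> X \<inter> G - K) < e" by (subst measure) auto
    moreover have "closedin (top_of_set (X \<times> X)) K"
      using clK K A by (intro closed_subset) auto
    moreover have "openin (top_of_set (X \<times> X)) (X \<times> X \<inter> G)"
      using G by (simp add: openin_open_Int)
    ultimately show "\<exists>F G. closedin (top_of_set (X \<times> X)) F \<and> openin (top_of_set (X \<times> X)) G \<and>
        F \<subseteq> A \<and> A \<subseteq> G \<and> measure \<pi> (G - F) < e"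
      using K G A by (intro exI[of _ K] exI[of _ "X \<times> X \<inter> G"]) auto
  qed
  have AE_XX: "measure P (B \<inter> (X \<times> X)) = measure P B" if "B \<in> sets P" for B
    using that XX \<open>AE p in P. p \<in> X \<times> X\<close> by (intro P.finite_measure_eq_AE) auto
  have marg: "distr \<pi> (restrict_space borel X) pr = M"
    if M: "radon_measure_on X M" "prob_space M" and pr: "continuous_on UNIV pr"
      "\<And>p. p \<in> X \<times> X \<Longrightarrow> pr p \<in> X" and eq: "\<And>A. A \<in> sets M \<Longrightarrow> measure P (pr -` A) = measure M A"
    for M and pr :: "'u \<times> 'u \<Rightarrow> 'u"
  proof (rule measure_eqI)
    interpret M: prob_space M by fact
    show "sets (distr \<pi> (restrict_space borel X) pr) = sets M"
      using M by (simp add: radon_measure_on_def)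
    fix A assume "A \<in> sets (distr \<pi> (restrict_space borel X) pr)"
    then have A: "A \<in> sets (restrict_space borel X)" "A \<in> sets M"
      using M by (auto simp: radon_measure_on_def)
    then have bA: "A \<in> sets borel" using sets_radon_measure_on[OF M(1) borel_X] by blast
    have "pr \<in> measurable P borel"
      by (subst measurable_cong_sets[OF P(1) refl]) (rule borel_measurable_continuous_onI[OF pr(1)])
    then have "pr \<in> measurable \<pi> borel" unfolding \<pi>_def by (rule measurable_restrict_space1)
    then have prm: "pr \<in> measurable \<pi> (restrict_space borel X)"
      using pr(2) by (intro measurable_restrict_space2) (auto simp: space)
    have "emeasure (distr \<pi> (restrict_space borel X) pr) A = emeasure \<pi> (pr -` A \<inter> X \<times> X)"
      using A prm by (simp add: emeasure_distr space)
    also have "\<dots> = ennreal (measure P (pr -` A \<inter> X \<times> X))"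
      by (simp add: \<pi>.emeasure_eq_measure measure)
    also have "\<dots> = ennreal (measure P (pr -` A))" using AE_XX[OF vim[OF pr(1) bA]] by simp
    also have "\<dots> = emeasure M A" using eq[OF A(2)] by (simp add: M.emeasure_eq_measure)
    finally show "emeasure (distr \<pi> (restrict_space borel X) pr) A = emeasure M A" .
  qed
  have "\<pi> \<in> couplings X \<mu> \<nu>"
    unfolding couplings_def using radon_\<pi> \<pi>.prob_space_axioms
      marg[OF radon(1) \<mu>.prob_space_axioms prc(1) _ fst_eq] marg[OF radon(2) \<nu>.prob_space_axioms prc(2) _ snd_eq]
    by auto
  moreover have "cost \<pi> \<le> ennreal dual_value"
    unfolding cost_def
  proof (rule nn_integral_le_layers)
    show "finite_measure \<pi>" by unfold_locales
    show "(\<lambda>p. c (fst p) (snd p)) \<in> borel_measurable \<pi>"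
      using cost_measurable measurable_radon_iff[OF radon_\<pi>] by blast
    show "0 \<le> c (fst p) (snd p)" if "p \<in> space \<pi>" for p using that cost_nonneg space by auto
    fix n N :: nat assume n: "0 < n"
    \<comment> \<open>Open in \<open>X \<times> X\<close> by lower semicontinuity, hence open in the
      compact square, where bumps live.\<close>
    define O' where "O' i = {p\<in>X \<times> X. real i / real n < c (fst p) (snd p)}" for i
    have O': "open (O' i)" for i
      using openin_lsc_on[OF lsc_cost, of "real i / real n"] open_Times[OF open_X open_X]
      unfolding O'_def by (auto simp: openin_open_eq)
    have "(\<Sum>i\<in>{1..N}. measure P (O' i)) / real n \<le> dual_value"
    proof (rule field_le_epsilon)
      fix e :: real assume e: "0 < e"
      \<comment> \<open>Each of the \<open>N\<close> layers may lose \<open>d\<close>; after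
        division by \<open>n\<close> the total \<open>N * d / n\<close> is at most
        \<open>e\<close>.\<close>
      define d where "d = e * real n / (real N + 1)"
      have d: "0 < d" using e n by (simp add: d_def)
      obtain h where h: "\<And>i. bump (O' i) (h i)" "\<And>i. measure P (O' i) < \<Lambda> (h i) + d"
        using P(4)[OF O' d] by metis
      have hc: "continuous_on UNIV (h i)" for i using h(1) by (simp add: bump_def)
      \<comment> \<open>A continuous minorant of the cost: at \<open>(x, y)\<close> at most
        \<open>n * c x y\<close> of the levels \<open>i\<close> satisfy
        \<open>i / n < c x y\<close>, and each contributes at most \<open>1 / n\<close>.\<close>
      define k where "k p = (1 / real n) * (\<Sum>i\<in>{1..N}. h i p)" for p
      have "k (x, y) \<le> c x y" if xy: "x \<in> X" "y \<in> X" for x y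
      proof -
        have "h i (x, y) \<le> of_bool (real i < real n * c x y)" for i
        proof -
          have "h i (x, y) \<le> indicator (O' i) (x, y)" using h(1)[of i] by (simp add: bump_def)
          also have "\<dots> = of_bool (real i < real n * c x y)"
            using n xy by (simp add: O'_def indicator_def field_simps)
          finally show ?thesis .
        qed
        then have "(\<Sum>i\<in>{1..N}. h i (x, y)) \<le> (\<Sum>i\<in>{1..N}. of_bool (real i < real n * c x y))"
          by (intro sum_mono)
        also have "\<dots> \<le> real n * c x y"
        proof -
          have "(\<Sum>i\<in>{1..N}. of_bool (real i < real n * c x y) :: real) = real (card {i\<in>{1..N}. real i < real n * c x y})"
            by (simp add: sum.If_cases of_bool_def Int_def)
          also have "card {i\<in>{1..N}. real i < real n * c x y} \<le> card {1..nat \<lfloor>real n * c x y\<rfloor>}"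
            by (intro card_mono) (auto simp: le_nat_floor)
          finally show ?thesis using cost_nonneg[OF xy] by (simp add: le_floor_iff) linarith
        qed
        finally show ?thesis using n by (simp add: k_def field_simps)
      qed
      moreover have "continuous_on UNIV k" unfolding k_def by (intro continuous_intros hc)
      ultimately have "\<Lambda> k \<le> dual_value" by (intro le) auto
      moreover have "\<Lambda> k = (\<Sum>i\<in>{1..N}. \<Lambda> (h i)) / real n"
        unfolding k_def by (subst \<Lambda>.scale) (simp_all add: \<Lambda>.sum hc continuous_on_sum)
      moreover have "(\<Sum>i\<in>{1..N}. measure P (O' i)) \<le> (\<Sum>i\<in>{1..N}. \<Lambda> (h i) + d)"
        using h(2) by (intro sum_mono less_imp_le)
      moreover have "real N * d / real n \<le> e"
      proof -
        have "real N * d / real n = e * (real N / (real N + 1))" using n by (simp add: d_def)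
        also have "\<dots> \<le> e * 1" using e by (intro mult_left_mono) auto
        finally show ?thesis by simp
      qed
      ultimately show "(\<Sum>i\<in>{1..N}. measure P (O' i)) / real n \<le> dual_value + e"
        using n by (simp add: sum.distrib field_simps)
    qed
    then show "(\<Sum>i\<in>{1..N}. measure \<pi> {p \<in> space \<pi>. real i / real n < c (fst p) (snd p)}) / real n \<le> dual_value"
      unfolding space O'_def by (subst sum.cong[OF refl measure]) auto
  qed
  ultimately show thesis by (rule that)
qed

end

section \<open>Cyclic monotonicity\<close>

text \<open>Upper semicontinuity of \<open>u\<close> on the compact set \<open>K\<close>, stated
  through compact superlevel sets. In this form it is visibly stable under finite unions, which is
  what increasing sequences of such sets require.\<close>

definition usc_compact :: "('b::t2_space \<Rightarrow> real) \<Rightarrow> 'b set \<Rightarrow> bool" where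
  "usc_compact u K \<longleftrightarrow> compact K \<and> (\<forall>a. compact {p\<in>K. a \<le> u p})"

lemma usc_compact_Un:
  assumes "usc_compact u K" "usc_compact u K'"
  shows "usc_compact u (K \<union> K')"
proof -
  have "{p\<in>K \<union> K'. a \<le> u p} = {p\<in>K. a \<le> u p} \<union> {p\<in>K'. a \<le> u p}" for a by auto
  then show ?thesis using assms by (simp add: usc_compact_def compact_Un)
qed

lemma usc_compact_singleton: "usc_compact u {p}"
proof -
  have "finite {q\<in>{p}. a \<le> u q}" for a by simp
  then show ?thesis unfolding usc_compact_def by (simp add: finite_imp_compact)
qed

lemma usc_compact_UN:
  "finite I \<Longrightarrow> I \<noteq> {} \<Longrightarrow> (\<And>i. i \<in> I \<Longrightarrow> usc_compact u (K i)) \<Longrightarrow> usc_compact u (\<Union>i\<in>I. K i)"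
  by (induction I rule: finite_ne_induct) (auto intro: usc_compact_Un)

lemma usc_compact_imp_lsc:
  assumes "usc_compact u K"
  shows "lsc_on K (\<lambda>p. - u p)"
  unfolding lsc_on_def
proof (intro ballI allI impI)
  fix p a assume p: "p \<in> K" "a < - u p"
  have "closed {p\<in>K. - a \<le> u p}"
    using assms by (simp add: usc_compact_def compact_imp_closed)
  then show "\<exists>V. open V \<and> p \<in> V \<and> (\<forall>q\<in>K \<inter> V. a < - u q)"
    using p by (intro exI[of _ "- {p\<in>K. - a \<le> u p}"]) auto
qed

text \<open>For every rational level both \<open>{q \<le> u}\<close> and \<open>{u < q}\<close> are
  approximated from inside by compact sets \<open>K n\<close> and \<open>L n\<close>. On the
  intersection of the unions \<open>K n \<union> L n\<close> every superlevel set is cut out by some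
  of the \<open>K n\<close>, hence compact. Countability is taken from the real line, so no
  countable base of the domain enters.\<close>

lemma Lusin_usc:
  fixes u :: "'b::t2_space \<Rightarrow> real"
  assumes M: "radon_measure_on Y M" and Y: "Y \<in> sets borel" and u[measurable]: "u \<in> borel_measurable M"
    and A: "A \<in> sets M" and e: "0 < e"
  obtains K where "usc_compact u K" "K \<subseteq> A" "measure M (A - K) < e"
proof -
  interpret finite_measure M using M by (simp add: radon_measure_on_def)
  note sets = sets_radon_measure_on[OF M Y]
  define q :: "nat \<Rightarrow> real" where "q = from_nat_into \<rat>"
  have q: "range q = \<rat>" unfolding q_def by (rule range_from_nat_into) (auto simp: countable_rat)
  have AM: "p \<in> space M" if "p \<in> A" for p using sets.sets_into_space[OF A] that by auto
  define A1 where "A1 n = {p\<in>A. q n \<le> u p}" for n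
  define A2 where "A2 n = {p\<in>A. u p < q n}" for n
  have "A1 n = A \<inter> {p\<in>space M. q n \<le> u p}" "A2 n = A \<inter> {p\<in>space M. u p < q n}" for n
    using AM by (auto simp: A1_def A2_def)
  then have A12: "A1 n \<in> sets M" "A2 n \<in> sets M" for n using A by auto
  \<comment> \<open>Two approximations per level and the geometric series add up to
    \<open>e/2\<close>.\<close>
  define d where "d n = e / 8 * (1/2) ^ n" for n :: nat
  have d: "0 < d n" for n using e by (simp add: d_def)
  have "\<exists>K. compact K \<and> K \<subseteq> A1 n \<and> measure M (A1 n - K) < d n" for n
    by (rule radon_measure_on_inner_compact[OF M Y A12(1) d]) blast
  then obtain K where K: "\<And>n. compact (K n)" "\<And>n. K n \<subseteq> A1 n" "\<And>n. measure M (A1 n - K n) < d n"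
    by metis
  have "\<exists>K. compact K \<and> K \<subseteq> A2 n \<and> measure M (A2 n - K) < d n" for n
    by (rule radon_measure_on_inner_compact[OF M Y A12(2) d]) blast
  then obtain L where L: "\<And>n. compact (L n)" "\<And>n. L n \<subseteq> A2 n" "\<And>n. measure M (A2 n - L n) < d n"
    by metis
  have cl: "closed (K n)" "closed (L n)" for n
    using compact_imp_closed[OF K(1)] compact_imp_closed[OF L(1)] by blast+
  have KL: "K n \<in> sets M" "L n \<in> sets M" for n
    using cl[of n] K(2)[of n] L(2)[of n] A12[of n] sets by auto
  define \<Gamma> where "\<Gamma> = (\<Inter>n. K n \<union> L n)"
  have cl\<Gamma>: "closed \<Gamma>" unfolding \<Gamma>_def using cl by (intro closed_INT) auto
  have "\<Gamma> = (K 0 \<union> L 0) \<inter> \<Gamma>" by (auto simp: \<Gamma>_def)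
  moreover have "compact ((K 0 \<union> L 0) \<inter> \<Gamma>)"
    using cl\<Gamma> K L by (intro compact_Int_closed compact_Un) auto
  ultimately have cpt: "compact \<Gamma>" by simp
  have sub: "\<Gamma> \<subseteq> A" using K(2)[of 0] L(2)[of 0] by (auto simp: \<Gamma>_def A1_def A2_def)
  have "compact {p\<in>\<Gamma>. a \<le> u p}" for a
  proof -
    have "{p\<in>\<Gamma>. a \<le> u p} = \<Gamma> \<inter> (\<Inter>n\<in>{n. q n < a}. K n)"
    proof (intro equalityI subsetI)
      fix p assume p: "p \<in> {p\<in>\<Gamma>. a \<le> u p}"
      have "p \<in> K n" if "q n < a" for n
      proof -
        have "p \<notin> L n" using L(2)[of n] p that by (force simp: A2_def)
        then show ?thesis using p by (auto simp: \<Gamma>_def)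
      qed
      then show "p \<in> \<Gamma> \<inter> (\<Inter>n\<in>{n. q n < a}. K n)" using p by auto
    next
      fix p assume p: "p \<in> \<Gamma> \<inter> (\<Inter>n\<in>{n. q n < a}. K n)"
      have "a \<le> u p"
      proof (rule ccontr)
        assume "\<not> a \<le> u p"
        then obtain r where r: "r \<in> \<rat>" "u p < r" "r < a" using Rats_dense_in_real[of "u p" a] by auto
        then obtain n where "r = q n" using q by (metis imageE)
        then have "p \<in> K n" using p r by auto
        then have "q n \<le> u p" using K(2)[of n] by (auto simp: A1_def)
        then show False using r \<open>r = q n\<close> by simp
      qed
      then show "p \<in> {p\<in>\<Gamma>. a \<le> u p}" using p by auto
    qed
    moreover have "closed (\<Inter>n\<in>{n. q n < a}. K n)" using cl by (intro closed_INT) auto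
    ultimately show ?thesis using cpt by (simp add: compact_Int_closed)
  qed
  then have good: "usc_compact u \<Gamma>" using cpt by (simp add: usc_compact_def)
  define B where "B n = (A1 n - K n) \<union> (A2 n - L n)" for n
  have BM: "B n \<in> sets M" for n unfolding B_def using A12 KL by auto
  have B_le: "measure M (B n) \<le> e / 4 * (1/2) ^ n" for n
  proof -
    have "measure M (B n) \<le> measure M (A1 n - K n) + measure M (A2 n - L n)"
      unfolding B_def using A12 KL by (intro measure_Un_le) auto
    then show ?thesis using K(3)[of n] L(3)[of n] by (simp add: d_def)
  qed
  have sm: "summable (\<lambda>n. e / 4 * (1/2) ^ n :: real)" by (intro summable_mult summable_geometric) auto
  have smB: "summable (\<lambda>n. measure M (B n))"
    by (rule summable_comparison_test'[OF sm, of 0]) (use B_le in auto)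
  have "A - \<Gamma> \<subseteq> (\<Union>n. B n)" by (fastforce simp: \<Gamma>_def B_def A1_def A2_def)
  then have "measure M (A - \<Gamma>) \<le> measure M (\<Union>n. B n)" using BM by (intro finite_measure_mono) auto
  also have "\<dots> \<le> (\<Sum>n. measure M (B n))"
    using BM smB by (intro finite_measure_subadditive_countably) auto
  also have "\<dots> \<le> (\<Sum>n. e / 4 * (1/2) ^ n)" by (intro suminf_le B_le smB sm)
  also have "\<dots> = e / 4 * 2" using suminf_geometric[of "1/2 :: real"] by (subst suminf_mult) auto
  also have "\<dots> < e" using e by simp
  finally show thesis using good sub that by blast
qed

text \<open>Without a minimum, every point has a neighbourhood in \<open>K\<close> on which
  \<open>u\<close> exceeds its value at some other point of \<open>K\<close>. Compactness produces
  one point whose value is strictly below all values on \<open>K\<close>, including its own.\<close>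

lemma lsc_attains_inf:
  assumes K: "compact K" "K \<noteq> {}" and u: "lsc_on K u"
  shows "\<exists>p\<in>K. \<forall>q\<in>K. u p \<le> u q"
proof (rule ccontr)
  assume contra: "\<not> ?thesis"
  let ?Q = "\<lambda>A. \<exists>q\<in>K. \<forall>p\<in>A. u q < u p"
  have "?Q K"
  proof (rule compact_union_induct[OF K(1), where Q="?Q"])
    show "?Q {}" using K(2) by auto
    show "?Q (A \<union> B)" if A: "?Q A" and B: "?Q B" for A B
    proof -
      obtain a b where "a \<in> K" "\<forall>p\<in>A. u a < u p" "b \<in> K" "\<forall>p\<in>B. u b < u p" using A B by blast
      then show ?thesis
        by (intro bexI[of _ "if u a \<le> u b then a else b"]) (auto intro: le_less_trans)
    qed
    fix p assume p: "p \<in> K"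
    then obtain q where "q \<in> K" "u q < u p" using contra by (meson not_le)
    then show "\<exists>V. open V \<and> p \<in> V \<and> ?Q (K \<inter> V)"
      using lsc_onD[OF u p, of "u q"] by blast
  qed
  then show False by blast
qed

text \<open>Joint lower semicontinuity yields product neighbourhoods, and compactness of
  \<open>K\<close> leaves one neighbourhood of \<open>x\<close> that works for all parameters.
  Strictness survives the infimum because it is attained.\<close>

lemma lsc_INF_compact:
  assumes K: "compact K" "K \<noteq> {}" and w: "lsc_on (A \<times> K) w"
  shows "\<And>x. x \<in> A \<Longrightarrow> \<exists>p\<in>K. (INF q\<in>K. w (x, q)) = w (x, p)"
    and "\<And>x q. x \<in> A \<Longrightarrow> q \<in> K \<Longrightarrow> (INF q\<in>K. w (x, q)) \<le> w (x, q)"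
    and "lsc_on A (\<lambda>x. INF q\<in>K. w (x, q))"
proof -
  have att: "\<exists>p\<in>K. \<forall>q\<in>K. w (x, p) \<le> w (x, q)" if "x \<in> A" for x
  proof (rule lsc_attains_inf[OF K])
    show "lsc_on K (\<lambda>p. w (x, p))"
      using that by (intro lsc_on_compose[OF w] continuous_on_Pair continuous_on_const continuous_on_id) auto
  qed
  show eq: "\<exists>p\<in>K. (INF q\<in>K. w (x, q)) = w (x, p)" if x: "x \<in> A" for x
  proof -
    obtain p where "p \<in> K" "\<forall>q\<in>K. w (x, p) \<le> w (x, q)" using att[OF x] by blast
    then show ?thesis by (intro bexI[of _ p] cInf_eq_minimum) auto
  qed
  show "(INF q\<in>K. w (x, q)) \<le> w (x, q)" if x: "x \<in> A" and q: "q \<in> K" for x q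
  proof -
    obtain p where "\<forall>q\<in>K. w (x, p) \<le> w (x, q)" using att[OF x] by blast
    then show ?thesis using q by (intro cINF_lower bdd_belowI2[of K "w (x, p)"]) auto
  qed
  show "lsc_on A (\<lambda>x. INF q\<in>K. w (x, q))"
    unfolding lsc_on_def
  proof (intro ballI allI impI)
    fix x a assume x: "x \<in> A" "a < (INF q\<in>K. w (x, q))"
    obtain p0 where p0: "p0 \<in> K" "\<forall>q\<in>K. w (x, p0) \<le> w (x, q)" using att[OF x(1)] by blast
    have "(INF q\<in>K. w (x, q)) \<le> w (x, p0)"
      using p0 by (intro cINF_lower bdd_belowI2) auto
    then have a: "a < w (x, q)" if "q \<in> K" for q using x(2) p0(2) that by fastforce
    let ?Q = "\<lambda>B. \<exists>V. open V \<and> x \<in> V \<and> (\<forall>y\<in>A \<inter> V. \<forall>p\<in>B. a < w (y, p))"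
    have "?Q K"
    proof (rule compact_union_induct[OF K(1), where Q="?Q"])
      show "?Q {}" by (intro exI[of _ UNIV]) auto
      show "?Q (B \<union> B')" if B: "?Q B" and B': "?Q B'" for B B'
      proof -
        obtain V V' where "open V" "x \<in> V" "\<forall>y\<in>A \<inter> V. \<forall>p\<in>B. a < w (y, p)"
          "open V'" "x \<in> V'" "\<forall>y\<in>A \<inter> V'. \<forall>p\<in>B'. a < w (y, p)" using B B' by blast
        then show ?thesis by (intro exI[of _ "V \<inter> V'"]) auto
      qed
      fix p assume p: "p \<in> K"
      obtain O' where O': "open O'" "(x, p) \<in> O'" "\<forall>r\<in>A \<times> K \<inter> O'. a < w r"
        using lsc_onD[OF w, of "(x, p)" a] a[OF p] x(1) p by blast
      obtain V W where VW: "open V" "open W" "(x, p) \<in> V \<times> W" "V \<times> W \<subseteq> O'"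
        using open_prod_elim[OF O'(1,2)] by blast
      have "a < w (y, q)" if "y \<in> A \<inter> V" "q \<in> K \<inter> W" for y q
      proof -
        have "(y, q) \<in> A \<times> K \<inter> O'" using that VW(4) by auto
        then show ?thesis using O'(3) by blast
      qed
      then have "?Q (K \<inter> W)" using VW by (intro exI[of _ V]) auto
      then show "\<exists>W. open W \<and> p \<in> W \<and> ?Q (K \<inter> W)" using VW(2,3) by blast
    qed
    then obtain V where V: "open V" "x \<in> V" "\<forall>y\<in>A \<inter> V. \<forall>p\<in>K. a < w (y, p)" by blast
    have "a < (INF q\<in>K. w (y, q))" if "y \<in> A \<inter> V" for y
      using eq[of y] V(3) that by fastforce
    then show "\<exists>V. open V \<and> x \<in> V \<and> (\<forall>y\<in>A \<inter> V. a < (INF q\<in>K. w (y, q)))"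
      using V by blast
  qed
qed

text \<open>The cyclic permutation pairs each first coordinate with the preceding second coordinate
  and closes the loop from the last to the first; this is the inequality that bounds chain
  sums.\<close>

lemma cyclically_monotonic_shift:
  assumes C: "cyclically_monotonic c C" and mem: "\<And>i. i \<le> k \<Longrightarrow> (\<xi> i, \<eta> i) \<in> C"
  shows "(\<Sum>i\<le>k. c (\<xi> i) (\<eta> i)) \<le> c (\<xi> 0) (\<eta> k) + (\<Sum>i<k. c (\<xi> (Suc i)) (\<eta> i))"
proof -
  \<comment> \<open>The definition of cyclic monotonicity counts from \<open>1\<close>, the chain
    from \<open>0\<close>; hence the subtraction of \<open>1\<close> in every index below.\<close>
  define \<sigma> where "\<sigma> j = (if j = 1 then Suc k else if j \<in> {1..Suc k} then j - 1 else j)" for j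
  have "bij_betw \<sigma> {1..Suc k} {1..Suc k}"
    by (rule bij_betw_byWitness[where f' = "\<lambda>j. if j = Suc k then 1 else Suc j"]) (auto simp: \<sigma>_def)
  then have "\<sigma> permutes {1..Suc k}" by (rule bij_imp_permutes) (auto simp: \<sigma>_def)
  moreover have "\<forall>j\<in>{1..Suc k}. (\<xi> (j - 1), \<eta> (j - 1)) \<in> C" using mem by auto
  ultimately have "(\<Sum>j=1..Suc k. c (\<xi> (j - 1)) (\<eta> (j - 1))) \<le> (\<Sum>j=1..Suc k. c (\<xi> (j - 1)) (\<eta> (\<sigma> j - 1)))"
    using C[unfolded cyclically_monotonic_def, rule_format, of "Suc k" "\<lambda>j. \<xi> (j - 1)" "\<lambda>j. \<eta> (j - 1)" \<sigma>]
    by blast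
  moreover have "(\<Sum>j=1..Suc k. c (\<xi> (j - 1)) (\<eta> (j - 1))) = (\<Sum>i\<le>k. c (\<xi> i) (\<eta> i))"
    using sum.atLeast_Suc_atMost_Suc_shift[of "\<lambda>j. c (\<xi> (j - 1)) (\<eta> (j - 1))" 0 k] by (simp add: atMost_atLeast0)
  moreover have "(\<Sum>j=1..Suc k. c (\<xi> (j - 1)) (\<eta> (\<sigma> j - 1))) = (\<Sum>i=0..k. c (\<xi> i) (\<eta> (\<sigma> (Suc i) - 1)))"
    using sum.atLeast_Suc_atMost_Suc_shift[of "\<lambda>j. c (\<xi> (j - 1)) (\<eta> (\<sigma> j - 1))" 0 k] by simp
  moreover have "\<dots> = c (\<xi> 0) (\<eta> k) + (\<Sum>i<k. c (\<xi> (Suc i)) (\<eta> (\<sigma> (Suc (Suc i)) - 1)))"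
    by (simp add: atMost_atLeast0[symmetric] sum.atMost_shift \<sigma>_def)
  moreover have "(\<Sum>i<k. c (\<xi> (Suc i)) (\<eta> (\<sigma> (Suc (Suc i)) - 1))) = (\<Sum>i<k. c (\<xi> (Suc i)) (\<eta> i))"
    by (intro sum.cong) (auto simp: \<sigma>_def)
  ultimately show ?thesis by simp
qed

text \<open>The potential of Rockafellar and Rueschendorf: an infimum over chains in a cyclically monotonic
  set. It is taken over compact sets of chains on which \<open>c\<close> is upper semicontinuous, so that it is
  lower semicontinuous at each stage and hence Borel in the countable limit.\<close>

locale cyclic_exhaustion = lattice_cost X L c for X :: "'u::t2_space set" and L c +
  fixes C :: "('u \<times> 'u) set" and \<Gamma> :: "nat \<Rightarrow> ('u \<times> 'u) set" and p0 :: "'u \<times> 'u"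
  assumes C: "cyclically_monotonic c C" "C \<subseteq> X \<times> X"
    and \<Gamma>: "\<And>m. usc_compact (\<lambda>p. c (fst p) (snd p)) (\<Gamma> m)" "\<And>m. \<Gamma> m \<subseteq> C" "\<And>m. p0 \<in> \<Gamma> m" "incseq \<Gamma>"
begin

text \<open>The infimum over chains with \<open>k\<close> links in \<open>\<Gamma> m\<close>
  starting at \<open>p0\<close>, as a dynamic programming recursion in the last link. Each level is
  an infimum over a single copy of \<open>\<Gamma> m\<close>, so semicontinuity can be proved by
  induction on \<open>k\<close>.\<close>

primrec stage :: "nat \<Rightarrow> nat \<Rightarrow> 'u \<Rightarrow> real" where
  "stage m 0 x = c x (snd p0)"
| "stage m (Suc k) x = (INF p\<in>\<Gamma> m. c x (snd p) - c (fst p) (snd p) + stage m k (fst p))"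

lemma \<Gamma>_X: "p \<in> \<Gamma> m \<Longrightarrow> fst p \<in> X \<and> snd p \<in> X"
  using \<Gamma>(2)[of m] C(2) by auto

lemma stage_lsc: "lsc_on X (stage m k)"
  and stage_step_lsc: "lsc_on (X \<times> \<Gamma> m)
    (\<lambda>r. c (fst r) (snd (snd r)) - c (fst (snd r)) (snd (snd r)) + stage m k (fst (snd r)))"
proof -
  have step: "lsc_on (X \<times> \<Gamma> m)
    (\<lambda>r. c (fst r) (snd (snd r)) - c (fst (snd r)) (snd (snd r)) + stage m k (fst (snd r)))"
    if k: "lsc_on X (stage m k)" for k
  proof -
    have "continuous_on (X \<times> \<Gamma> m) (\<lambda>r. (fst r, snd (snd r)))"
      by (intro continuous_on_Pair continuous_on_fst continuous_on_snd continuous_on_id)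
    moreover have "(\<lambda>r. (fst r, snd (snd r))) ` (X \<times> \<Gamma> m) \<subseteq> X \<times> X"
      using \<Gamma>_X by fastforce
    ultimately have 1: "lsc_on (X \<times> \<Gamma> m) (\<lambda>r. c (fst r) (snd (snd r)))"
      using lsc_on_compose[OF lsc_cost] by fastforce
    \<comment> \<open>The subtracted cost would destroy lower semicontinuity on a general set; on
      \<open>\<Gamma> m\<close> the cost is upper semicontinuous by the Lusin condition.\<close>
    have 2: "lsc_on (X \<times> \<Gamma> m) (\<lambda>r. - c (fst (snd r)) (snd (snd r)))"
    proof (rule lsc_on_compose[OF usc_compact_imp_lsc[OF \<Gamma>(1)]])
      show "continuous_on (X \<times> \<Gamma> m) snd" by (intro continuous_on_snd continuous_on_id)
    qed auto
    have 3: "lsc_on (X \<times> \<Gamma> m) (\<lambda>r. stage m k (fst (snd r)))"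
    proof (rule lsc_on_compose[OF k])
      show "continuous_on (X \<times> \<Gamma> m) (\<lambda>r. fst (snd r))"
        by (intro continuous_on_fst continuous_on_snd continuous_on_id)
      show "(\<lambda>r. fst (snd r)) ` (X \<times> \<Gamma> m) \<subseteq> X"
        using \<Gamma>_X by fastforce
    qed
    show ?thesis using lsc_on_add[OF lsc_on_add[OF 1 2] 3] by simp
  qed
  have lsc: "lsc_on X (stage m k)" for k
  proof (induction k)
    case 0
    have "snd p0 \<in> X" using \<Gamma>(3) \<Gamma>_X by blast
    then show ?case using lsc_cost_slice by simp
  next
    case (Suc k)
    have "compact (\<Gamma> m)" "\<Gamma> m \<noteq> {}" using \<Gamma>(1,3) by (auto simp: usc_compact_def)
    from lsc_INF_compact(3)[OF this step[OF Suc]] show ?case by simp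
  qed
  show "lsc_on X (stage m k)" by (rule lsc)
  show "lsc_on (X \<times> \<Gamma> m)
    (\<lambda>r. c (fst r) (snd (snd r)) - c (fst (snd r)) (snd (snd r)) + stage m k (fst (snd r)))"
    by (rule step[OF lsc])
qed

lemma stage_attained:
  assumes "x \<in> X"
  shows "\<exists>p\<in>\<Gamma> m. stage m (Suc k) x = c x (snd p) - c (fst p) (snd p) + stage m k (fst p)"
proof -
  have "compact (\<Gamma> m)" "\<Gamma> m \<noteq> {}" using \<Gamma>(1,3) by (auto simp: usc_compact_def)
  from lsc_INF_compact(1)[OF this stage_step_lsc assms] show ?thesis by simp
qed

lemma stage_le:
  assumes "x \<in> X" "p \<in> \<Gamma> m"
  shows "stage m (Suc k) x \<le> c x (snd p) - c (fst p) (snd p) + stage m k (fst p)"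
proof -
  have "compact (\<Gamma> m)" "\<Gamma> m \<noteq> {}" using \<Gamma>(1,3) by (auto simp: usc_compact_def)
  from lsc_INF_compact(2)[OF this stage_step_lsc assms] show ?thesis by simp
qed

lemma stage_lipschitz:
  assumes x: "x \<in> X" "y \<in> X"
  shows "stage m k x \<le> c x y + stage m k y"
proof (cases k)
  case 0
  have "snd p0 \<in> X" using \<Gamma>(3) \<Gamma>_X by blast
  then show ?thesis using cost_triangle x 0 by simp
next
  case (Suc k')
  obtain p where p: "p \<in> \<Gamma> m" "stage m (Suc k') y = c y (snd p) - c (fst p) (snd p) + stage m k' (fst p)"
    using stage_attained[OF x(2)] by blast
  show ?thesis
    using stage_le[OF x(1) p(1), of k'] p cost_triangle[OF x, of "snd p"] \<Gamma>_X[OF p(1)] Suc by simp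
qed

lemma stage_antimono: "m \<le> m' \<Longrightarrow> x \<in> X \<Longrightarrow> stage m' k x \<le> stage m k x"
proof (induction k arbitrary: x)
  case (Suc k)
  obtain p where p: "p \<in> \<Gamma> m" "stage m (Suc k) x = c x (snd p) - c (fst p) (snd p) + stage m k (fst p)"
    using stage_attained[OF Suc.prems(2)] by blast
  have "p \<in> \<Gamma> m'" using p \<Gamma>(4) Suc.prems(1) by (auto simp: incseq_def)
  from stage_le[OF Suc.prems(2) this, of k] Suc.IH[OF Suc.prems(1), of "fst p"] \<Gamma>_X[OF p(1)] p
  show ?case by simp
qed simp

text \<open>All infima are attained, so the recursion unrolls to one chain in \<open>C\<close> whose
  sum is exactly the value; cyclic monotonicity can then be applied to its points.\<close>

lemma stage_chain:
  "x \<in> X \<Longrightarrow> \<exists>\<xi> \<eta>. (\<forall>i\<le>k. (\<xi> i, \<eta> i) \<in> C) \<and> (\<xi> 0, \<eta> 0) = p0 \<and>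
     stage m k x = c x (\<eta> k) + (\<Sum>i<k. c (\<xi> (Suc i)) (\<eta> i) - c (\<xi> (Suc i)) (\<eta> (Suc i)))"
proof (induction k arbitrary: x)
  case 0
  have "p0 \<in> C" using \<Gamma> by blast
  then show ?case by (intro exI[of _ "\<lambda>_. fst p0"] exI[of _ "\<lambda>_. snd p0"]) simp
next
  case (Suc k)
  obtain p where p: "p \<in> \<Gamma> m" "stage m (Suc k) x = c x (snd p) - c (fst p) (snd p) + stage m k (fst p)"
    using stage_attained[OF Suc.prems] by blast
  obtain \<xi> \<eta> where ch: "\<forall>i\<le>k. (\<xi> i, \<eta> i) \<in> C" "(\<xi> 0, \<eta> 0) = p0"
    "stage m k (fst p) = c (fst p) (\<eta> k) + (\<Sum>i<k. c (\<xi> (Suc i)) (\<eta> i) - c (\<xi> (Suc i)) (\<eta> (Suc i)))"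
    using Suc.IH[of "fst p"] \<Gamma>_X[OF p(1)] by blast
  define \<xi>' where "\<xi>' = \<xi>(Suc k := fst p)"
  define \<eta>' where "\<eta>' = \<eta>(Suc k := snd p)"
  have "(\<xi>' i, \<eta>' i) \<in> C" if "i \<le> Suc k" for i
    using that ch(1) p(1) \<Gamma>(2) by (cases "i = Suc k") (auto simp: \<xi>'_def \<eta>'_def)
  moreover have "(\<xi>' 0, \<eta>' 0) = p0" using ch(2) by (simp add: \<xi>'_def \<eta>'_def)
  moreover have "(\<Sum>i<k. c (\<xi>' (Suc i)) (\<eta>' i) - c (\<xi>' (Suc i)) (\<eta>' (Suc i))) =
      (\<Sum>i<k. c (\<xi> (Suc i)) (\<eta> i) - c (\<xi> (Suc i)) (\<eta> (Suc i)))"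
    by (intro sum.cong) (auto simp: \<xi>'_def \<eta>'_def)
  then have "stage m (Suc k) x = c x (\<eta>' (Suc k)) +
      (\<Sum>i<Suc k. c (\<xi>' (Suc i)) (\<eta>' i) - c (\<xi>' (Suc i)) (\<eta>' (Suc i)))"
    unfolding p(2) ch(3) by (simp add: \<xi>'_def \<eta>'_def)
  ultimately show ?case by blast
qed

text \<open>Closing the minimising chain back to \<open>p0\<close>, cyclic monotonicity bounds its
  sum below by \<open>c x (\<eta> k) - c (\<xi> 0) (\<eta> k) + c (\<xi> 0) (\<eta> 0)\<close>, and
  the triangle inequality eliminates the free end \<open>\<eta> k\<close>. The bound does not depend
  on \<open>m\<close> and \<open>k\<close>, so \<open>potential\<close> is a finite infimum.\<close>

lemma stage_lower:
  assumes x: "x \<in> X"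
  shows "- c x (fst p0) \<le> stage m k x"
proof -
  obtain \<xi> \<eta> where ch: "\<forall>i\<le>k. (\<xi> i, \<eta> i) \<in> C" "(\<xi> 0, \<eta> 0) = p0"
    "stage m k x = c x (\<eta> k) + (\<Sum>i<k. c (\<xi> (Suc i)) (\<eta> i) - c (\<xi> (Suc i)) (\<eta> (Suc i)))"
    using stage_chain[OF x] by blast
  have X: "\<xi> i \<in> X" "\<eta> i \<in> X" if "i \<le> k" for i using ch(1) that C(2) by auto
  have "(\<Sum>i\<le>k. c (\<xi> i) (\<eta> i)) \<le> c (\<xi> 0) (\<eta> k) + (\<Sum>i<k. c (\<xi> (Suc i)) (\<eta> i))"
    using ch(1) by (intro cyclically_monotonic_shift[OF C(1)]) auto
  moreover have "(\<Sum>i\<le>k. c (\<xi> i) (\<eta> i)) = c (\<xi> 0) (\<eta> 0) + (\<Sum>i<k. c (\<xi> (Suc i)) (\<eta> (Suc i)))"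
    by (rule sum.atMost_shift)
  ultimately have "c x (\<eta> k) - c (\<xi> 0) (\<eta> k) + c (\<xi> 0) (\<eta> 0) \<le> stage m k x"
    unfolding ch(3) by (simp add: sum_subtractf)
  moreover have "c (\<xi> 0) (\<eta> k) \<le> c (\<xi> 0) x + c x (\<eta> k)"
    using X x by (intro cost_triangle) auto
  moreover have "c (\<xi> 0) x = c x (\<xi> 0)" using X x by (intro cost_sym) auto
  moreover have "0 \<le> c (\<xi> 0) (\<eta> 0)" using X by (intro cost_nonneg) auto
  moreover have "\<xi> 0 = fst p0" using ch(2) by (metis fst_conv)
  ultimately show ?thesis by simp
qed

definition potential :: "'u \<Rightarrow> real" where
  "potential x = (INF i. stage (fst i) (snd i) x)"

lemma potential_lower: "x \<in> X \<Longrightarrow> potential x \<le> stage m k x"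
  unfolding potential_def
  using cINF_lower[OF bdd_belowI2[of UNIV "- c x (fst p0)" "\<lambda>i. stage (fst i) (snd i) x"], of "(m, k)"]
    stage_lower by simp

lemma potential_measurable: "potential \<in> borel_measurable (restrict_space borel X)"
  unfolding potential_def[abs_def]
  by (intro borel_measurable_cINF_real lsc_on_measurable stage_lsc) auto

lemma potential_lipschitz:
  assumes "x \<in> X" "y \<in> X"
  shows "potential x - potential y \<le> c x y"
proof -
  have "potential x - c x y \<le> potential y"
    unfolding potential_def[of y]
  proof (rule cINF_greatest)
    fix i :: "nat \<times> nat"
    show "potential x - c x y \<le> stage (fst i) (snd i) y"
      using potential_lower[OF assms(1), of "fst i" "snd i"] stage_lipschitz[OF assms, of "fst i" "snd i"]
      by linarith
  qed simp
  then show ?thesis by simp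
qed

text \<open>Any chain used at \<open>fst p\<close> may be extended by the link \<open>p\<close> and
  evaluated at \<open>snd p\<close>: the new term \<open>c (snd p) (snd p)\<close> vanishes and
  \<open>c (fst p) (snd p)\<close> is subtracted. Together with \<open>potential_lipschitz\<close>
  this is equality.\<close>

lemma potential_contact:
  assumes p: "p \<in> \<Gamma> m"
  shows "c (fst p) (snd p) \<le> potential (fst p) - potential (snd p)"
proof -
  have X: "fst p \<in> X" "snd p \<in> X" using \<Gamma>_X[OF p] by auto
  have "potential (snd p) + c (fst p) (snd p) \<le> potential (fst p)"
    unfolding potential_def[of "fst p"]
  proof (rule cINF_greatest)
    fix i :: "nat \<times> nat"
    \<comment> \<open>The link \<open>p\<close> is available from level \<open>m\<close> on, the
      given stage has level \<open>fst i\<close>; passing to the larger level does not increase the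
      stage.\<close>
    define m' where "m' = max m (fst i)"
    have "p \<in> \<Gamma> m'" using monoD[OF \<Gamma>(4), of m m'] p by (auto simp: m'_def)
    from stage_le[OF X(2) this, of "snd i"] potential_lower[OF X(2), of m' "Suc (snd i)"]
      stage_antimono[of "fst i" m' "fst p" "snd i"] X cost_self[OF X(2)]
    show "potential (snd p) + c (fst p) (snd p) \<le> stage (fst i) (snd i) (fst p)"
      by (simp add: m'_def)
  qed simp
  then show ?thesis by simp
qed

end

section \<open>Weak duality and the characterisation of optimal couplings\<close>

context transport_problem
begin

lemma couplingD:
  assumes "\<pi> \<in> couplings X \<mu> \<nu>"
  shows "radon_measure_on (X \<times> X) \<pi>" "prob_space \<pi>" "space \<pi> = X \<times> X"
    "fst \<in> measurable \<pi> (restrict_space borel X)" "snd \<in> measurable \<pi> (restrict_space borel X)"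
    "distr \<pi> (restrict_space borel X) fst = \<mu>" "distr \<pi> (restrict_space borel X) snd = \<nu>"
proof -
  show \<pi>: "radon_measure_on (X \<times> X) \<pi>" "prob_space \<pi>"
    "distr \<pi> (restrict_space borel X) fst = \<mu>" "distr \<pi> (restrict_space borel X) snd = \<nu>"
    using assms by (auto simp: couplings_def)
  show sp: "space \<pi> = X \<times> X" by (rule space_radon_measure_on[OF \<pi>(1)])
  have sets: "sets \<pi> = sets (restrict_space borel (X \<times> X))" using \<pi>(1) by (simp add: radon_measure_on_def)
  have "pr \<in> measurable \<pi> (restrict_space borel X)"
    if "continuous_on UNIV pr" "\<And>p. p \<in> X \<times> X \<Longrightarrow> pr p \<in> X" for pr :: "'u \<times> 'u \<Rightarrow> 'u"
  proof (rule measurable_restrict_space2)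
    show "pr \<in> measurable \<pi> borel"
      by (subst measurable_cong_sets[OF sets refl])
        (rule measurable_restrict_space1[OF borel_measurable_continuous_onI[OF that(1)]])
  qed (use that sp in auto)
  from this[of fst] this[of snd]
  show "fst \<in> measurable \<pi> (restrict_space borel X)" "snd \<in> measurable \<pi> (restrict_space borel X)"
    by (auto simp: continuous_on_fst continuous_on_snd continuous_on_id)
qed

lemma coupling_integral:
  fixes f :: "'u \<Rightarrow> real"
  assumes \<pi>: "\<pi> \<in> couplings X \<mu> \<nu>" and f: "f \<in> borel_measurable (restrict_space borel X)"
  shows "integrable \<mu> f \<Longrightarrow> integrable \<pi> (\<lambda>p. f (fst p))" "(\<integral>x. f x \<partial>\<mu>) = (\<integral>p. f (fst p) \<partial>\<pi>)"
    "integrable \<nu> f \<Longrightarrow> integrable \<pi> (\<lambda>p. f (snd p))" "(\<integral>x. f x \<partial>\<nu>) = (\<integral>p. f (snd p) \<partial>\<pi>)"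
  using integrable_distr_eq[OF couplingD(4)[OF \<pi>], of f] integral_distr[OF couplingD(4)[OF \<pi>], of f]
    integrable_distr_eq[OF couplingD(5)[OF \<pi>], of f] integral_distr[OF couplingD(5)[OF \<pi>], of f] f
    couplingD(6,7)[OF \<pi>]
  by simp_all

lemma coupling_cost_integrable:
  assumes \<pi>: "\<pi> \<in> couplings X \<mu> \<nu>"
  shows "integrable \<pi> (\<lambda>p. c (fst p) (snd p))" "cost \<pi> = ennreal (\<integral>p. c (fst p) (snd p) \<partial>\<pi>)"
proof -
  obtain x0 where x0: "x0 \<in> X" using X_nonempty by auto
  note sp = couplingD(3)[OF \<pi>]
  have cm: "(\<lambda>x. c x x0) \<in> borel_measurable (restrict_space borel X)"
    by (rule lsc_on_measurable[OF lsc_cost_slice[OF x0]])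
  have "integrable \<pi> (\<lambda>p. c (fst p) x0 + c (snd p) x0)"
    using coupling_integral(1,3)[OF \<pi> cm] cost_integrable[OF \<mu> x0] cost_integrable[OF \<nu> x0] by simp
  moreover have "c (fst p) (snd p) \<le> c (fst p) x0 + c (snd p) x0" "0 \<le> c (fst p) (snd p)"
    if "p \<in> X \<times> X" for p
  proof -
    have p: "fst p \<in> X" "snd p \<in> X" using that by auto
    show "c (fst p) (snd p) \<le> c (fst p) x0 + c (snd p) x0"
      using cost_triangle[OF p(1) x0 p(2)] cost_sym[OF p(2) x0] by simp
    show "0 \<le> c (fst p) (snd p)" using p by (rule cost_nonneg)
  qed
  note bounds = this
  moreover have "(\<lambda>p. c (fst p) (snd p)) \<in> borel_measurable \<pi>"
    using cost_measurable measurable_radon_iff[OF couplingD(1)[OF \<pi>]] by blast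
  ultimately show int: "integrable \<pi> (\<lambda>p. c (fst p) (snd p))"
    using sp by (elim Bochner_Integration.integrable_bound) (force intro!: AE_I2)+
  show "cost \<pi> = ennreal (\<integral>p. c (fst p) (snd p) \<partial>\<pi>)"
    unfolding cost_def using sp bounds(2) by (intro nn_integral_eq_integral int AE_I2) simp
qed

text \<open>Weak duality in a generality that covers both the lattice \<open>L\<close> and the chain
  potential, which is Borel and \<open>1\<close>-Lipschitz for \<open>c\<close> but not obviously
  continuous.\<close>

lemma lipschitz_duality_gap:
  assumes \<pi>: "\<pi> \<in> couplings X \<mu> \<nu>" and f: "f \<in> borel_measurable (restrict_space borel X)"
    and lip: "\<And>x y. x \<in> X \<Longrightarrow> y \<in> X \<Longrightarrow> f x - f y \<le> c x y"
  shows "integrable \<pi> (\<lambda>p. f (fst p) - f (snd p))"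
    "(\<integral>p. f (fst p) - f (snd p) \<partial>\<pi>) = (\<integral>x. f x \<partial>\<mu>) - (\<integral>x. f x \<partial>\<nu>)"
    "(\<integral>x. f x \<partial>\<mu>) - (\<integral>x. f x \<partial>\<nu>) \<le> (\<integral>p. c (fst p) (snd p) \<partial>\<pi>)"
proof -
  have int: "integrable \<pi> (\<lambda>p. f (fst p))" "integrable \<pi> (\<lambda>p. f (snd p))"
    using coupling_integral(1,3)[OF \<pi> f] admissible_integrable[OF \<mu> f lip] admissible_integrable[OF \<nu> f lip] by auto
  then show i: "integrable \<pi> (\<lambda>p. f (fst p) - f (snd p))" by simp
  show eq: "(\<integral>p. f (fst p) - f (snd p) \<partial>\<pi>) = (\<integral>x. f x \<partial>\<mu>) - (\<integral>x. f x \<partial>\<nu>)"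
    using int coupling_integral(2,4)[OF \<pi> f] by simp
  have "(\<integral>p. f (fst p) - f (snd p) \<partial>\<pi>) \<le> (\<integral>p. c (fst p) (snd p) \<partial>\<pi>)"
    using couplingD(3)[OF \<pi>] lip by (intro integral_mono i coupling_cost_integrable[OF \<pi>]) auto
  then show "(\<integral>x. f x \<partial>\<mu>) - (\<integral>x. f x \<partial>\<nu>) \<le> (\<integral>p. c (fst p) (snd p) \<partial>\<pi>)" using eq by simp
qed

lemma L_duality_gap:
  assumes \<pi>: "\<pi> \<in> couplings X \<mu> \<nu>" and f: "f \<in> L"
  shows "integrable \<pi> (\<lambda>p. f (fst p) - f (snd p))"
    "(\<integral>p. f (fst p) - f (snd p) \<partial>\<pi>) = (\<integral>x. f x \<partial>\<mu>) - (\<integral>x. f x \<partial>\<nu>)"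
    "(\<integral>x. f x \<partial>\<mu>) - (\<integral>x. f x \<partial>\<nu>) \<le> (\<integral>p. c (fst p) (snd p) \<partial>\<pi>)"
  by (rule lipschitz_duality_gap[OF \<pi> L_measurable[OF f]], erule (1) cost_upper[OF f])+

lemma dual_le_cost:
  assumes \<pi>: "\<pi> \<in> couplings X \<mu> \<nu>"
  shows "dual_value \<le> (\<integral>p. c (fst p) (snd p) \<partial>\<pi>)"
  unfolding dual_value_def
  using L_const L_duality_gap(3)[OF \<pi>]
  by (intro cSUP_least) auto

theorem Kantorovich_duality:
  "(INF \<pi>\<in>couplings X \<mu> \<nu>. cost \<pi>) = ennreal dual_value"
  "\<exists>\<pi>\<in>couplings X \<mu> \<nu>. cost \<pi> = ennreal dual_value"
proof -
  obtain \<pi> where \<pi>: "\<pi> \<in> couplings X \<mu> \<nu>" "cost \<pi> \<le> ennreal dual_value"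
    by (rule exists_coupling_le_dual)
  have ge: "ennreal dual_value \<le> cost \<pi>'" if "\<pi>' \<in> couplings X \<mu> \<nu>" for \<pi>'
    using dual_le_cost[OF that] coupling_cost_integrable(2)[OF that] by (simp add: ennreal_leI)
  show "\<exists>\<pi>\<in>couplings X \<mu> \<nu>. cost \<pi> = ennreal dual_value"
    using \<pi> ge by (intro bexI[of _ \<pi>] antisym) auto
  show "(INF \<pi>\<in>couplings X \<mu> \<nu>. cost \<pi>) = ennreal dual_value"
    using \<pi> ge by (intro antisym INF_greatest) (auto intro: INF_lower2)
qed

lemma cost_eq_dual_iff:
  assumes \<pi>: "\<pi> \<in> couplings X \<mu> \<nu>"
  shows "cost \<pi> = ennreal dual_value \<longleftrightarrow> (\<integral>p. c (fst p) (snd p) \<partial>\<pi>) = dual_value"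
  using dual_le_cost[OF \<pi>] dual_nonneg coupling_cost_integrable(2)[OF \<pi>] by simp

text \<open>Dual candidates within \<open>(1/2) ^ n\<close> of the supremum have gaps with summable
  integrals, so the gaps tend to \<open>0\<close> almost everywhere along the whole sequence. A
  permutation does not change the sum of \<open>f n\<close> over the second coordinates, so the
  inequality for \<open>c\<close> follows in the limit.\<close>

theorem optimal_imp_cyclically_monotonic:
  assumes \<pi>: "\<pi> \<in> couplings X \<mu> \<nu>" and opt: "cost \<pi> = ennreal dual_value"
  shows "\<exists>C\<subseteq>X \<times> X. cyclically_monotonic c C \<and> concentrated_on \<pi> C"
proof -
  note sp = couplingD(3)[OF \<pi>]
  have val: "(\<integral>p. c (fst p) (snd p) \<partial>\<pi>) = dual_value" using cost_eq_dual_iff[OF \<pi>] opt by simp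
  have "\<exists>f\<in>L. dual_value - (1/2) ^ n < (\<integral>x. f x \<partial>\<mu>) - (\<integral>x. f x \<partial>\<nu>)" for n :: nat
  proof -
    have "dual_value - (1/2) ^ n < (SUP f\<in>L. (\<integral>x. f x \<partial>\<mu>) - (\<integral>x. f x \<partial>\<nu>))"
      unfolding dual_value_def[symmetric] by simp
    then show ?thesis using less_cSUP_iff[OF _ dual_bdd] L_const by auto
  qed
  then obtain f where f: "\<And>n :: nat. f n \<in> L" "\<And>n. dual_value - (1/2) ^ n < (\<integral>x. f n x \<partial>\<mu>) - (\<integral>x. f n x \<partial>\<nu>)"
    by metis
  define u where "u n p = c (fst p) (snd p) - (f n (fst p) - f n (snd p))" for n p
  have u_nonneg: "0 \<le> u n p" if "p \<in> X \<times> X" for n p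
  proof -
    have "fst p \<in> X" "snd p \<in> X" using that by auto
    then show ?thesis using cost_upper[OF f(1)] by (simp add: u_def)
  qed
  note gap = L_duality_gap[OF \<pi> f(1)]
  have int: "integrable \<pi> (u n)" for n
    unfolding u_def using coupling_cost_integrable(1)[OF \<pi>] gap(1) by (rule Bochner_Integration.integrable_diff)
  have um[measurable]: "u n \<in> borel_measurable \<pi>" for n using int by (rule borel_measurable_integrable)
  have u_le: "(\<integral>\<^sup>+ p. ennreal (u n p) \<partial>\<pi>) \<le> ennreal ((1/2) ^ n)" for n
  proof -
    have "(\<integral>p. u n p \<partial>\<pi>) = dual_value - ((\<integral>x. f n x \<partial>\<mu>) - (\<integral>x. f n x \<partial>\<nu>))"
      unfolding u_def
      by (subst Bochner_Integration.integral_diff[OF coupling_cost_integrable(1)[OF \<pi>] gap(1)])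
        (simp only: val gap(2))
    then have "(\<integral>p. u n p \<partial>\<pi>) \<le> (1/2) ^ n" using f(2)[of n] by linarith
    moreover have "(\<integral>\<^sup>+ p. ennreal (u n p) \<partial>\<pi>) = ennreal (\<integral>p. u n p \<partial>\<pi>)"
      using sp u_nonneg by (intro nn_integral_eq_integral int AE_I2) simp
    ultimately show ?thesis by (simp add: ennreal_leI)
  qed
  have "(\<integral>\<^sup>+ p. (\<Sum>n. ennreal (u n p)) \<partial>\<pi>) = (\<Sum>n. \<integral>\<^sup>+ p. ennreal (u n p) \<partial>\<pi>)"
    by (intro nn_integral_suminf) auto
  also have "\<dots> \<le> (\<Sum>n. ennreal ((1/2) ^ n))" by (intro suminf_le u_le) auto
  also have "\<dots> = ennreal (1 / (1 - 1/2))" by (intro suminf_ennreal_eq geometric_sums) auto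
  finally have "(\<integral>\<^sup>+ p. (\<Sum>n. ennreal (u n p)) \<partial>\<pi>) \<noteq> \<infinity>" by (auto simp: top_unique)
  then have AE: "AE p in \<pi>. (\<Sum>n. ennreal (u n p)) \<noteq> \<infinity>"
    by (intro nn_integral_PInf_AE) auto
  \<comment> \<open>Finiteness of the series of gaps defines a measurable set directly and forces
    the gaps to tend to \<open>0\<close> at each of its points.\<close>
  define C where "C = {p\<in>space \<pi>. (\<Sum>n. ennreal (u n p)) \<noteq> \<infinity>}"
  have CM: "C \<in> sets \<pi>" unfolding C_def by measurable
  have CX: "C \<subseteq> X \<times> X" unfolding C_def sp by auto
  have "emeasure \<pi> (space \<pi> - C) = 0"
    using AE by (subst (asm) AE_iff_measurable[where N="space \<pi> - C"]) (use CM in \<open>auto simp: C_def\<close>)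
  then have conc: "concentrated_on \<pi> C"
    unfolding concentrated_on_def using CM by simp
  have lim: "(\<lambda>n. u n p) \<longlonglongrightarrow> 0" if "p \<in> C" for p
  proof (rule summable_LIMSEQ_zero, rule summable_suminf_not_top)
    show "0 \<le> u n p" for n using u_nonneg CX that by auto
  qed (use that in \<open>simp add: C_def\<close>)
  have "cyclically_monotonic c C"
    unfolding cyclically_monotonic_def
  proof (intro allI impI)
    fix N \<xi> \<eta> \<sigma>
    assume "(\<forall>k\<in>{1..N}. (\<xi> k, \<eta> k) \<in> C) \<and> \<sigma> permutes {1..N}"
    then have mem: "\<And>k. k \<in> {1..N} \<Longrightarrow> (\<xi> k, \<eta> k) \<in> C" and \<sigma>: "\<sigma> permutes {1..N}" by auto
    have mX: "\<xi> k \<in> X" "\<eta> k \<in> X" if "k \<in> {1..N}" for k using mem[OF that] CX by auto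
    have "(\<lambda>n. \<Sum>k=1..N. c (\<xi> k) (\<eta> k) - u n (\<xi> k, \<eta> k)) \<longlonglongrightarrow> (\<Sum>k=1..N. c (\<xi> k) (\<eta> k) - 0)"
      by (intro tendsto_sum tendsto_diff tendsto_const lim mem)
    moreover have "(\<Sum>k=1..N. c (\<xi> k) (\<eta> k) - u n (\<xi> k, \<eta> k)) \<le> (\<Sum>k=1..N. c (\<xi> k) (\<eta> (\<sigma> k)))" for n
    proof -
      have "(\<Sum>k=1..N. c (\<xi> k) (\<eta> k) - u n (\<xi> k, \<eta> k)) = (\<Sum>k=1..N. f n (\<xi> k)) - (\<Sum>k=1..N. f n (\<eta> k))"
        by (simp add: u_def sum_subtractf)
      also have "(\<Sum>k=1..N. f n (\<eta> k)) = (\<Sum>k=1..N. f n (\<eta> (\<sigma> k)))"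
        using sum.permute[OF \<sigma>, of "\<lambda>k. f n (\<eta> k)"] by (simp add: o_def)
      also have "(\<Sum>k=1..N. f n (\<xi> k)) - (\<Sum>k=1..N. f n (\<eta> (\<sigma> k))) = (\<Sum>k=1..N. f n (\<xi> k) - f n (\<eta> (\<sigma> k)))"
        by (simp add: sum_subtractf)
      also have "\<dots> \<le> (\<Sum>k=1..N. c (\<xi> k) (\<eta> (\<sigma> k)))"
        using mX permutes_in_image[OF \<sigma>] by (intro sum_mono cost_upper f) auto
      finally show ?thesis .
    qed
    ultimately show "(\<Sum>k=1..N. c (\<xi> k) (\<eta> k)) \<le> (\<Sum>k=1..N. c (\<xi> k) (\<eta> (\<sigma> k)))"
      using LIMSEQ_le_const2 by fastforce
  qed
  then show ?thesis using CX conc by blast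
qed

text \<open>\<open>C\<close> is measurable only for the completion; its main part is a subset of
  full measure that is measurable for \<open>M\<close> itself.\<close>

lemma concentrated_onE:
  assumes "prob_space M" "concentrated_on M C"
  obtains S where "S \<in> sets M" "S \<subseteq> C" "measure M S = 1"
proof -
  interpret prob_space M by fact
  have C: "C \<in> sets (completion M)" "emeasure (completion M) (space M - C) = 0"
    using assms(2) by (auto simp: concentrated_on_def)
  have Csp: "C \<subseteq> space (completion M)" using sets.sets_into_space[OF C(1)] .
  have "space M = C \<union> (space M - C)" using Csp by auto
  have "emeasure (completion M) C + emeasure (completion M) (space M - C) =
      emeasure (completion M) (C \<union> (space M - C))"
    using C(1) sets.compl_sets[OF C(1)] by (intro plus_emeasure) auto
  also have "C \<union> (space M - C) = space M" using Csp by auto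
  also have "emeasure (completion M) (space M) = 1" by (simp add: emeasure_space_1)
  finally have "emeasure M (main_part M C) = 1" using C by simp
  moreover have "main_part M C \<subseteq> C" using main_part_null_part_Un[OF C(1)] by auto
  ultimately show thesis using that[of "main_part M C"] C(1) by (simp add: emeasure_eq_measure)
qed

text \<open>Lusin's theorem exhausts a measurable part of \<open>C\<close> by sets on which the
  chain potential can be built. The contact property then holds almost everywhere, so the cost of
  \<open>\<pi>\<close> is at most the dual value of the potential.\<close>

theorem cyclically_monotonic_imp_optimal:
  assumes \<pi>: "\<pi> \<in> couplings X \<mu> \<nu>" and C: "C \<subseteq> X \<times> X" "cyclically_monotonic c C" "concentrated_on \<pi> C"
  shows "cost \<pi> = ennreal dual_value"
proof -
  interpret \<pi>: prob_space \<pi> by (rule couplingD(2)[OF \<pi>])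
  obtain S where S: "S \<in> sets \<pi>" "S \<subseteq> C" "measure \<pi> S = 1"
    using concentrated_onE[OF couplingD(2)[OF \<pi>] C(3)] .
  have "S \<noteq> {}" using S(3) by auto
  then obtain p0 where p0: "p0 \<in> S" by auto
  define cc where "cc = (\<lambda>p. c (fst p) (snd p))"
  have ccm: "cc \<in> borel_measurable \<pi>"
    using coupling_cost_integrable(1)[OF \<pi>] unfolding cc_def by (rule borel_measurable_integrable)
  have "\<exists>K. usc_compact cc K \<and> K \<subseteq> S \<and> measure \<pi> (S - K) < 1 / real (Suc m)" for m
    by (rule Lusin_usc[OF couplingD(1)[OF \<pi>] borel_XX ccm S(1), of "1 / real (Suc m)"]) auto
  then obtain K where K: "\<And>m. usc_compact cc (K m)" "\<And>m. K m \<subseteq> S" "\<And>m. measure \<pi> (S - K m) < 1 / real (Suc m)"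
    by metis
  \<comment> \<open>Finite unions make the sequence increasing, and the added point
    \<open>p0\<close> gives all chains a common start.\<close>
  define \<Gamma> where "\<Gamma> m = {p0} \<union> (\<Union>j\<le>m. K j)" for m
  have \<Gamma>_usc: "usc_compact cc (\<Gamma> m)" for m
    unfolding \<Gamma>_def by (intro usc_compact_Un usc_compact_singleton usc_compact_UN K) auto
  have \<Gamma>_S: "\<Gamma> m \<subseteq> S" for m using K(2) p0 by (auto simp: \<Gamma>_def)
  have \<Gamma>_inc: "incseq \<Gamma>" by (auto simp: \<Gamma>_def incseq_def)
  have \<Gamma>_C: "\<Gamma> m \<subseteq> C" and p0_\<Gamma>: "p0 \<in> \<Gamma> m" for m
    using \<Gamma>_S[of m] S(2) by (auto simp: \<Gamma>_def)
  interpret cyclic_exhaustion X L c C \<Gamma> p0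
    by unfold_locales (fact C(2) C(1) \<Gamma>_usc[unfolded cc_def] \<Gamma>_C p0_\<Gamma> \<Gamma>_inc)+
  have \<Gamma>_sets: "\<Gamma> m \<in> sets \<pi>" for m
  proof -
    have "closed (\<Gamma> m)" using \<Gamma>_usc[of m] by (simp add: usc_compact_def compact_imp_closed)
    moreover have "\<Gamma> m \<subseteq> X \<times> X" by (rule order_trans[OF \<Gamma>_C assms(2)])
    ultimately show ?thesis by (simp add: sets_radon_measure_on[OF couplingD(1)[OF \<pi>] borel_XX])
  qed
  have "1 \<le> measure \<pi> (\<Union>m. \<Gamma> m)"
  proof (rule field_le_epsilon)
    fix e :: real assume "0 < e"
    then obtain m where m: "1 / real (Suc m) < e" using nat_approx_posE by blast
    have "1 = measure \<pi> S" using S by simp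
    also have "\<dots> \<le> measure \<pi> ((S - \<Gamma> m) \<union> (\<Union>m. \<Gamma> m))"
      using S(1) \<Gamma>_sets by (intro \<pi>.finite_measure_mono) auto
    also have "\<dots> \<le> measure \<pi> (S - \<Gamma> m) + measure \<pi> (\<Union>m. \<Gamma> m)"
      using S(1) \<Gamma>_sets by (intro measure_Un_le) auto
    also have "measure \<pi> (S - \<Gamma> m) \<le> measure \<pi> (S - K m)"
    proof (rule \<pi>.finite_measure_mono)
      have "closed (K m)" using K(1)[of m] by (simp add: usc_compact_def compact_imp_closed)
      moreover have "K m \<subseteq> X \<times> X" by (rule order_trans[OF order_trans[OF K(2) S(2)] assms(2)])
      ultimately have "K m \<in> sets \<pi>" by (simp add: sets_radon_measure_on[OF couplingD(1)[OF \<pi>] borel_XX])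
      then show "S - K m \<in> sets \<pi>" using S(1) by auto
    qed (auto simp: \<Gamma>_def)
    finally show "1 \<le> measure \<pi> (\<Union>m. \<Gamma> m) + e" using K(3)[of m] m by linarith
  qed
  then have "measure \<pi> (\<Union>m. \<Gamma> m) = 1" using \<pi>.prob_le_1[of "\<Union>m. \<Gamma> m"] by linarith
  moreover have "(\<Union>m. \<Gamma> m) \<in> sets \<pi>" using \<Gamma>_sets by auto
  ultimately have "AE p in \<pi>. p \<in> (\<Union>m. \<Gamma> m)" by (subst \<pi>.AE_in_set_eq_1)
  then have AE: "AE p in \<pi>. c (fst p) (snd p) \<le> potential (fst p) - potential (snd p)"
    by eventually_elim (use potential_contact in blast)
  have gap: "integrable \<pi>' (\<lambda>p. potential (fst p) - potential (snd p))"
    "(\<integral>p. potential (fst p) - potential (snd p) \<partial>\<pi>') = (\<integral>x. potential x \<partial>\<mu>) - (\<integral>x. potential x \<partial>\<nu>)"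
    "(\<integral>x. potential x \<partial>\<mu>) - (\<integral>x. potential x \<partial>\<nu>) \<le> (\<integral>p. c (fst p) (snd p) \<partial>\<pi>')"
    if "\<pi>' \<in> couplings X \<mu> \<nu>" for \<pi>'
    by (rule lipschitz_duality_gap[OF that potential_measurable], erule (1) potential_lipschitz)+
  have "(\<integral>p. c (fst p) (snd p) \<partial>\<pi>) \<le> (\<integral>p. potential (fst p) - potential (snd p) \<partial>\<pi>)"
    using coupling_cost_integrable(1)[OF \<pi>] gap(1)[OF \<pi>] AE by (intro integral_mono_AE)
  then have le: "(\<integral>p. c (fst p) (snd p) \<partial>\<pi>) \<le> (\<integral>x. potential x \<partial>\<mu>) - (\<integral>x. potential x \<partial>\<nu>)"
    using gap(2)[OF \<pi>] by simp
  obtain \<pi>' where \<pi>': "\<pi>' \<in> couplings X \<mu> \<nu>" "cost \<pi>' = ennreal dual_value"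
    using Kantorovich_duality(2) by blast
  have "(\<integral>x. potential x \<partial>\<mu>) - (\<integral>x. potential x \<partial>\<nu>) \<le> dual_value"
    using gap(3)[OF \<pi>'(1)] cost_eq_dual_iff[OF \<pi>'(1)] \<pi>'(2) by simp
  then show ?thesis using le dual_le_cost[OF \<pi>] cost_eq_dual_iff[OF \<pi>] by simp
qed

end

section \<open>The Samuel compactification\<close>

text \<open>The compactification extends only bounded functions, so a Lipschitz \<open>f\<close> is extended as
  \<open>tan \<circ> g\<close> with \<open>g\<close> the extension of \<open>arctan \<circ> f\<close>.\<close>

definition tan_ext :: "real \<Rightarrow> ereal" where
  "tan_ext t = (if pi/2 \<le> t then \<infinity> else if t \<le> - (pi/2) then -\<infinity> else ereal (tan t))"

lemma tan_ext_arctan: "tan_ext (arctan x) = ereal x"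
  using arctan_bounded[of x] by (auto simp: tan_ext_def tan_arctan)

text \<open>A monotone map between these order topologies is continuous once its range is open, and
  here the range is everything.\<close>

lemma continuous_tan_ext: "continuous_on UNIV tan_ext"
proof (rule continuous_onI_mono)
  have "y \<in> range tan_ext" for y
  proof (cases y)
    case (real r)
    then show ?thesis using tan_ext_arctan[of r] by (metis rangeI)
  next
    case PInf
    have "tan_ext (pi/2) = \<infinity>" by (simp add: tan_ext_def)
    then show ?thesis using PInf by (metis rangeI)
  next
    case MInf
    have "tan_ext (- (pi/2)) = -\<infinity>" using pi_gt_zero by (simp add: tan_ext_def del: pi_gt_zero)
    then show ?thesis using MInf by (metis rangeI)
  qed
  then have "range tan_ext = UNIV" by blast
  then show "open (range tan_ext)" by simp
  fix s t :: real assume "s \<le> t"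
  then show "tan_ext s \<le> tan_ext t" using tan_mono_le[of s t] by (auto simp: tan_ext_def)
qed

lemma arctan_lipschitz: "\<bar>arctan x - arctan y\<bar> \<le> \<bar>x - y\<bar>"
proof -
  have "norm (arctan x - arctan y) \<le> 1 * norm (x - y)"
  proof (rule field_differentiable_bound[of UNIV])
    show "(arctan has_field_derivative inverse (1 + t\<^sup>2)) (at t within UNIV)" for t
      using DERIV_arctan[of t] by simp
    show "norm (inverse (1 + t\<^sup>2)) \<le> 1" for t :: real
      using zero_le_power2[of t] by (simp add: norm_inverse inverse_le_1_iff abs_of_nonneg)
  qed auto
  then show ?thesis by simp
qed

lemma lipschitz_on_max_real:
  fixes f g :: "'a::metric_space \<Rightarrow> real"
  assumes "K-lipschitz_on A f" "K-lipschitz_on A g"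
  shows "K-lipschitz_on A (\<lambda>x. max (f x) (g x))"
proof (rule lipschitz_onI)
  fix x y assume xy: "x \<in> A" "y \<in> A"
  show "dist (max (f x) (g x)) (max (f y) (g y)) \<le> K * dist x y"
    using lipschitz_onD[OF assms(1) xy] lipschitz_onD[OF assms(2) xy] by (auto simp: dist_real_def max_def)
qed (use assms lipschitz_on_nonneg in blast)

text \<open>Every difference quotient is a lower bound of the admissible constants, so their infimum
  is itself a Lipschitz constant. The assumption keeps the set under \<open>Inf\<close>
  nonempty.\<close>

lemma lip_norm_le_1_iff:
  fixes f :: "'a::metric_space \<Rightarrow> real"
  assumes "L-lipschitz_on UNIV f"
  shows "lip_norm f \<le> 1 \<longleftrightarrow> 1-lipschitz_on UNIV f"
proof
  assume le: "lip_norm f \<le> 1"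
  show "1-lipschitz_on UNIV f"
  proof (rule lipschitz_onI)
    fix x y
    show "dist (f x) (f y) \<le> 1 * dist x y"
    proof (cases "x = y")
      case False
      have "dist (f x) (f y) / dist x y \<le> Inf {L. L-lipschitz_on UNIV f}"
        using assms False by (intro cInf_greatest) (auto simp: divide_le_eq dest: lipschitz_onD)
      then have "dist (f x) (f y) / dist x y \<le> 1" using le by (simp add: lip_norm_def)
      then show ?thesis using False by (simp add: divide_le_eq)
    qed simp
  qed simp
next
  assume "1-lipschitz_on UNIV f"
  then show "lip_norm f \<le> 1"
    unfolding lip_norm_def by (intro cInf_lower bdd_belowI[of _ 0]) (auto dest: lipschitz_on_nonneg)
qed

section \<open>Extensions of Lipschitz functions to the finite part\<close>

locale samuel_compactification =
  fixes \<iota> :: "'a::metric_space \<Rightarrow> 'u::t2_space" and z :: 'a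
  assumes uniform_compactification: "uniform_compactification \<iota>"
begin

lemma compact_UNIV: "compact (UNIV :: 'u set)"
  and dense: "closure (range \<iota>) = UNIV"
  using uniform_compactification by (auto simp: uniform_compactification_def compactification_def)

lemma open_meets_range: "open V \<Longrightarrow> V \<noteq> {} \<Longrightarrow> \<exists>x. \<iota> x \<in> V"
  using dense open_Int_closure_eq_empty[of V "range \<iota>"] by auto

lemma extension_unique:
  fixes g h :: "'u \<Rightarrow> 'c::t2_space"
  assumes "continuous_on UNIV g" "continuous_on UNIV h" "\<And>x. g (\<iota> x) = h (\<iota> x)"
  shows "g = h"
proof -
  have "closed {\<xi>. g \<xi> = h \<xi>}" using assms(1,2) by (rule closed_Collect_eq)
  moreover have "range \<iota> \<subseteq> {\<xi>. g \<xi> = h \<xi>}" using assms(3) by auto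
  ultimately have "closure (range \<iota>) \<subseteq> {\<xi>. g \<xi> = h \<xi>}" by (intro closure_minimal)
  then show ?thesis using dense by auto
qed

lemma extU_props:
  assumes f: "K-lipschitz_on UNIV f"
  shows "continuous_on UNIV (extU \<iota> f)" "extU \<iota> f (\<iota> x) = ereal (f x)"
proof -
  have "uniformly_continuous_on UNIV (\<lambda>x. arctan (f x))"
  proof (rule lipschitz_on_uniformly_continuous)
    show "K-lipschitz_on UNIV (\<lambda>x. arctan (f x))"
      using order_trans[OF arctan_lipschitz] lipschitz_onD[OF f] lipschitz_on_nonneg[OF f]
      by (intro lipschitz_onI) (simp_all add: dist_real_def)
  qed
  moreover have "bounded (range (\<lambda>x. arctan (f x)))"
  proof (rule boundedI[of _ "pi/2"])
    fix y assume "y \<in> range (\<lambda>x. arctan (f x))"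
    then obtain x where "y = arctan (f x)" by blast
    then show "norm y \<le> pi/2" using arctan_bounded[of "f x"] unfolding real_norm_def by linarith
  qed
  ultimately obtain g0 :: "'u \<Rightarrow> real" where g0: "continuous_on UNIV g0" "\<forall>x. g0 (\<iota> x) = arctan (f x)"
    using uniform_compactification unfolding uniform_compactification_def by blast
  define g where "g \<xi> = tan_ext (g0 \<xi>)" for \<xi>
  have g: "continuous_on UNIV g" "\<forall>x. g (\<iota> x) = ereal (f x)"
    unfolding g_def using g0 continuous_on_compose2[OF continuous_tan_ext g0(1)] by (auto simp: tan_ext_arctan)
  have "\<exists>!g. continuous_on UNIV g \<and> (\<forall>x. g (\<iota> x) = ereal (f x))"
  proof (rule ex1I[of _ g])
    show "h = g" if "continuous_on UNIV h \<and> (\<forall>x. h (\<iota> x) = ereal (f x))" for h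
      using that g by (intro extension_unique) auto
  qed (use g in auto)
  from theI'[OF this]
  show "continuous_on UNIV (extU \<iota> f)" "extU \<iota> f (\<iota> x) = ereal (f x)"
    unfolding extU_def by auto
qed

abbreviation X :: "'u set" where "X \<equiv> MR \<iota> z"

lemma dist_lipschitz: "1-lipschitz_on UNIV (\<lambda>x. dist x z)"
  by (rule lipschitz_onI) (auto simp: dist_real_def abs_le_iff algebra_simps intro: dist_triangle dist_triangle3 dist_triangle2)

lemma open_X: "open X"
  unfolding MR_def by (intro open_Collect_less extU_props[OF dist_lipschitz] continuous_on_const)

text \<open>The open set where the extended distance is below \<open>n\<close> meets the dense image
  only in points of the ball. Finiteness of this one extension thereby bounds the extensions of all
  Lipschitz functions.\<close>

lemma X_closure_ball:
  assumes "\<xi> \<in> X"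
  obtains n :: nat where "\<xi> \<in> closure (\<iota> ` {x. dist x z < real n})"
proof -
  have "extU \<iota> (\<lambda>x. dist x z) \<xi> \<noteq> \<infinity>" using assms by (auto simp: MR_def)
  then obtain n where n: "extU \<iota> (\<lambda>x. dist x z) \<xi> < ereal (real n)"
    using less_PInf_Ex_of_nat by blast
  define W where "W = {\<eta>. extU \<iota> (\<lambda>x. dist x z) \<eta> < ereal (real n)}"
  have "open W" unfolding W_def
    by (intro open_Collect_less extU_props[OF dist_lipschitz] continuous_on_const)
  then have "W \<inter> closure (range \<iota>) \<subseteq> closure (W \<inter> range \<iota>)" by (rule open_Int_closure_subset)
  then have "\<xi> \<in> closure (W \<inter> range \<iota>)" using n dense by (auto simp: W_def)
  moreover have "W \<inter> range \<iota> \<subseteq> \<iota> ` {x. dist x z < real n}"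
    by (auto simp: W_def extU_props(2)[OF dist_lipschitz])
  ultimately show thesis using that closure_mono by blast
qed

lemma extU_bounds:
  assumes f: "K-lipschitz_on UNIV f" and \<xi>: "\<xi> \<in> closure (\<iota> ` {x. dist x z < r})"
  shows "ereal (f z - K * r) \<le> extU \<iota> f \<xi>" "extU \<iota> f \<xi> \<le> ereal (f z + K * r)"
proof -
  note ext = extU_props[OF f]
  have "\<iota> ` {x. dist x z < r} \<subseteq> {\<eta>. ereal (f z - K * r) \<le> extU \<iota> f \<eta>} \<inter> {\<eta>. extU \<iota> f \<eta> \<le> ereal (f z + K * r)}"
  proof (intro subsetI)
    fix \<eta> assume "\<eta> \<in> \<iota> ` {x. dist x z < r}"
    then obtain x where x: "dist x z < r" "\<eta> = \<iota> x" by auto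
    have "\<bar>f x - f z\<bar> \<le> K * dist x z" using lipschitz_onD[OF f, of x z] by (simp add: dist_real_def)
    also have "\<dots> \<le> K * r" using x lipschitz_on_nonneg[OF f] by (intro mult_left_mono) auto
    finally show "\<eta> \<in> {\<eta>. ereal (f z - K * r) \<le> extU \<iota> f \<eta>} \<inter> {\<eta>. extU \<iota> f \<eta> \<le> ereal (f z + K * r)}"
      by (auto simp: x(2) ext(2))
  qed
  moreover have "closed ({\<eta>. ereal (f z - K * r) \<le> extU \<iota> f \<eta>} \<inter> {\<eta>. extU \<iota> f \<eta> \<le> ereal (f z + K * r)})"
    by (intro closed_Int closed_Collect_le ext(1) continuous_on_const)
  ultimately have "closure (\<iota> ` {x. dist x z < r}) \<subseteq>
      {\<eta>. ereal (f z - K * r) \<le> extU \<iota> f \<eta>} \<inter> {\<eta>. extU \<iota> f \<eta> \<le> ereal (f z + K * r)}"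
    by (rule closure_minimal)
  then show "ereal (f z - K * r) \<le> extU \<iota> f \<xi>" "extU \<iota> f \<xi> \<le> ereal (f z + K * r)" using \<xi> by auto
qed

lemma extU_finite:
  assumes "K-lipschitz_on UNIV f" "\<xi> \<in> X"
  shows "\<bar>extU \<iota> f \<xi>\<bar> \<noteq> \<infinity>"
proof -
  obtain n :: nat where "\<xi> \<in> closure (\<iota> ` {x. dist x z < real n})" using X_closure_ball[OF assms(2)] .
  from extU_bounds[OF assms(1) this] show ?thesis by auto
qed

lemma extR_\<iota>: "K-lipschitz_on UNIV f \<Longrightarrow> extR \<iota> f (\<iota> x) = f x"
  by (simp add: extR_def extU_props)

lemma extR_continuous:
  assumes "K-lipschitz_on UNIV f"
  shows "continuous_on X (extR \<iota> f)"
proof -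
  have "continuous_on X (extU \<iota> f)" using extU_props(1)[OF assms] by (rule continuous_on_subset) simp
  then have "continuous_on X (real_of_ereal \<circ> extU \<iota> f)"
    using continuous_on_iff_real[of X "extU \<iota> f"] extU_finite[OF assms] by blast
  then show ?thesis by (simp add: extR_def[abs_def] o_def)
qed

text \<open>As \<open>X\<close> is open, the set where the two functions differ is open in the
  compact space and would contain a point of the dense image. The algebraic rules for
  \<open>extR\<close> on \<open>X\<close> follow from this.\<close>

lemma extR_unique:
  assumes f: "K-lipschitz_on UNIV f" and F: "continuous_on X F" "\<And>x. F (\<iota> x) = f x" and \<xi>: "\<xi> \<in> X"
  shows "extR \<iota> f \<xi> = F \<xi>"
proof (rule ccontr)
  assume "extR \<iota> f \<xi> \<noteq> F \<xi>"
  have "closedin (top_of_set X) {\<eta>\<in>X. extR \<iota> f \<eta> - F \<eta> = 0}"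
    using extR_continuous[OF f] F(1) by (intro continuous_closedin_preimage_constant continuous_on_diff)
  then have "openin (top_of_set X) (X - {\<eta>\<in>X. extR \<iota> f \<eta> - F \<eta> = 0})"
    by (intro openin_diff) auto
  then have "open (X - {\<eta>\<in>X. extR \<iota> f \<eta> - F \<eta> = 0})" using open_X openin_open_eq by blast
  moreover have "\<xi> \<in> X - {\<eta>\<in>X. extR \<iota> f \<eta> - F \<eta> = 0}" using \<xi> \<open>extR \<iota> f \<xi> \<noteq> F \<xi>\<close> by simp
  ultimately obtain x where "\<iota> x \<in> X - {\<eta>\<in>X. extR \<iota> f \<eta> - F \<eta> = 0}" using open_meets_range by blast
  then show False using extR_\<iota>[OF f] F(2) by auto
qed

text \<open>The bound is uniform in \<open>f\<close>, so the supremum defining \<open>dbar\<close>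
  on \<open>X\<close> is finite.\<close>

lemma extR_bounded:
  assumes "\<xi> \<in> X"
  obtains B where "\<And>f. 1-lipschitz_on UNIV f \<Longrightarrow> f z = 0 \<Longrightarrow> \<bar>extR \<iota> f \<xi>\<bar> \<le> B"
proof -
  obtain n :: nat where n: "\<xi> \<in> closure (\<iota> ` {x. dist x z < real n})" using X_closure_ball[OF assms] .
  have "\<bar>extR \<iota> f \<xi>\<bar> \<le> real n" if f: "1-lipschitz_on UNIV f" "f z = 0" for f
  proof -
    have "extU \<iota> f \<xi> = ereal (extR \<iota> f \<xi>)"
      using extU_finite[OF f(1) assms] by (simp add: extR_def ereal_real)
    then show ?thesis using extU_bounds[OF f(1) n] f(2) by (simp add: abs_le_iff)
  qed
  then show thesis using that by blast
qed

lemma lipschitz_uminus: "1-lipschitz_on UNIV f \<Longrightarrow> 1-lipschitz_on UNIV (\<lambda>x. - f x :: real)"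
  by (rule lipschitz_onI) (auto dest: lipschitz_onD simp: dist_minus)

lemma lipschitz_shift: "1-lipschitz_on UNIV f \<Longrightarrow> 1-lipschitz_on UNIV (\<lambda>x. f x + a :: real)"
  by (rule lipschitz_onI) (auto dest: lipschitz_onD simp: dist_real_def)

lemma lipschitz_const: "1-lipschitz_on UNIV (\<lambda>_. a :: real)"
  by (rule lipschitz_onI) auto

lemma extR_uminus:
  assumes "1-lipschitz_on UNIV f" "\<xi> \<in> X"
  shows "extR \<iota> (\<lambda>x. - f x) \<xi> = - extR \<iota> f \<xi>"
  using extR_\<iota>[OF assms(1)] extR_continuous[OF assms(1)]
  by (intro extR_unique[OF lipschitz_uminus[OF assms(1)] _ _ assms(2)]) (auto intro: continuous_on_minus)

lemma extR_shift:
  assumes "1-lipschitz_on UNIV f" "\<xi> \<in> X"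
  shows "extR \<iota> (\<lambda>x. f x + a) \<xi> = extR \<iota> f \<xi> + a"
  using extR_\<iota>[OF assms(1)] extR_continuous[OF assms(1)]
  by (intro extR_unique[OF lipschitz_shift[OF assms(1)] _ _ assms(2)]) (auto intro!: continuous_on_add continuous_on_const)

lemma extR_max:
  assumes "1-lipschitz_on UNIV f" "1-lipschitz_on UNIV g" "\<xi> \<in> X"
  shows "extR \<iota> (\<lambda>x. max (f x) (g x)) \<xi> = max (extR \<iota> f \<xi>) (extR \<iota> g \<xi>)"
  using extR_\<iota>[OF assms(1)] extR_continuous[OF assms(1)] extR_\<iota>[OF assms(2)] extR_continuous[OF assms(2)]
  by (intro extR_unique[OF lipschitz_on_max_real[OF assms(1,2)] _ _ assms(3)]) (auto intro: continuous_on_max)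

lemma extR_const: "\<xi> \<in> X \<Longrightarrow> extR \<iota> (\<lambda>_. a) \<xi> = a"
  by (rule extR_unique[OF lipschitz_const]) (auto intro: continuous_on_const)

lemma unit_ball_Lip0: "{f \<in> Lip0 z. lip_norm f \<le> 1} = {f. f z = 0 \<and> 1-lipschitz_on UNIV f}"
  using lip_norm_le_1_iff by (auto simp: Lip0_def)

lemma dbar_eq: "dbar \<iota> z \<xi> \<eta> = (SUP f\<in>{f. f z = 0 \<and> 1-lipschitz_on UNIV f}. \<bar>extR \<iota> f \<xi> - extR \<iota> f \<eta>\<bar>)"
  by (simp add: dbar_def dual_norm_def unit_ball_Lip0 delta_def)

lemma dbar_bdd:
  assumes "\<xi> \<in> X" "\<eta> \<in> X"
  shows "bdd_above ((\<lambda>f. \<bar>extR \<iota> f \<xi> - extR \<iota> f \<eta>\<bar>) ` {f. f z = 0 \<and> 1-lipschitz_on UNIV f})"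
proof -
  obtain B where B: "\<And>f. 1-lipschitz_on UNIV f \<Longrightarrow> f z = 0 \<Longrightarrow> \<bar>extR \<iota> f \<xi>\<bar> \<le> B"
    using extR_bounded[OF assms(1)] by metis
  obtain B' where B': "\<And>f. 1-lipschitz_on UNIV f \<Longrightarrow> f z = 0 \<Longrightarrow> \<bar>extR \<iota> f \<eta>\<bar> \<le> B'"
    using extR_bounded[OF assms(2)] by metis
  show ?thesis
  proof (rule bdd_aboveI2[of _ _ "B + B'"])
    fix f :: "'a \<Rightarrow> real" assume "f \<in> {f. f z = 0 \<and> 1-lipschitz_on UNIV f}"
    then have "\<bar>extR \<iota> f \<xi>\<bar> \<le> B" "\<bar>extR \<iota> f \<eta>\<bar> \<le> B'" using B B' by auto
    then show "\<bar>extR \<iota> f \<xi> - extR \<iota> f \<eta>\<bar> \<le> B + B'" by linarith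
  qed
qed

lemma dbar_upper:
  assumes "1-lipschitz_on UNIV f" "\<xi> \<in> X" "\<eta> \<in> X"
  shows "extR \<iota> f \<xi> - extR \<iota> f \<eta> \<le> dbar \<iota> z \<xi> \<eta>"
proof -
  \<comment> \<open>Subtracting \<open>f z\<close> puts the function into \<open>Lip0\<close>
    without changing differences of values.\<close>
  let ?g = "\<lambda>x. f x + (- f z)"
  have "extR \<iota> f \<xi> - extR \<iota> f \<eta> \<le> \<bar>extR \<iota> ?g \<xi> - extR \<iota> ?g \<eta>\<bar>"
    using assms by (simp only: extR_shift)
  also have "\<dots> \<le> dbar \<iota> z \<xi> \<eta>"
    unfolding dbar_eq using lipschitz_shift[OF assms(1), of "- f z"]
    by (intro cSUP_upper[OF _ dbar_bdd[OF assms(2,3)]]) simp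
  finally show ?thesis .
qed

text \<open>Passing from \<open>f\<close> to \<open>- f\<close> removes the absolute value in the
  dual norm.\<close>

lemma dbar_approx:
  assumes "\<xi> \<in> X" "\<eta> \<in> X" "a < dbar \<iota> z \<xi> \<eta>"
  obtains f where "1-lipschitz_on UNIV f" "a < extR \<iota> f \<xi> - extR \<iota> f \<eta>"
proof -
  have "(\<lambda>_. 0) \<in> {f :: 'a \<Rightarrow> real. f z = 0 \<and> 1-lipschitz_on UNIV f}" using lipschitz_const by simp
  then have ne: "{f :: 'a \<Rightarrow> real. f z = 0 \<and> 1-lipschitz_on UNIV f} \<noteq> {}" by (metis empty_iff)
  obtain f where f: "1-lipschitz_on UNIV f" "a < \<bar>extR \<iota> f \<xi> - extR \<iota> f \<eta>\<bar>"
    using assms(3)[unfolded dbar_eq less_cSUP_iff[OF ne dbar_bdd[OF assms(1,2)]]] by auto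
  show thesis
  proof (cases "0 \<le> extR \<iota> f \<xi> - extR \<iota> f \<eta>")
    case True
    then show thesis using f that by simp
  next
    case False
    then show thesis
      using f that[OF lipschitz_uminus[OF f(1)]] extR_uminus[OF f(1)] assms(1,2) by simp
  qed
qed

text \<open>Membership ignores values off \<open>X\<close>. There \<open>extR\<close> converts
  infinities to \<open>0\<close>, and an identity such as the one for \<open>f + a\<close> fails, so
  the set of all \<open>extR \<iota> f\<close> alone would not have the required closure
  properties.\<close>

definition L :: "('u \<Rightarrow> real) set" where
  "L = {F. \<exists>f. 1-lipschitz_on UNIV f \<and> (\<forall>\<xi>\<in>X. F \<xi> = extR \<iota> f \<xi>)}"

sublocale lattice_cost X L "dbar \<iota> z"
proof
  show "compact (UNIV :: 'u set)" by (rule compact_UNIV)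
  show "open X" by (rule open_X)
  show "continuous_on X F" if "F \<in> L" for F
  proof -
    from that obtain f where f: "1-lipschitz_on UNIV f" "\<forall>\<xi>\<in>X. F \<xi> = extR \<iota> f \<xi>" by (auto simp: L_def)
    then show ?thesis using extR_continuous[OF f(1)] continuous_on_cong[OF refl, of X F "extR \<iota> f"] by blast
  qed
  show "(\<lambda>_. a) \<in> L" for a
    unfolding L_def using lipschitz_const[of a] extR_const[of _ a] by auto
  show "(\<lambda>x. - F x) \<in> L" if "F \<in> L" for F
  proof -
    from that obtain f where f: "1-lipschitz_on UNIV f" "\<forall>\<xi>\<in>X. F \<xi> = extR \<iota> f \<xi>" by (auto simp: L_def)
    then show ?thesis
      unfolding L_def using lipschitz_uminus[OF f(1)] extR_uminus[OF f(1)]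
      by (intro CollectI exI[of _ "\<lambda>x. - f x"]) auto
  qed
  show "(\<lambda>x. F x + a) \<in> L" if "F \<in> L" for F a
  proof -
    from that obtain f where f: "1-lipschitz_on UNIV f" "\<forall>\<xi>\<in>X. F \<xi> = extR \<iota> f \<xi>" by (auto simp: L_def)
    then show ?thesis
      unfolding L_def using lipschitz_shift[OF f(1)] extR_shift[OF f(1)]
      by (intro CollectI exI[of _ "\<lambda>x. f x + a"]) auto
  qed
  show "(\<lambda>x. max (F x) (G x)) \<in> L" if F: "F \<in> L" and G: "G \<in> L" for F G
  proof -
    obtain f g where fg: "1-lipschitz_on UNIV f" "\<forall>\<xi>\<in>X. F \<xi> = extR \<iota> f \<xi>"
      "1-lipschitz_on UNIV g" "\<forall>\<xi>\<in>X. G \<xi> = extR \<iota> g \<xi>"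
      using F G unfolding L_def by blast
    then show ?thesis
      unfolding L_def using lipschitz_on_max_real[OF fg(1,3)] extR_max[OF fg(1,3)]
      by (intro CollectI exI[of _ "\<lambda>x. max (f x) (g x)"]) auto
  qed
  show "F \<xi> - F \<eta> \<le> dbar \<iota> z \<xi> \<eta>" if "F \<in> L" "\<xi> \<in> X" "\<eta> \<in> X" for F \<xi> \<eta>
    using that dbar_upper unfolding L_def by auto
  show "\<exists>F\<in>L. a < F \<xi> - F \<eta>" if approx: "\<xi> \<in> X" "\<eta> \<in> X" "a < dbar \<iota> z \<xi> \<eta>" for \<xi> \<eta> a
  proof -
    obtain f where "1-lipschitz_on UNIV f" "a < extR \<iota> f \<xi> - extR \<iota> f \<eta>" using dbar_approx[OF approx] .
    then show ?thesis by (intro bexI[of _ "extR \<iota> f"]) (auto simp: L_def)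
  qed
qed

end

theorem corollary4p4:
  fixes \<iota> :: "'a::complete_space \<Rightarrow> 'u::t2_space"
    and z :: 'a
    and \<mu> \<nu> :: "'u measure"
  assumes "uniform_compactification \<iota>"
    and "radon_measure_on (MR \<iota> z) \<mu>" and "prob_space \<mu>" and "finite_first_moment \<iota> z \<mu>"
    and "radon_measure_on (MR \<iota> z) \<nu>" and "prob_space \<nu>" and "finite_first_moment \<iota> z \<nu>"
  shows "enn2ereal (INF \<pi>\<in>couplings (MR \<iota> z) \<mu> \<nu>. transport_cost \<iota> z \<pi>) =
           (SUP f\<in>{f :: 'a \<Rightarrow> real. 1-lipschitz_on UNIV f}.
              ereal ((LINT \<xi>|\<mu>. extR \<iota> f \<xi>) - (LINT \<xi>|\<nu>. extR \<iota> f \<xi>))) \<and>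
         (\<exists>\<pi>\<in>couplings (MR \<iota> z) \<mu> \<nu>. transport_cost \<iota> z \<pi> =
           (INF \<pi>'\<in>couplings (MR \<iota> z) \<mu> \<nu>. transport_cost \<iota> z \<pi>')) \<and>
         (\<forall>\<pi>\<in>couplings (MR \<iota> z) \<mu> \<nu>.
           transport_cost \<iota> z \<pi> = (INF \<pi>'\<in>couplings (MR \<iota> z) \<mu> \<nu>. transport_cost \<iota> z \<pi>') \<longleftrightarrow>
           (\<exists>C \<subseteq> MR \<iota> z \<times> MR \<iota> z.
              cyclically_monotonic (dbar \<iota> z) C \<and> concentrated_on \<pi> C))"
proof -
  interpret samuel_compactification \<iota> z by unfold_locales (rule assms(1))
  interpret transport_problem X L "dbar \<iota> z" \<mu> \<nu>
    using assms(2-7) by unfold_locales (auto simp: admissible_def finite_first_moment_def)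
  have cost: "transport_cost \<iota> z \<pi> = cost \<pi>" for \<pi> by (simp add: transport_cost_def cost_def)
  have inf: "(INF \<pi>\<in>couplings X \<mu> \<nu>. transport_cost \<iota> z \<pi>) = ennreal dual_value"
    unfolding cost by (rule Kantorovich_duality(1))
  let ?v = "\<lambda>F. (LINT \<xi>|\<mu>. F \<xi>) - (LINT \<xi>|\<nu>. F \<xi>)"
  let ?S = "SUP f\<in>{f. 1-lipschitz_on UNIV f}. ereal (?v (extR \<iota> f))"
  have "?S = ereal dual_value"
  proof (rule antisym)
    show "?S \<le> ereal dual_value"
    proof (rule SUP_least)
      fix f :: "'a \<Rightarrow> real" assume "f \<in> {f. 1-lipschitz_on UNIV f}"
      then have "extR \<iota> f \<in> L" by (auto simp: L_def)
      from dual_upper[OF this] show "ereal (?v (extR \<iota> f)) \<le> ereal dual_value" by simp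
    qed
    \<comment> \<open>Both measures live on \<open>X\<close>, so a member of \<open>L\<close> has
      the same integrals as the extension with which it agrees there.\<close>
    have ge: "ereal (?v F) \<le> ?S" if "F \<in> L" for F
    proof -
      from that obtain f where f: "1-lipschitz_on UNIV f" "\<forall>\<xi>\<in>X. F \<xi> = extR \<iota> f \<xi>" by (auto simp: L_def)
      then have "(LINT \<xi>|\<mu>. F \<xi>) = (LINT \<xi>|\<mu>. extR \<iota> f \<xi>)" "(LINT \<xi>|\<nu>. F \<xi>) = (LINT \<xi>|\<nu>. extR \<iota> f \<xi>)"
        using radon by (auto intro!: Bochner_Integration.integral_cong simp: space_radon_measure_on)
      then show ?thesis using f(1) by (intro SUP_upper2[of f]) auto
    qed
    show "ereal dual_value \<le> ?S"
    proof (cases ?S)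
      case (real s)
      then have "?v F \<le> s" if "F \<in> L" for F using ge[OF that] by simp
      then have "dual_value \<le> s" unfolding dual_value_def using L_const by (intro cSUP_least) auto
      then show ?thesis using real by simp
    next
      case MInf
      then show ?thesis using ge[OF L_const[of 0]] by simp
    qed simp
  qed
  moreover have "enn2ereal (ennreal dual_value) = ereal dual_value"
    using dual_nonneg by (simp add: enn2ereal_ennreal)
  moreover have "cost \<pi> = ennreal dual_value \<longleftrightarrow>
      (\<exists>C \<subseteq> X \<times> X. cyclically_monotonic (dbar \<iota> z) C \<and> concentrated_on \<pi> C)"
    if "\<pi> \<in> couplings X \<mu> \<nu>" for \<pi>
    using optimal_imp_cyclically_monotonic[OF that] cyclically_monotonic_imp_optimal[OF that] by metis
  ultimately show ?thesis
    unfolding inf unfolding cost using Kantorovich_duality(2) by simp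
qed

end
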